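(* Let $E\subset\mathbb{C}$ be a closed set and let $w$ be an admissible weight on $E$. Let $P_1,\dots,P_m$ be polynomials of degrees $n_1,\dots,n_m$ respectively, and $n=\sum_{j=1}^m n_j$. Then \[ \prod_{j=1}^m\|w^{n_j}P_j\|_E \le e^{nC_E^w(m)}\left\|w^n\prod_{j=1}^m P_j\right\|_E \le e^{nC_E^w}\left\|w^n\prod_{j=1}^m P_j\right\|_E, \] where \[ C_E^w(m):=\sup_{c_1,\dots,c_m\in E}\int\log\max_{1\le k\le m} w(c_k)|z-c_k|\,d\mu_w(z)+F_w, \qquad C_E^w:=\int\log d_E^w(z)\,d\mu_w(z)+F_w . \] For each fixed $m\ge 2$, the constant $C_E^w(m)$ cannot be replaced by a smaller value; and $C_E^w$ cannot be replaced by a smaller value independent of $m$.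
   Context: $\|f\|_E:=\sup_{z\in E}|f(z)|$. A weight $w:E\to[0,\infty)$ is admissible if $w$ is upper semicontinuous on $E$, the set $\{z\in E: w(z)>0\}$ has positive logarithmic capacity, and, if $E$ is unbounded, $|z|w(z)\to 0$ as $|z|\to\infty$, $z\in E$. The weighted equilibrium measure $\mu_w$ is the (unique) positive unit Borel measure with compact support $S_w\subset E$, and $F_w$ the (unique) constant, such that $\int\log|z-t|\,d\mu_w(t)+\log w(z)+F_w\ge 0$ for $z\in S_w$ and $\int\log|z-t|\,d\mu_w(t)+\log w(z)+F_w\le 0$ for quasi every $z\in E$ (i.e. except on a set of zero logarithmic capacity); $F_w$ is the modified Robin constant. The weighted farthest-point distance function is $d_E^w(z):=\sup_{t\in E}w(t)|z-t|$, $z\in\mathbb{C}$. *)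

theory Defs
  imports "HOL-Probability.Probability" "HOL-Computational_Algebra.Polynomial"
begin

definition elog :: "real \<Rightarrow> ereal" where
  "elog r = (if r \<le> 0 then -\<infinity> else ereal (ln r))"

definition neglog :: "real \<Rightarrow> ennreal" where
  "neglog r = (if r \<le> 0 then \<infinity> else ennreal (max 0 (- ln r)))"

definition eexp :: "ereal \<Rightarrow> ereal" where
  "eexp x = (case x of ereal r \<Rightarrow> ereal (exp r) | PInfty \<Rightarrow> \<infinity> | MInfty \<Rightarrow> 0)"

text \<open>The integral of log g against mu, for g \<ge> 0 with log g bounded above on the
  (compact) support of mu; its value lies in [-infinity, infinity).\<close>
definition logint :: "complex measure \<Rightarrow> (complex \<Rightarrow> real) \<Rightarrow> ereal" where
  "logint \<mu> g = ereal (\<integral>z. max 0 (ln (g z)) \<partial>\<mu>) - enn2ereal (\<integral>\<^sup>+z. neglog (g z) \<partial>\<mu>)"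

text \<open>finite logarithmic energy: the double integral of log(1/|z-t|) is finite
  (for compactly supported measures only its positive part can diverge)\<close>
definition finite_log_energy :: "complex measure \<Rightarrow> bool" where
  "finite_log_energy \<mu> \<longleftrightarrow> (\<integral>\<^sup>+z. (\<integral>\<^sup>+t. neglog (cmod (z - t)) \<partial>\<mu>) \<partial>\<mu>) < \<infinity>"

definition pos_log_cap :: "complex set \<Rightarrow> bool" where
  "pos_log_cap A \<longleftrightarrow> (\<exists>K \<mu>. compact K \<and> K \<subseteq> A \<and> prob_space \<mu> \<and> sets \<mu> = sets borel
       \<and> emeasure \<mu> K = 1 \<and> finite_log_energy \<mu>)"

definition quasi_every :: "complex set \<Rightarrow> (complex \<Rightarrow> bool) \<Rightarrow> bool" where
  "quasi_every E P \<longleftrightarrow> \<not> pos_log_cap {z \<in> E. \<not> P z}"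

definition admissible_weight :: "complex set \<Rightarrow> (complex \<Rightarrow> real) \<Rightarrow> bool" where
  "admissible_weight E w \<longleftrightarrow>
     (\<forall>z\<in>E. w z \<ge> 0)
   \<and> (\<forall>z\<in>E. \<forall>a. w z < a \<longrightarrow> (\<exists>\<delta>>0. \<forall>t\<in>E. dist t z < \<delta> \<longrightarrow> w t < a))
   \<and> pos_log_cap {z \<in> E. w z > 0}
   \<and> (\<not> bounded E \<longrightarrow> (\<forall>\<epsilon>>0. \<exists>R. \<forall>z\<in>E. cmod z > R \<longrightarrow> cmod z * w z < \<epsilon>))"

definition msupp :: "complex measure \<Rightarrow> complex set" where
  "msupp \<mu> = {z. \<forall>e>0. emeasure \<mu> (ball z e) > 0}"

definition is_weighted_equilibrium ::
    "complex set \<Rightarrow> (complex \<Rightarrow> real) \<Rightarrow> complex measure \<Rightarrow> real \<Rightarrow> bool" where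
  "is_weighted_equilibrium E w \<mu> F \<longleftrightarrow>
     prob_space \<mu> \<and> sets \<mu> = sets borel \<and> compact (msupp \<mu>) \<and> msupp \<mu> \<subseteq> E
   \<and> finite_log_energy \<mu>
   \<and> (\<forall>z\<in>msupp \<mu>. logint \<mu> (\<lambda>t. cmod (z - t)) + elog (w z) + ereal F \<ge> 0)
   \<and> quasi_every E (\<lambda>z. logint \<mu> (\<lambda>t. cmod (z - t)) + elog (w z) + ereal F \<le> 0)"

definition wnorm :: "complex set \<Rightarrow> (complex \<Rightarrow> real) \<Rightarrow> nat \<Rightarrow> complex poly \<Rightarrow> real" where
  "wnorm E w k p = (SUP z\<in>E. w z ^ k * cmod (poly p z))"

definition farthest_dist :: "complex set \<Rightarrow> (complex \<Rightarrow> real) \<Rightarrow> complex \<Rightarrow> real" where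
  "farthest_dist E w z = (SUP t\<in>E. w t * cmod (z - t))"

definition CEwm :: "complex set \<Rightarrow> (complex \<Rightarrow> real) \<Rightarrow> complex measure \<Rightarrow> real \<Rightarrow> nat \<Rightarrow> ereal" where
  "CEwm E w \<mu> F m = (SUP c\<in>{c. \<forall>k<m. c k \<in> E}.
       logint \<mu> (\<lambda>z. Max ((\<lambda>k. w (c k) * cmod (z - c k)) ` {..<m})) + ereal F)"

definition CEw :: "complex set \<Rightarrow> (complex \<Rightarrow> real) \<Rightarrow> complex measure \<Rightarrow> real \<Rightarrow> real" where
  "CEw E w \<mu> F = (\<integral>z. ln (farthest_dist E w z) \<partial>\<mu>) + F"

definition prod_ineq :: "complex set \<Rightarrow> (complex \<Rightarrow> real) \<Rightarrow> nat \<Rightarrow> (nat \<Rightarrow> complex poly) \<Rightarrow> ereal \<Rightarrow> bool" where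
  "prod_ineq E w m P c \<longleftrightarrow>
     (let n = (\<Sum>j<m. degree (P j)) in
       ereal (\<Prod>j<m. wnorm E w (degree (P j)) (P j))
         \<le> eexp (ereal (real n) * c) * ereal (wnorm E w n (\<Prod>j<m. P j)))"

end

theory Submission
  imports
    Defs
    "HOL-Computational_Algebra.Fundamental_Theorem_Algebra"
    "HOL-Complex_Analysis.Complex_Analysis"
begin

text \<open>
  Write \<open>U\<close> for the logarithmic potential of \<open>\<mu>\<close> and \<open>g(z) = max\<^sub>j w(c\<^sub>j) |z - c\<^sub>j|\<close>.

  Upper bound. On the support of \<open>\<mu>\<close> one has \<open>w \<ge> exp(- U - F)\<close>, so by the principle of domination every polynomial
  \<open>P\<close> of degree \<open>n\<close> satisfies \<open>|P| \<le> \<parallel>w\<^sup>n P\<parallel> exp(n (U + F))\<close> on the whole plane. Bounding the factors of the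
  \<open>P\<^sub>j(c\<^sub>j)\<close> by \<open>g\<close> reduces the claim to an estimate for the product of \<open>g\<close> over the zeros of \<open>P = \<Prod> P\<^sub>j\<close>. The power
  \<open>g\<^sup>p\<close> is comparable, up to a factor depending on \<open>m\<close> only, to \<open>|Q|\<close> for a polynomial
  \<open>Q = \<Sum> \<zeta>\<^sub>j (w(c\<^sub>j) (z - c\<^sub>j))\<^sup>p\<close> with suitable unimodular \<open>\<zeta>\<^sub>j\<close>, and for polynomials the estimate is the symmetry of the
  resultant of \<open>P\<close> and \<open>Q\<close>.

  Sharpness. Discretize \<open>\<mu>\<close> to a monic polynomial and add a small proportion of zeros that make it tiny near the set of
  capacity zero where \<open>U + log w + F > 0\<close>; these exist because a compact set without small monic polynomials carries a
  weak limit of Leja points, which has finite energy. Assigning each zero \<open>x\<close> to the index \<open>j\<close> for which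
  \<open>w(c\<^sub>j) |x - c\<^sub>j|\<close> is maximal gives near-extremal \<open>P\<^sub>j\<close>. Finally \<open>C(m)\<close> tends to \<open>C\<close>, since finitely many
  \<open>c\<^sub>j\<close> suffice to approximate the farthest-point distance uniformly on the support of \<open>\<mu>\<close>.
\<close>

section \<open>Products of linear forms on the torus\<close>

text \<open>A direct route to the upper estimate would write \<open>log g\<close> as the potential
  of a unit measure and exchange two integrals. Replacing \<open>g^p\<close> by a polynomial
  \<open>Q\<close> makes that measure discrete: the exchange becomes a finite product, and the
  integral of \<open>log |Q|\<close> against \<open>\<mu>\<close> exceeds \<open>p\<close> times
  that of \<open>log g\<close> by at most \<open>log m\<close>. The obstacle in the principle of
  domination is that \<open>U\<close> is only upper semicontinuous, so \<open>log |P| - n U\<close>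
  need not attain a maximum. Therefore \<open>\<mu>\<close> is first restricted to compact sets of
  nearly full mass with continuous potential, then rescaled to a mass slightly above the degree of
  \<open>P\<close>, which forces decay at infinity; the losses vanish in the limit. Circle means are
  replaced by products over \<open>N\<close>-th roots of unity, where explicit polynomial identities
  are available. Weak limits of planar point masses are found by lifting the points to the unit
  interval through a curve covering the set. For sharpness, truncated potentials serve as continuous
  majorants of \<open>U\<close>, which makes the sets to be repaired compact.\<close>

lemma prod_roots_unity_diff:
  fixes x y :: complex
  assumes "N \<ge> 1"
  shows "(\<Prod>\<omega> | \<omega> ^ N = 1. x - \<omega> * y) = x ^ N - y ^ N"
proof -
  let ?R = "{\<omega>::complex. \<omega> ^ N = 1}"
  have fin: "finite ?R" and card: "card ?R = N"
    using assms by (auto simp: card_complex_roots_unity intro!: finite_roots_unity)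
  have *: "(\<Prod>\<omega>\<in>?R. [:-\<omega>, 1:]) = monom 1 N - 1"
  proof (rule poly_eqI_degree_lead_coeff[where n = N and A = ?R])
    show "coeff (\<Prod>\<omega>\<in>?R. [:-\<omega>, 1:]) N = coeff (monom 1 N - 1) N"
    proof -
      have "degree (\<Prod>\<omega>\<in>?R. [:-\<omega>, 1:]) = N"
        by (subst degree_prod_eq_sum_degree) (auto simp: card)
      moreover have "lead_coeff (\<Prod>\<omega>\<in>?R. [:-\<omega>, 1:]) = 1"
        by (simp add: lead_coeff_prod)
      ultimately show ?thesis using assms by simp
    qed
    show "degree (\<Prod>\<omega>\<in>?R. [:-\<omega>, 1:]) \<le> N"
      by (subst degree_prod_eq_sum_degree) (auto simp: card)
    show "degree (monom (1::complex) N - 1) \<le> N"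
      by (rule degree_diff_le) (auto simp: degree_monom_le)
    show "poly (\<Prod>\<omega>\<in>?R. [:-\<omega>, 1:]) z = poly (monom 1 N - 1) z" if "z \<in> ?R" for z
      using that fin by (auto simp: poly_prod poly_monom intro!: prod_zero bexI[of _ z])
  qed (use card in auto)
  show ?thesis
  proof (cases "y = 0")
    case True
    then show ?thesis using assms card by simp
  next
    case False
    have "(\<Prod>\<omega>\<in>?R. x - \<omega> * y) = (\<Prod>\<omega>\<in>?R. y * poly [:-\<omega>, 1:] (x / y))"
      using False by (intro prod.cong) (auto simp: field_simps)
    also have "\<dots> = y ^ N * poly (\<Prod>\<omega>\<in>?R. [:-\<omega>, 1:]) (x / y)"
      by (simp add: prod.distrib card poly_prod)
    also have "\<dots> = x ^ N - y ^ N"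
      unfolding * using False by (simp add: poly_monom field_simps)
    finally show ?thesis .
  qed
qed

lemma norm_prod_linear_unit_circle_ge:
  fixes a b :: "'i \<Rightarrow> complex"
  assumes "finite I"
  obtains \<zeta> where "cmod \<zeta> = 1" "(\<Prod>k\<in>I. max (cmod (a k)) (cmod (b k))) \<le> (\<Prod>k\<in>I. cmod (a k + \<zeta> * b k))"
proof -
  define f where "f \<zeta> = (\<Prod>k\<in>I. if cmod (a k) < cmod (b k) then cnj (b k) + \<zeta> * cnj (a k) else a k + \<zeta> * b k)" for \<zeta>
  \<comment> \<open>The reflected factor has the same modulus on the unit circle, and makes the value at 0 the product of the maxima.\<close>
  have same: "cmod (f \<zeta>) = (\<Prod>k\<in>I. cmod (a k + \<zeta> * b k))" if "cmod \<zeta> = 1" for \<zeta>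
    unfolding f_def prod_norm[symmetric]
  proof (intro prod.cong refl)
    fix k
    have \<zeta>: "\<zeta> * cnj \<zeta> = 1"
      using that by (simp add: complex_mult_cnj cmod_power2[symmetric])
    have "cmod (a k + \<zeta> * b k) = cmod (cnj (a k + \<zeta> * b k))" by (rule complex_mod_cnj[symmetric])
    also have "\<dots> = cmod (\<zeta> * cnj (a k + \<zeta> * b k))" using that by (simp add: norm_mult)
    also have "\<zeta> * cnj (a k + \<zeta> * b k) = (\<zeta> * cnj \<zeta>) * cnj (b k) + \<zeta> * cnj (a k)"
      by (simp add: algebra_simps)
    finally show "cmod (if cmod (a k) < cmod (b k) then cnj (b k) + \<zeta> * cnj (a k) else a k + \<zeta> * b k) =
        cmod (a k + \<zeta> * b k)"
      using \<zeta> by simp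
  qed
  have hol: "f holomorphic_on UNIV"
    unfolding f_def
  proof (intro holomorphic_on_prod)
    fix k
    show "(\<lambda>\<zeta>. if cmod (a k) < cmod (b k) then cnj (b k) + \<zeta> * cnj (a k) else a k + \<zeta> * b k) holomorphic_on UNIV"
      by (cases "cmod (a k) < cmod (b k)") (auto intro!: holomorphic_intros)
  qed
  have "continuous_on (sphere 0 1) (\<lambda>z. cmod (f z))"
    using hol by (intro continuous_intros holomorphic_on_imp_continuous_on) (auto intro: holomorphic_on_subset)
  then obtain \<zeta> where \<zeta>: "\<zeta> \<in> sphere 0 1" "\<And>z. z \<in> sphere 0 1 \<Longrightarrow> cmod (f z) \<le> cmod (f \<zeta>)"
    using continuous_attains_sup[of "sphere 0 (1::real)" "\<lambda>z::complex. cmod (f z)"] by fastforce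
  have "cmod (f 0) \<le> cmod (f \<zeta>)"
  proof (rule maximum_modulus_frontier[where S = "cball 0 1" and f = f and \<xi> = 0])
    show "f holomorphic_on interior (cball 0 1)" using hol by (rule holomorphic_on_subset) auto
    show "continuous_on (closure (cball 0 1)) f"
      using hol by (intro holomorphic_on_imp_continuous_on) (auto intro: holomorphic_on_subset)
    show "cmod (f z) \<le> cmod (f \<zeta>)" if "z \<in> frontier (cball 0 1)" for z using \<zeta> that by simp
  qed auto
  also have "cmod (f 0) = (\<Prod>k\<in>I. max (cmod (a k)) (cmod (b k)))"
    unfolding f_def prod_norm[symmetric] by (intro prod.cong) auto
  finally show thesis using that[of \<zeta>] \<zeta> same by simp
qed

text \<open>Induction on \<open>m\<close>. The hypothesis is needed for arbitrary index sets: it is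
  used only for the factors where an earlier form beats the new one, since elsewhere the new form
  already gives the maximum. The two-form case then picks the phase of the new form.\<close>

lemma norm_prod_linear_forms_torus_ge:
  fixes b :: "nat \<Rightarrow> 'i \<Rightarrow> complex"
  assumes "finite I" "m \<ge> 1"
  shows "\<exists>\<zeta>. (\<forall>j. cmod (\<zeta> j) = 1) \<and>
           (\<Prod>k\<in>I. Max ((\<lambda>j. cmod (b j k)) ` {..<m})) \<le> (\<Prod>k\<in>I. cmod (\<Sum>j<m. \<zeta> j * b j k))"
  using assms(2,1)
proof (induction m arbitrary: I rule: dec_induct)
  case base
  show ?case by (rule exI[of _ "\<lambda>_. 1"]) (simp add: lessThan_Suc)
next
  case (step m)
  let ?M = "\<lambda>k. Max ((\<lambda>j. cmod (b j k)) ` {..<m})"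
  let ?J = "{k\<in>I. cmod (b m k) < ?M k}"
  have ne: "{..<m} \<noteq> {}" using step.hyps(1) by (auto simp: lessThan_empty_iff)
  have M_nonneg: "0 \<le> ?M k" for k
    using ne by (subst Max_ge_iff) auto
  have MS: "Max ((\<lambda>j. cmod (b j k)) ` {..<Suc m}) = max (cmod (b m k)) (?M k)" for k
    using ne by (simp add: lessThan_Suc)
  obtain \<zeta> where \<zeta>: "\<And>j. cmod (\<zeta> j) = 1"
      "(\<Prod>k\<in>?J. ?M k) \<le> (\<Prod>k\<in>?J. cmod (\<Sum>j<m. \<zeta> j * b j k))"
    using step.IH[of ?J] step.prems by auto
  obtain \<xi> where \<xi>: "cmod \<xi> = 1"
      "(\<Prod>k\<in>I. max (cmod (\<Sum>j<m. \<zeta> j * b j k)) (cmod (b m k)))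
        \<le> (\<Prod>k\<in>I. cmod ((\<Sum>j<m. \<zeta> j * b j k) + \<xi> * b m k))"
    using norm_prod_linear_unit_circle_ge[OF step.prems] .
  have split: "prod f I = prod f ?J * prod f (I - ?J)" for f :: "'i \<Rightarrow> real"
    using step.prems by (metis (no_types, lifting) mem_Collect_eq prod.subset_diff subsetI mult.commute)
  have "(\<Prod>k\<in>I. Max ((\<lambda>j. cmod (b j k)) ` {..<Suc m})) =
      (\<Prod>k\<in>?J. ?M k) * (\<Prod>k\<in>I-?J. cmod (b m k))"
    unfolding MS split by (intro arg_cong2[where f = "(*)"] prod.cong) auto
  also have "\<dots> \<le> (\<Prod>k\<in>?J. cmod (\<Sum>j<m. \<zeta> j * b j k)) * (\<Prod>k\<in>I-?J. cmod (b m k))"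
    using \<zeta>(2) by (intro mult_right_mono prod_nonneg) auto
  also have "\<dots> \<le> (\<Prod>k\<in>?J. max (cmod (\<Sum>j<m. \<zeta> j * b j k)) (cmod (b m k))) *
      (\<Prod>k\<in>I-?J. max (cmod (\<Sum>j<m. \<zeta> j * b j k)) (cmod (b m k)))"
    by (intro mult_mono prod_mono prod_nonneg) (auto intro: max.coboundedI1)
  also have "\<dots> = (\<Prod>k\<in>I. max (cmod (\<Sum>j<m. \<zeta> j * b j k)) (cmod (b m k)))"
    by (rule split[symmetric])
  also note \<xi>(2)
  also have "(\<Prod>k\<in>I. cmod ((\<Sum>j<m. \<zeta> j * b j k) + \<xi> * b m k)) =
     (\<Prod>k\<in>I. cmod (\<Sum>j<Suc m. (\<zeta>(m := \<xi>)) j * b j k))"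
    by (intro prod.cong) auto
  finally show ?case using \<zeta>(1) \<xi>(1) by (intro exI[of _ "\<zeta>(m := \<xi>)"]) auto
qed

lemma norm_poly_proots:
  fixes p :: "complex poly"
  shows "cmod (poly p z) = cmod (lead_coeff p) * (\<Prod>x\<in>#proots p. cmod (z - x))"
proof -
  have "poly (\<Prod>x\<in>#A. [:-x, 1:]) z = (\<Prod>x\<in>#A. z - x)" for A :: "complex multiset"
    by (induction A) (auto simp: algebra_simps)
  then have "poly p z = lead_coeff p * (\<Prod>x\<in>#proots p. z - x)"
    by (metis complex_poly_decompose_multiset poly_smult)
  moreover have "cmod (\<Prod>x\<in>#A. z - x) = (\<Prod>x\<in>#A. cmod (z - x))" for A :: "complex multiset"
    by (induction A) (auto simp: norm_mult)
  ultimately show ?thesis by (simp add: norm_mult)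
qed

section \<open>A maximum principle for logarithmic potentials\<close>

lemma prod_prod_mset_swap:
  fixes f :: "'a \<Rightarrow> 'b \<Rightarrow> 'c::comm_monoid_mult"
  shows "(\<Prod>i\<in>I. \<Prod>x\<in>#A. f i x) = (\<Prod>x\<in>#A. \<Prod>i\<in>I. f i x)"
  by (induction A) (simp_all add: prod.distrib)

lemma prod_mset_mono_real:
  fixes f g :: "'a \<Rightarrow> real"
  assumes "\<And>x. x \<in># A \<Longrightarrow> 0 \<le> f x \<and> f x \<le> g x"
  shows "0 \<le> (\<Prod>x\<in>#A. f x) \<and> (\<Prod>x\<in>#A. f x) \<le> (\<Prod>x\<in>#A. g x)"
  using assms
proof (induction A)
  case (add x A)
  then show ?case
    by (auto intro!: mult_mono mult_nonneg_nonneg intro: order_trans)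
qed auto

text \<open>The factor 2 does not depend on \<open>N\<close>: passing from the centre of a circle to
  \<open>N\<close> equidistributed points on it costs a bounded factor per zero, however large
  \<open>N\<close> is.\<close>

lemma norm_power_diff_bounds:
  fixes x :: complex
  assumes "2 * r \<le> cmod x" "0 < r" "N \<ge> 1"
  shows "cmod x ^ N / 2 \<le> cmod (x ^ N - of_real r ^ N)" "cmod (x ^ N - of_real r ^ N) \<le> 2 * cmod x ^ N"
proof -
  have "r ^ N \<le> (cmod x / 2) ^ N"
    using assms by (intro power_mono) auto
  also have "\<dots> = cmod x ^ N / 2 ^ N" by (simp add: power_divide)
  also have "\<dots> \<le> cmod x ^ N / 2 ^ 1"
    using assms by (intro divide_left_mono power_increasing) auto
  finally have *: "r ^ N \<le> cmod x ^ N / 2" by simp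
  have "cmod (of_real r ^ N :: complex) = r ^ N" using assms by (simp add: norm_power)
  then show "cmod x ^ N / 2 \<le> cmod (x ^ N - of_real r ^ N)" "cmod (x ^ N - of_real r ^ N) \<le> 2 * cmod x ^ N"
    using norm_triangle_ineq2[of "x ^ N" "of_real r ^ N"] norm_triangle_ineq4[of "x ^ N" "of_real r ^ N"] *
    by (simp_all add: norm_power)
qed

lemma poly_norm_le_power:
  fixes p :: "complex poly"
  shows "cmod (poly p z) \<le> (\<Sum>i\<le>degree p. cmod (coeff p i)) * (cmod z + 1) ^ degree p"
proof -
  have "cmod (poly p z) \<le> (\<Sum>i\<le>degree p. cmod (coeff p i * z ^ i))"
    unfolding poly_altdef by (rule norm_sum)
  also have "\<dots> \<le> (\<Sum>i\<le>degree p. cmod (coeff p i) * (cmod z + 1) ^ degree p)"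
  proof (rule sum_mono)
    fix i assume "i \<in> {..degree p}"
    then have "cmod z ^ i \<le> (cmod z + 1) ^ i" "(cmod z + 1) ^ i \<le> (cmod z + 1) ^ degree p"
      by (auto intro!: power_mono power_increasing)
    then show "cmod (coeff p i * z ^ i) \<le> cmod (coeff p i) * (cmod z + 1) ^ degree p"
      by (auto simp: norm_mult norm_power intro!: mult_left_mono)
  qed
  finally show ?thesis by (simp add: sum_distrib_right)
qed

text \<open>The extra \<open>r\<^sup>2\<close> is the strict subharmonicity of the squared modulus.
  For \<open>N > 1\<close> the roots of unity sum to 0, which kills the mixed term.\<close>

lemma sum_norm_square_circle:
  fixes z :: complex
  assumes "N > 1"
  shows "(\<Sum>\<omega> | \<omega> ^ N = 1. (cmod (z - \<omega> * of_real r))\<^sup>2) = real N * ((cmod z)\<^sup>2 + r\<^sup>2)"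
proof -
  have *: "(cmod (z - \<omega> * of_real r))\<^sup>2 = ((cmod z)\<^sup>2 + r\<^sup>2) - 2 * r * Re (cnj z * \<omega>)"
    if "\<omega> ^ N = 1" for \<omega>
  proof -
    have "cmod \<omega> = 1" using that assms by (metis norm_one power_eq_1_iff gr_implies_not_zero norm_power norm_ge_zero power_eq_imp_eq_norm)
    then have "(Re \<omega>)\<^sup>2 + (Im \<omega>)\<^sup>2 = 1" by (simp add: cmod_power2[symmetric])
    then have "r\<^sup>2 = (Re \<omega>)\<^sup>2 * r\<^sup>2 + (Im \<omega>)\<^sup>2 * r\<^sup>2"
      by (metis distrib_right mult_1)
    then show ?thesis
      unfolding cmod_power2 by (simp add: power2_eq_square algebra_simps)
  qed
  have "(\<Sum>\<omega> | \<omega> ^ N = 1. (cmod (z - \<omega> * of_real r))\<^sup>2) =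
      (\<Sum>\<omega> | \<omega> ^ N = 1. ((cmod z)\<^sup>2 + r\<^sup>2) - 2 * r * Re (cnj z * \<omega>))"
    by (rule sum.cong) (use * in auto)
  also have "\<dots> = real N * ((cmod z)\<^sup>2 + r\<^sup>2) - 2 * r * Re (cnj z * \<Sum>{\<omega>. \<omega> ^ N = 1})"
    using assms by (simp add: sum_subtractf card_complex_roots_unity sum_distrib_left Re_sum)
  finally show ?thesis by (simp add: sum_roots_unity[OF assms])
qed

text \<open>The quotient of \<open>cmod (poly P z)\<close> by \<open>exp (C + V z)\<close> decays at
  infinity because \<open>\<nu>\<close> has mass larger than \<open>degree P\<close>, so a
  counterexample forces a maximum off \<open>K\<close>. The perturbation
  \<open>\<eta> * (cmod z)\<^sup>2\<close> in the exponent makes this impossible: comparison with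
  the geometric mean over \<open>N\<close> points of a small circle loses a bounded factor and gains
  one exponential in \<open>N\<close>.\<close>

theorem potential_maximum_principle:
  fixes \<nu> :: "complex measure" and P :: "complex poly" and V :: "complex \<Rightarrow> real"
  assumes "finite_measure \<nu>" and sets: "sets \<nu> = sets borel"
    and K: "compact K" "AE t in \<nu>. t \<in> K"
    and int: "\<And>z. integrable \<nu> (\<lambda>t. ln (cmod (z - t)))"
    and V: "\<And>z. V z = (\<integral>t. ln (cmod (z - t)) \<partial>\<nu>)" and cont: "continuous_on UNIV V"
    and deg: "real (degree P) < measure \<nu> (space \<nu>)"
    and bound: "\<And>z. z \<in> K \<Longrightarrow> cmod (poly P z) \<le> exp (C + V z)"
  shows "cmod (poly P z) \<le> exp (C + V z)"
proof (rule ccontr)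
  interpret finite_measure \<nu> by fact
  assume contra: "\<not> cmod (poly P z) \<le> exp (C + V z)"
  define s where "s = measure \<nu> (space \<nu>)"
  obtain \<rho> where \<rho>: "\<rho> > 0" "K \<subseteq> cball 0 \<rho>"
    using compact_imp_bounded[OF K(1)] unfolding bounded_pos by (auto simp: subset_iff)
  define c where "c = (1 + (\<Sum>i\<le>degree P. cmod (coeff P i))) * 2 ^ degree P"
  have c: "c > 0" unfolding c_def by (intro mult_pos_pos add_pos_nonneg sum_nonneg) auto
  have P_le: "cmod (poly P z) \<le> c * cmod z ^ degree P" if "cmod z \<ge> 1" for z
  proof -
    have "cmod (poly P z) \<le> (\<Sum>i\<le>degree P. cmod (coeff P i)) * (cmod z + 1) ^ degree P" by (rule poly_norm_le_power)
    also have "\<dots> \<le> (1 + (\<Sum>i\<le>degree P. cmod (coeff P i))) * (2 * cmod z) ^ degree P"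
      using that by (intro mult_mono power_mono add_nonneg_nonneg sum_nonneg) auto
    finally show ?thesis by (simp add: c_def power_mult_distrib)
  qed
  \<comment> \<open>Outside a large disc \<open>V z\<close> is at least
    \<open>s * ln (cmod z / 2)\<close>, and the surplus \<open>s - degree P\<close> absorbs all
    constants once \<open>ln (cmod z)\<close> exceeds the threshold.\<close>
  have far: "cmod (poly P z) \<le> exp (C + V z)"
    if z: "cmod z \<ge> 1" "cmod z \<ge> 2 * \<rho>" "cmod z \<ge> exp ((ln c - C + s * ln 2) / (s - degree P))" for z
  proof -
    have "s * ln (cmod z / 2) = (\<integral>t. ln (cmod z / 2) \<partial>\<nu>)" by (simp add: s_def)
    also have "\<dots> \<le> V z"
      unfolding V
    proof (rule integral_mono_AE[OF _ int])
      show "AE t in \<nu>. ln (cmod z / 2) \<le> ln (cmod (z - t))"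
        using K(2)
      proof eventually_elim
        case (elim t)
        then have "cmod t \<le> \<rho>" using \<rho> by auto
        then have "cmod z / 2 \<le> cmod (z - t)"
          using norm_triangle_ineq2[of z t] z by simp
        then show ?case using z by (subst ln_le_cancel_iff) auto
      qed
    qed auto
    finally have V1: "s * (ln (cmod z) - ln 2) \<le> V z" using z by (auto simp: ln_div split: if_splits)
    have "(ln c - C + s * ln 2) / (s - degree P) \<le> ln (cmod z)"
      using z by (subst ln_ge_iff) auto
    then have "ln c - C + s * ln 2 \<le> ln (cmod z) * (s - degree P)"
      using deg by (simp add: s_def pos_divide_le_eq)
    with V1 have "ln c + degree P * ln (cmod z) \<le> C + V z" by (simp add: algebra_simps)
    then have "exp (ln c + degree P * ln (cmod z)) \<le> exp (C + V z)" by simp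
    moreover have "exp (ln c + degree P * ln (cmod z)) = c * cmod z ^ degree P"
      using c less_le_trans[OF zero_less_one z(1)] by (simp add: exp_add exp_of_nat_mult del: zero_less_norm_iff)
    ultimately show ?thesis using P_le[OF z(1)] by simp
  qed
  define R where "R = Max {1, 2 * \<rho>, exp ((ln c - C + s * ln 2) / (s - degree P)), cmod z + 1}"
  have R: "R \<ge> 1" "R \<ge> 2 * \<rho>" "R \<ge> exp ((ln c - C + s * ln 2) / (s - degree P))" "R > cmod z"
    unfolding R_def by (auto simp: less_max_iff_disj le_max_iff_disj)
  define q where "q = cmod (poly P z) * exp (- C - V z)"
  have q: "q > 1"
    using contra by (simp add: q_def exp_diff exp_minus exp_add field_simps)
  \<comment> \<open>Small enough that \<open>exp (\<eta> * (cmod z)\<^sup>2)\<close> stays below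
    \<open>q\<close> on the disc, so the maximum of \<open>\<phi>\<close> can lie neither on
    \<open>K\<close> nor on the boundary circle.\<close>
  define \<eta> where "\<eta> = ln q / (2 * R\<^sup>2)"
  have \<eta>: "\<eta> > 0" "\<eta> * R\<^sup>2 < ln q"
    using q R(1) by (auto simp: \<eta>_def)
  define \<phi> where "\<phi> z = cmod (poly P z) * exp (- C - V z + \<eta> * (cmod z)\<^sup>2)" for z
  have "continuous_on (cball 0 R) \<phi>"
    unfolding \<phi>_def using cont by (intro continuous_intros) (auto intro: continuous_on_subset)
  then obtain z0 where z0: "z0 \<in> cball 0 R" "\<And>z. z \<in> cball 0 R \<Longrightarrow> \<phi> z \<le> \<phi> z0"
    using continuous_attains_sup[of "cball 0 R" \<phi>] R(1) by auto
  have "q \<le> \<phi> z" unfolding q_def \<phi>_def using \<eta>(1) by (intro mult_left_mono) auto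
  also have "\<dots> \<le> \<phi> z0" using z0(2)[of z] R(4) by auto
  finally have q0: "q \<le> \<phi> z0" .
  have small: "\<phi> x < q" if "cmod (poly P x) \<le> exp (C + V x)" "cmod x \<le> R" for x
  proof -
    have "\<phi> x \<le> exp (C + V x) * exp (- C - V x + \<eta> * (cmod x)\<^sup>2)"
      unfolding \<phi>_def using that by (intro mult_right_mono) auto
    also have "\<dots> = exp (\<eta> * (cmod x)\<^sup>2)" by (simp add: exp_add[symmetric])
    also have "\<dots> \<le> exp (\<eta> * R\<^sup>2)" using that \<eta> by (auto intro!: mult_left_mono power_mono)
    also have "\<dots> < exp (ln q)" using \<eta>(2) by (subst exp_less_cancel_iff)
    also have "\<dots> = q" using q by simp
    finally show ?thesis .
  qed
  have "z0 \<notin> K" using small[of z0] bound[of z0] q0 z0(1) by auto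
  moreover have "cmod z0 < R"
  proof (rule ccontr)
    assume "\<not> cmod z0 < R"
    then have "cmod z0 = R" using z0(1) by simp
    then show False using far[of z0] R small[of z0] q0 by simp
  qed
  moreover have "poly P z0 \<noteq> 0" using q0 q by (auto simp: \<phi>_def)
  moreover have "open ((- K) \<inter> ball 0 R \<inter> {x. poly P x \<noteq> 0})"
    using K(1) by (intro open_Int open_Collect_neq continuous_intros) (auto simp: compact_imp_closed open_Compl)
  ultimately obtain e where e: "e > 0" "ball z0 e \<subseteq> (- K) \<inter> ball 0 R \<inter> {x. poly P x \<noteq> 0}"
    using openE[of "(- K) \<inter> ball 0 R \<inter> {x. poly P x \<noteq> 0}" z0] by auto
  \<comment> \<open>Half the radius, so that zeros of \<open>P\<close> and points of
    \<open>K\<close> keep the distance \<open>2 * r\<close> from \<open>z0\<close> demanded by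
    \<open>norm_power_diff_bounds\<close>.\<close>
  define r where "r = e / 2"
  have r: "r > 0" "2 * r = e" using e by (auto simp: r_def)
  have far0: "2 * r \<le> cmod (z0 - x)" if "x \<in> K \<or> poly P x = 0" for x
    using that e(2) r(2) by (auto simp: subset_iff dist_norm) (meson linorder_not_le)+
  \<comment> \<open>The right side is free of \<open>N\<close> while the left side grows
    exponentially; the two factors on the right are the losses at the zeros of \<open>P\<close> and
    in the integral against \<open>\<nu>\<close>.\<close>
  have contradiction: "exp (\<eta> * r\<^sup>2 * N) \<le> 2 ^ degree P * exp (s * ln 2)" if N: "N > 1" for N :: nat
  proof -
    let ?R = "{\<omega>::complex. \<omega> ^ N = 1}"
    have fin: "finite ?R" and card: "card ?R = N"
      using N by (auto simp: card_complex_roots_unity intro!: finite_roots_unity)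
    have \<omega>: "cmod \<omega> = 1" if "\<omega> \<in> ?R" for \<omega>
      using that N by (metis (mono_tags) mem_Collect_eq norm_one power_eq_1_iff gr_implies_not_zero norm_power norm_ge_zero power_eq_imp_eq_norm)
    have in_ball: "z0 - \<omega> * of_real r \<in> ball z0 e" if "\<omega> \<in> ?R" for \<omega>
      using \<omega>[OF that] r by (simp add: dist_norm norm_mult)
    have circle: "(\<Prod>\<omega>\<in>?R. cmod (z0 - \<omega> * of_real r - x)) = cmod ((z0 - x) ^ N - of_real r ^ N)" for x
    proof -
      have "(\<Prod>\<omega>\<in>?R. cmod (z0 - \<omega> * of_real r - x)) = cmod (\<Prod>\<omega>\<in>?R. (z0 - x) - \<omega> * of_real r)"
        by (simp add: prod_norm[symmetric] algebra_simps)
      also have "(\<Prod>\<omega>\<in>?R. (z0 - x) - \<omega> * of_real r) = (z0 - x) ^ N - of_real r ^ N"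
        using N by (intro prod_roots_unity_diff) auto
      finally show ?thesis .
    qed
    have "cmod (poly P z0) ^ N / 2 ^ degree P =
        cmod (lead_coeff P) ^ N * (\<Prod>x\<in>#proots P. cmod (z0 - x) ^ N / 2)"
    proof -
      have "(\<Prod>x\<in>#A. cmod (z0 - x) ^ N / 2) = (\<Prod>x\<in>#A. cmod (z0 - x)) ^ N / 2 ^ size A" for A
        by (induction A) (auto simp: power_mult_distrib)
      then show ?thesis
        by (subst norm_poly_proots) (simp add: size_proots_complex power_mult_distrib)
    qed
    also have "\<dots> \<le> cmod (lead_coeff P) ^ N * (\<Prod>x\<in>#proots P. cmod ((z0 - x) ^ N - of_real r ^ N))"
    proof (rule mult_left_mono)
      have "cmod (z0 - x) ^ N / 2 \<le> cmod ((z0 - x) ^ N - of_real r ^ N)" if "x \<in># proots P" for x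
        using that norm_power_diff_bounds(1)[OF far0[of x] r(1)] N by (cases "P = 0") auto
      then show "(\<Prod>x\<in>#proots P. cmod (z0 - x) ^ N / 2) \<le> (\<Prod>x\<in>#proots P. cmod ((z0 - x) ^ N - of_real r ^ N))"
        using prod_mset_mono_real[of "proots P" "\<lambda>x. cmod (z0 - x) ^ N / 2" "\<lambda>x. cmod ((z0 - x) ^ N - of_real r ^ N)"]
        by auto
    qed auto
    also have "\<dots> = (\<Prod>\<omega>\<in>?R. cmod (poly P (z0 - \<omega> * of_real r)))"
      by (simp add: norm_poly_proots[of P] prod.distrib card prod_prod_mset_swap circle)
    finally have 1: "cmod (poly P z0) ^ N / 2 ^ degree P \<le> (\<Prod>\<omega>\<in>?R. cmod (poly P (z0 - \<omega> * of_real r)))" .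
    have "(\<Sum>\<omega>\<in>?R. V (z0 - \<omega> * of_real r)) = (\<integral>t. (\<Sum>\<omega>\<in>?R. ln (cmod (z0 - \<omega> * of_real r - t))) \<partial>\<nu>)"
      unfolding V by (subst Bochner_Integration.integral_sum) (use int in auto)
    also have "\<dots> \<le> (\<integral>t. N * ln (cmod (z0 - t)) + ln 2 \<partial>\<nu>)"
    proof (rule integral_mono_AE)
      show "AE t in \<nu>. (\<Sum>\<omega>\<in>?R. ln (cmod (z0 - \<omega> * of_real r - t))) \<le> N * ln (cmod (z0 - t)) + ln 2"
        using K(2)
      proof eventually_elim
        case (elim t)
        have nz: "cmod (z0 - \<omega> * of_real r - t) > 0" if "\<omega> \<in> ?R" for \<omega>
          using in_ball[OF that] e(2) elim by (metis ComplD IntE eq_iff_diff_eq_0 subsetD zero_less_norm_iff)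
        have pos: "cmod (z0 - t) > 0" using far0[of t] elim r by (auto simp: algebra_simps)
        have "(\<Sum>\<omega>\<in>?R. ln (cmod (z0 - \<omega> * of_real r - t))) = ln (\<Prod>\<omega>\<in>?R. cmod (z0 - \<omega> * of_real r - t))"
          using fin nz by (subst ln_prod) auto
        also have "\<dots> \<le> ln (2 * cmod (z0 - t) ^ N)"
        proof (subst ln_le_cancel_iff)
          show "0 < (\<Prod>\<omega>\<in>?R. cmod (z0 - \<omega> * of_real r - t))" using nz by (intro prod_pos) auto
          show "(\<Prod>\<omega>\<in>?R. cmod (z0 - \<omega> * of_real r - t)) \<le> 2 * cmod (z0 - t) ^ N"
            unfolding circle using far0[of t] elim r(1) N by (intro norm_power_diff_bounds) auto
        qed (use pos in auto)
        also have "\<dots> = N * ln (cmod (z0 - t)) + ln 2"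
          using pos by (simp add: ln_mult ln_realpow)
        finally show ?case .
      qed
    qed (use int in auto)
    also have "\<dots> = N * V z0 + s * ln 2"
      using int by (simp add: V s_def)
    finally have 2: "(\<Sum>\<omega>\<in>?R. V (z0 - \<omega> * of_real r)) \<le> N * V z0 + s * ln 2" .
    have "\<phi> z0 ^ N * (exp (\<eta> * r\<^sup>2 * N) / (2 ^ degree P * exp (s * ln 2))) =
       (cmod (poly P z0) ^ N / 2 ^ degree P) *
        exp (- (N * C) - (N * V z0 + s * ln 2) + \<eta> * (N * ((cmod z0)\<^sup>2 + r\<^sup>2)))"
      by (simp add: \<phi>_def power_mult_distrib exp_of_nat_mult[symmetric] exp_add exp_diff exp_minus algebra_simps divide_simps)
    also have "\<dots> \<le> (\<Prod>\<omega>\<in>?R. cmod (poly P (z0 - \<omega> * of_real r))) *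
        exp (- (N * C) - (\<Sum>\<omega>\<in>?R. V (z0 - \<omega> * of_real r)) + \<eta> * (\<Sum>\<omega>\<in>?R. (cmod (z0 - \<omega> * of_real r))\<^sup>2))"
      using 1 2 by (intro mult_mono prod_nonneg) (auto simp: sum_norm_square_circle[OF N])
    also have "\<dots> = (\<Prod>\<omega>\<in>?R. \<phi> (z0 - \<omega> * of_real r))"
      unfolding \<phi>_def prod.distrib exp_sum[OF fin, symmetric]
      by (simp add: sum.distrib sum_subtractf card sum_distrib_left sum_negf)
    also have "\<dots> \<le> (\<Prod>\<omega>\<in>?R. \<phi> z0)"
    proof (rule prod_mono)
      fix \<omega> assume "\<omega> \<in> ?R"
      then have "z0 - \<omega> * of_real r \<in> cball 0 R" using in_ball e(2) by fastforce
      then show "0 \<le> \<phi> (z0 - \<omega> * of_real r) \<and> \<phi> (z0 - \<omega> * of_real r) \<le> \<phi> z0"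
        using z0(2) by (simp add: \<phi>_def)
    qed
    also have "\<dots> = \<phi> z0 ^ N * 1" by (simp add: card)
    finally have "exp (\<eta> * r\<^sup>2 * N) / (2 ^ degree P * exp (s * ln 2)) \<le> 1"
      using q0 q by (subst (asm) mult_le_cancel_left_pos) auto
    then show ?thesis by (simp add: pos_divide_le_eq)
  qed
  obtain N0 :: nat where N0: "2 ^ degree P * exp (s * ln 2) < N0 * (\<eta> * r\<^sup>2)"
    using ex_less_of_nat_mult[of "\<eta> * r\<^sup>2" "2 ^ degree P * exp (s * ln 2)"] \<eta> r by auto
  have "2 ^ degree P * exp (s * ln 2) < (N0 + 2) * (\<eta> * r\<^sup>2)"
    using N0 \<eta> r by (simp add: distrib_right) (smt (verit) mult_pos_pos zero_less_power)
  also have "\<dots> \<le> exp (\<eta> * r\<^sup>2 * real (N0 + 2))"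
    using exp_ge_add_one_self[of "\<eta> * r\<^sup>2 * real (N0 + 2)"] by (simp add: mult_ac del: exp_ge_add_one_self)
  finally show False using contradiction[of "N0 + 2"] by simp
qed

section \<open>Logarithmic potentials\<close>

lemma logint_eq_integral:
  assumes int: "integrable \<mu> (\<lambda>z. ln (g z))" and pos: "AE z in \<mu>. g z > 0"
  shows "logint \<mu> g = ereal (\<integral>z. ln (g z) \<partial>\<mu>)"
proof -
  have "(\<integral>\<^sup>+z. neglog (g z) \<partial>\<mu>) = (\<integral>\<^sup>+z. ennreal (max 0 (- ln (g z))) \<partial>\<mu>)"
    using pos by (intro nn_integral_cong_AE) (auto simp: neglog_def elim!: eventually_mono)
  also have "\<dots> = ennreal (\<integral>z. max 0 (- ln (g z)) \<partial>\<mu>)"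
    using int by (intro nn_integral_eq_integral) auto
  finally have *: "enn2ereal (\<integral>\<^sup>+z. neglog (g z) \<partial>\<mu>) = ereal (\<integral>z. max 0 (- ln (g z)) \<partial>\<mu>)"
    by (simp add: enn2ereal_ennreal integral_nonneg_AE)
  have "(\<integral>z. ln (g z) \<partial>\<mu>) = (\<integral>z. max 0 (ln (g z)) - max 0 (- ln (g z)) \<partial>\<mu>)"
    by (intro Bochner_Integration.integral_cong) auto
  also have "\<dots> = (\<integral>z. max 0 (ln (g z)) \<partial>\<mu>) - (\<integral>z. max 0 (- ln (g z)) \<partial>\<mu>)"
    using int by (intro Bochner_Integration.integral_diff) auto
  finally show ?thesis unfolding logint_def * by simp
qed

lemma neglog_measurable [measurable]: "neglog \<in> borel_measurable borel"
  unfolding neglog_def by measurable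

lemma ln_max_lipschitz:
  fixes x y r :: real
  assumes "r > 0"
  shows "\<bar>ln (max r x) - ln (max r y)\<bar> \<le> \<bar>x - y\<bar> / r"
proof -
  have *: "ln (max r x) - ln (max r y) \<le> \<bar>x - y\<bar> / r" for x y
  proof -
    have "ln (max r x) - ln (max r y) = ln (max r x / max r y)"
      using assms by (subst ln_div) auto
    also have "\<dots> \<le> max r x / max r y - 1"
      using assms by (intro ln_le_minus_one divide_pos_pos) auto
    also have "\<dots> = (max r x - max r y) / max r y"
      using assms by (simp add: diff_divide_distrib)
    also have "\<dots> \<le> \<bar>x - y\<bar> / r"
      using assms by (intro frac_le) auto
    finally show ?thesis .
  qed
  show ?thesis using *[of x y] *[of y x] by (simp add: abs_le_iff abs_minus_commute)
qed

text \<open>Finiteness is demanded at every point: it makes \<open>U\<close> real-valued on the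
  whole plane and excludes atoms. \<open>U\<close> carries the sign of \<open>log |z - t|\<close>,
  so it is the negative of the usual logarithmic potential.\<close>

locale finite_log_potential = prob_space \<mu> for \<mu> :: "complex measure" +
  fixes S :: "complex set"
  assumes sets_eq [measurable_cong]: "sets \<mu> = sets borel"
    and compact_support: "compact S"
    and AE_support: "AE t in \<mu>. t \<in> S"
    and neglog_finite: "(\<integral>\<^sup>+t. neglog (cmod (z - t)) \<partial>\<mu>) < \<infinity>"
begin

definition U :: "complex \<Rightarrow> real" where
  "U z = (\<integral>t. ln (cmod (z - t)) \<partial>\<mu>)"

text \<open>Cutting the kernel at distance \<open>r\<close> gives continuous majorants of
  \<open>U\<close> that decrease to \<open>U\<close> as \<open>r\<close> tends to 0.\<close>

definition Utr :: "real \<Rightarrow> complex \<Rightarrow> real" where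
  "Utr r z = (\<integral>t. ln (max r (cmod (z - t))) \<partial>\<mu>)"

lemma space_eq [simp]: "space \<mu> = UNIV"
  using sets_eq_imp_space_eq[OF sets_eq] by simp

lemma S_nonempty: "S \<noteq> {}"
  using AE_support AE_False by auto

lemma support_bound:
  obtains \<rho> where "\<rho> \<ge> 1" "\<And>t. t \<in> S \<Longrightarrow> cmod t \<le> \<rho>"
proof -
  obtain b where "\<And>t. t \<in> S \<Longrightarrow> cmod t \<le> b"
    using compact_imp_bounded[OF compact_support] unfolding bounded_iff by auto
  then show thesis using that[of "max 1 b"] by (meson max.cobounded1 max.coboundedI2)
qed

lemma AE_neq: "AE t in \<mu>. t \<noteq> z"
proof -
  have "AE t in \<mu>. neglog (cmod (z - t)) \<noteq> \<infinity>"
    using neglog_finite[of z] by (intro nn_integral_noteq_infinite) auto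
  then show ?thesis by eventually_elim (auto simp: neglog_def)
qed

lemma integrable_ln [simp]: "integrable \<mu> (\<lambda>t. ln (cmod (z - t)))"
proof (rule integrableI_bounded)
  obtain \<rho> where \<rho>: "\<rho> \<ge> 1" "\<And>t. t \<in> S \<Longrightarrow> cmod t \<le> \<rho>" using support_bound by blast
  have "(\<integral>\<^sup>+t. ennreal (norm (ln (cmod (z - t)))) \<partial>\<mu>) \<le>
      (\<integral>\<^sup>+t. neglog (cmod (z - t)) + ennreal (ln (cmod z + \<rho>)) \<partial>\<mu>)"
  proof (rule nn_integral_mono_AE)
    show "AE t in \<mu>. ennreal (norm (ln (cmod (z - t)))) \<le> neglog (cmod (z - t)) + ennreal (ln (cmod z + \<rho>))"
      using AE_neq[of z] AE_support
    proof eventually_elim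
      case (elim t)
      have "cmod (z - t) \<le> cmod z + \<rho>"
        using norm_triangle_ineq4[of z t] \<rho>(2)[OF elim(2)] by simp
      moreover have "0 < cmod (z - t)" using elim(1) by simp
      ultimately have "ln (cmod (z - t)) \<le> ln (cmod z + \<rho>)" by (intro ln_mono)
      moreover have "0 \<le> ln (cmod z + \<rho>)" using \<rho>(1) by (intro ln_ge_zero) (simp add: add_increasing)
      ultimately have "\<bar>ln (cmod (z - t))\<bar> \<le> max 0 (- ln (cmod (z - t))) + ln (cmod z + \<rho>)"
        by auto
      then have "ennreal \<bar>ln (cmod (z - t))\<bar> \<le> ennreal (max 0 (- ln (cmod (z - t))) + ln (cmod z + \<rho>))"
        by (rule ennreal_leI)
      also have "\<dots> = ennreal (max 0 (- ln (cmod (z - t)))) + ennreal (ln (cmod z + \<rho>))"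
        using \<open>0 \<le> ln (cmod z + \<rho>)\<close> by (intro ennreal_plus) auto
      finally show ?case
        using \<open>0 < cmod (z - t)\<close> by (simp add: neglog_def)
    qed
  qed
  also have "\<dots> = (\<integral>\<^sup>+t. neglog (cmod (z - t)) \<partial>\<mu>) + ennreal (ln (cmod z + \<rho>))"
    by (subst nn_integral_add) (auto simp: emeasure_space_1[simplified])
  also have "\<dots> < \<infinity>" using neglog_finite[of z] by simp
  finally show "(\<integral>\<^sup>+t. ennreal (norm (ln (cmod (z - t)))) \<partial>\<mu>) < \<infinity>" .
qed measurable

lemma integrable_ln_max [simp]: "r > 0 \<Longrightarrow> integrable \<mu> (\<lambda>t. ln (max r (cmod (z - t))))"
proof -
  assume r: "r > 0"
  obtain \<rho> where \<rho>: "\<rho> \<ge> 1" "\<And>t. t \<in> S \<Longrightarrow> cmod t \<le> \<rho>" using support_bound by blast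
  show ?thesis
  proof (rule integrable_const_bound)
    show "AE t in \<mu>. norm (ln (max r (cmod (z - t)))) \<le> \<bar>ln r\<bar> + \<bar>ln (max r (cmod z + \<rho>))\<bar>"
      using AE_support
    proof eventually_elim
      case (elim t)
      have "cmod (z - t) \<le> cmod z + \<rho>"
        using norm_triangle_ineq4[of z t] \<rho>(2)[OF elim] by simp
      then have "ln (max r (cmod (z - t))) \<le> ln (max r (cmod z + \<rho>))" using r by (intro ln_mono) (auto simp: max_def)
      moreover have "ln r \<le> ln (max r (cmod (z - t)))" using r by auto
      ultimately show ?case by auto
    qed
  qed measurable
qed

lemma U_le_Utr: "r > 0 \<Longrightarrow> U z \<le> Utr r z"
  unfolding U_def Utr_def
proof (rule integral_mono_AE)
  assume "r > 0"
  show "AE t in \<mu>. ln (cmod (z - t)) \<le> ln (max r (cmod (z - t)))"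
    using AE_neq[of z] by eventually_elim (auto intro!: ln_mono)
qed auto

lemma Utr_mono: "0 < r \<Longrightarrow> r \<le> r' \<Longrightarrow> Utr r z \<le> Utr r' z"
  unfolding Utr_def by (rule integral_mono) auto

lemma ln_max_integral_lipschitz:
  assumes "r > 0" and K [measurable]: "K \<in> sets borel"
  shows "\<bar>(\<integral>t. ln (max r (cmod (z - t))) * indicator K t \<partial>\<mu>) - (\<integral>t. ln (max r (cmod (z' - t))) * indicator K t \<partial>\<mu>)\<bar>
      \<le> cmod (z - z') / r"
proof -
  let ?f = "\<lambda>z t. ln (max r (cmod (z - t))) * indicator K t"
  have int: "integrable \<mu> (?f z)" for z
    using assms by (intro integrable_real_mult_indicator) (auto simp: sets_eq)
  have "\<bar>(\<integral>t. ?f z t \<partial>\<mu>) - (\<integral>t. ?f z' t \<partial>\<mu>)\<bar> = \<bar>\<integral>t. ?f z t - ?f z' t \<partial>\<mu>\<bar>"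
    by (simp add: int)
  also have "\<dots> \<le> (\<integral>t. \<bar>?f z t - ?f z' t\<bar> \<partial>\<mu>)"
    by (rule integral_abs_bound)
  also have "\<dots> \<le> (\<integral>t. cmod (z - z') / r \<partial>\<mu>)"
  proof (rule integral_mono)
    fix t
    have "\<bar>?f z t - ?f z' t\<bar> \<le> \<bar>ln (max r (cmod (z - t))) - ln (max r (cmod (z' - t)))\<bar>"
      by (auto simp: indicator_def)
    also have "\<dots> \<le> \<bar>cmod (z - t) - cmod (z' - t)\<bar> / r"
      by (rule ln_max_lipschitz[OF assms(1)])
    also have "\<dots> \<le> cmod (z - z') / r"
      using assms norm_triangle_ineq3[of "z - t" "z' - t"] by (intro divide_right_mono) auto
    finally show "\<bar>?f z t - ?f z' t\<bar> \<le> cmod (z - z') / r" .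
  qed (use int in auto)
  finally show ?thesis by (simp add: prob_space[simplified])
qed

lemma continuous_ln_max_integral:
  assumes "r > 0" "K \<in> sets borel"
  shows "continuous_on A (\<lambda>z. \<integral>t. ln (max r (cmod (z - t))) * indicator K t \<partial>\<mu>)"
proof (rule lipschitz_on_continuous_on, rule lipschitz_onI)
  show "0 \<le> 1 / r" using assms(1) by simp
qed (use ln_max_integral_lipschitz[OF assms] in \<open>auto simp: dist_real_def dist_norm\<close>)

lemma continuous_Utr: "r > 0 \<Longrightarrow> continuous_on A (Utr r)"
  using continuous_ln_max_integral[of r UNIV A] by (simp add: Utr_def[abs_def])

lemma Utr_tendsto: "(\<lambda>i. Utr (1 / Suc i) z) \<longlonglongrightarrow> U z"
  unfolding Utr_def U_def
proof (rule integral_dominated_convergence[where w = "\<lambda>t. \<bar>ln (cmod (z - t))\<bar>"])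
  show "AE t in \<mu>. (\<lambda>i. ln (max (1 / Suc i) (cmod (z - t)))) \<longlonglongrightarrow> ln (cmod (z - t))"
    using AE_neq[of z]
  proof eventually_elim
    case (elim t)
    have "(\<lambda>i. max (1 / Suc i) (cmod (z - t))) \<longlonglongrightarrow> max 0 (cmod (z - t))"
      by (intro tendsto_max tendsto_const LIMSEQ_Suc lim_1_over_n)
    then show ?case using elim by (intro tendsto_ln) auto
  qed
  show "AE t in \<mu>. norm (ln (max (1 / Suc i) (cmod (z - t)))) \<le> \<bar>ln (cmod (z - t))\<bar>" for i
    using AE_neq[of z]
  proof eventually_elim
    case (elim t)
    show ?case
    proof (cases "1 / Suc i \<le> cmod (z - t)")
      case False
      then have "ln (cmod (z - t)) \<le> ln (1 / Suc i)" using elim by (intro ln_mono) auto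
      moreover have "ln (1 / Suc i) \<le> 0" by (subst ln_le_zero_iff) auto
      ultimately show ?thesis using False by (auto simp: max_def)
    qed (auto simp: max_def)
  qed
qed auto

lemma logint_eq_U: "logint \<mu> (\<lambda>t. cmod (z - t)) = ereal (U z)"
  unfolding U_def using AE_neq[of z] by (intro logint_eq_integral) (auto elim!: eventually_mono)

end

section \<open>The domination principle\<close>

lemma ln_max_diff_antimono:
  fixes r x y :: real
  assumes "0 < r" "0 < x" "x \<le> y"
  shows "ln (max r y) - ln y \<le> ln (max r x) - ln x"
proof -
  have "max r y / y \<le> max r x / x"
    using assms by (auto simp: max_def field_simps intro: mult_mono)
  then have "ln (max r y / y) \<le> ln (max r x / x)"
    using assms by (intro ln_mono) auto
  moreover have "ln (max r t / t) = ln (max r t) - ln t" if "t > 0" for t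
    using that assms(1) by (auto simp: ln_div max_def)
  ultimately show ?thesis using assms by simp
qed

text \<open>Moving a point to its nearest neighbour in a set at most doubles its distances to that
  set; this scaling turns the cut-off \<open>r / 2\<close> at the point into the cut-off
  \<open>r\<close> at the neighbour.\<close>

lemma ln_max_half:
  fixes r x :: real
  assumes "0 < r" "0 < x"
  shows "ln (max (r / 2) x) - ln x = ln (max r (2 * x)) - ln (2 * x)"
proof -
  have "max r (2 * x) = 2 * max (r / 2) x" by (auto simp: max_def)
  then have "ln (max r (2 * x)) = ln 2 + ln (max (r / 2) x)"
    using assms by (simp add: ln_mult max_def)
  then show ?thesis using assms by (simp add: ln_mult)
qed

section \<open>Restrictions of the measure with continuous potential, and domination of
  polynomials\<close>

context finite_log_potential
begin

text \<open>The set where truncation at \<open>1 / Suc i\<close> changes \<open>U\<close> by more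
  than \<open>a\<close>. Finer truncations stand in for \<open>U\<close>, which exhibits the set as
  a union of open sets.\<close>

definition exceed :: "nat \<Rightarrow> real \<Rightarrow> complex set" where
  "exceed i a = {z. \<exists>s. a < Utr (1 / Suc i) z - Utr (1 / Suc s) z}"

lemma open_exceed: "open (exceed i a)"
proof -
  have "exceed i a = (\<Union>s. {z. a < Utr (1 / Suc i) z - Utr (1 / Suc s) z})"
    by (auto simp: exceed_def)
  moreover have "open {z. a < Utr (1 / Suc i) z - Utr (1 / Suc s) z}" for s
    by (intro open_Collect_less continuous_intros continuous_Utr) auto
  ultimately show ?thesis by auto
qed

lemma not_exceed_imp: "z \<notin> exceed i a \<Longrightarrow> Utr (1 / Suc i) z - U z \<le> a"
  using Utr_tendsto[of z]
  by (intro LIMSEQ_le_const2[OF tendsto_diff[OF tendsto_const Utr_tendsto]])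
     (auto simp: exceed_def not_less)

lemma measure_exceed_tendsto:
  assumes "a > 0"
  shows "(\<lambda>i. measure \<mu> (exceed i a)) \<longlonglongrightarrow> 0"
proof -
  have "(\<lambda>i. measure \<mu> (exceed i a)) \<longlonglongrightarrow> measure \<mu> (\<Inter>i. exceed i a)"
  proof (rule finite_Lim_measure_decseq)
    show "range (\<lambda>i. exceed i a) \<subseteq> sets \<mu>" using open_exceed by (auto simp: sets_eq)
    show "decseq (\<lambda>i. exceed i a)"
    proof (rule decseq_SucI, rule subsetI)
      fix i z assume "z \<in> exceed (Suc i) a"
      moreover have "Utr (1 / Suc (Suc i)) z \<le> Utr (1 / Suc i) z"
        by (intro Utr_mono) (auto simp: field_simps)
      ultimately show "z \<in> exceed i a" unfolding exceed_def mem_Collect_eq by (metis diff_right_mono order_less_le_trans)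
    qed
  qed
  also have "(\<Inter>i. exceed i a) = {}"
  proof (rule ccontr)
    assume "\<not> ?thesis"
    then obtain z where z: "\<And>i. z \<in> exceed i a" by auto
    have "a \<le> Utr (1 / Suc i) z - U z" for i
    proof -
      obtain s where "a < Utr (1 / Suc i) z - Utr (1 / Suc s) z" using z[of i] by (auto simp: exceed_def)
      then show ?thesis using U_le_Utr[of "1 / Suc s" z] by simp
    qed
    then have "a \<le> U z - U z"
      by (intro LIMSEQ_le_const[OF tendsto_diff[OF Utr_tendsto tendsto_const]]) auto
    then show False using assms by simp
  qed
  finally show ?thesis by simp
qed

text \<open>On the complement of the sets \<open>exceed\<close> the truncated potentials converge uniformly, as in Egorov's theorem;
  semicontinuity makes that complement closed, and comparing a point with its nearest point in the compact set
  carries the uniformity over to the whole plane.\<close>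

lemma continuous_potential_restriction:
  assumes "\<eta> > 0"
  obtains K where "compact K" "K \<subseteq> S" "measure \<mu> K \<ge> 1 - \<eta>"
    "continuous_on UNIV (\<lambda>z. \<integral>t. ln (cmod (z - t)) * indicator K t \<partial>\<mu>)"
proof -
  \<comment> \<open>The tolerances \<open>(1/2) ^ j\<close> will give uniform convergence; the
    masses \<open>\<eta> * (1/2) ^ Suc j\<close> sum to \<open>\<eta>\<close>.\<close>
  have "\<exists>i. measure \<mu> (exceed i ((1/2) ^ j)) < \<eta> * (1/2) ^ Suc j" for j
    using order_tendstoD(2)[OF measure_exceed_tendsto[of "(1/2)^j"], of "\<eta> * (1/2) ^ Suc j"] assms
    by (auto simp: eventually_sequentially)
  then obtain i where i: "\<And>j. measure \<mu> (exceed (i j) ((1/2) ^ j)) < \<eta> * (1/2) ^ Suc j" by metis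
  define K where "K = S - (\<Union>j. exceed (i j) ((1/2) ^ j))"
  have KS: "K \<subseteq> S" by (auto simp: K_def)
  have cK: "compact K"
    unfolding K_def Diff_eq using compact_support open_exceed by (intro compact_Int_closed) auto
  have [measurable]: "K \<in> sets borel" using cK by (auto intro: borel_compact)
  have [measurable]: "S \<in> sets borel" using compact_support by (auto intro: borel_compact)
  have meas: "measure \<mu> K \<ge> 1 - \<eta>"
  proof -
    have sums: "(\<lambda>j. \<eta> * (1/2::real) ^ Suc j) sums \<eta>"
      using sums_mult[OF power_half_series, of \<eta>] by simp
    have "measure \<mu> (\<Union>j. exceed (i j) ((1/2) ^ j)) \<le> (\<Sum>j. measure \<mu> (exceed (i j) ((1/2) ^ j)))"
    proof (rule finite_measure_subadditive_countably)
      show "summable (\<lambda>j. measure \<mu> (exceed (i j) ((1/2) ^ j)))"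
        by (rule summable_comparison_test'[OF sums_summable[OF sums], of 0]) (simp add: less_imp_le[OF i] del: power_Suc)
    qed (use open_exceed in \<open>auto simp: sets_eq\<close>)
    also have "\<dots> \<le> (\<Sum>j. \<eta> * (1/2) ^ Suc j)"
      using summable_comparison_test'[OF sums_summable[OF sums], of 0 "\<lambda>j. measure \<mu> (exceed (i j) ((1/2) ^ j))"]
        sums_summable[OF sums] less_imp_le[OF i]
      by (intro suminf_le) (simp_all del: power_Suc)
    also have "\<dots> = \<eta>" using sums by (simp add: sums_iff)
    finally have "measure \<mu> (\<Union>j. exceed (i j) ((1/2) ^ j)) \<le> \<eta>" .
    moreover have "measure \<mu> S = 1" using AE_support by (intro prob_eq_1[THEN iffD2]) (auto simp: sets_eq)
    moreover have "measure \<mu> S \<le> measure \<mu> (K \<union> (\<Union>j. exceed (i j) ((1/2) ^ j)))"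
      using open_exceed by (intro finite_measure_mono sets.Un) (auto simp: K_def sets_eq)
    moreover have "\<dots> \<le> measure \<mu> K + measure \<mu> (\<Union>j. exceed (i j) ((1/2) ^ j))"
      using open_exceed by (intro measure_Un_le) (auto simp: sets_eq)
    ultimately show ?thesis by linarith
  qed
  let ?u = "\<lambda>z. \<integral>t. ln (cmod (z - t)) * indicator K t \<partial>\<mu>"
  let ?v = "\<lambda>j z. \<integral>t. ln (max (1 / Suc (i j) / 2) (cmod (z - t))) * indicator K t \<partial>\<mu>"
  have close: "0 \<le> ?v j z - ?u z \<and> ?v j z - ?u z \<le> (1/2) ^ j" for j z
  proof (cases "K = {}")
    case True
    then show ?thesis by simp
  next
    case False
    let ?r = "1 / Suc (i j) :: real"
    obtain z' where z': "z' \<in> K" "\<And>t. t \<in> K \<Longrightarrow> dist z z' \<le> dist z t"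
      using continuous_attains_inf[OF cK False continuous_on_dist[OF continuous_on_const continuous_on_id], of z] by auto
    have int1: "integrable \<mu> (\<lambda>t. ln (cmod (z - t)) * indicator K t)" for z
      by (intro integrable_real_mult_indicator) (auto simp: sets_eq)
    have int2: "integrable \<mu> (\<lambda>t. ln (max r (cmod (z - t))) * indicator K t)" if "r > 0" for r z
      using that by (intro integrable_real_mult_indicator) (auto simp: sets_eq)
    have diff: "?v j z - ?u z = (\<integral>t. (ln (max (?r / 2) (cmod (z - t))) - ln (cmod (z - t))) * indicator K t \<partial>\<mu>)"
      unfolding left_diff_distrib by (rule Bochner_Integration.integral_diff[symmetric]) (auto intro!: int1 int2)
    have "0 \<le> (\<integral>t. (ln (max (?r / 2) (cmod (z - t))) - ln (cmod (z - t))) * indicator K t \<partial>\<mu>)"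
    proof (rule integral_nonneg_AE)
      show "AE t in \<mu>. 0 \<le> (ln (max (?r / 2) (cmod (z - t))) - ln (cmod (z - t))) * indicator K t"
        using AE_neq[of z] by eventually_elim (auto intro!: mult_nonneg_nonneg ln_mono)
    qed
    moreover have "(\<integral>t. (ln (max (?r / 2) (cmod (z - t))) - ln (cmod (z - t))) * indicator K t \<partial>\<mu>) \<le>
        (\<integral>t. ln (max ?r (cmod (z' - t))) - ln (cmod (z' - t)) \<partial>\<mu>)"
    proof (rule integral_mono_AE)
      show "AE t in \<mu>. (ln (max (?r / 2) (cmod (z - t))) - ln (cmod (z - t))) * indicator K t
          \<le> ln (max ?r (cmod (z' - t))) - ln (cmod (z' - t))"
        using AE_neq[of z] AE_neq[of z']
      proof eventually_elim
        case (elim t)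
        show ?case
        proof (cases "t \<in> K")
          case True
          have pos: "0 < cmod (z - t)" "0 < cmod (z' - t)" using elim by auto
          have "cmod (z' - t) \<le> dist z z' + dist z t"
            using dist_triangle[of z' t z] by (simp add: dist_norm norm_minus_commute)
          also have "\<dots> \<le> 2 * cmod (z - t)" using z'(2)[OF True] by (simp add: dist_norm)
          finally have le: "cmod (z' - t) \<le> 2 * cmod (z - t)" .
          have "ln (max (?r / 2) (cmod (z - t))) - ln (cmod (z - t)) =
              ln (max ?r (2 * cmod (z - t))) - ln (2 * cmod (z - t))"
            using pos by (intro ln_max_half) auto
          also have "\<dots> \<le> ln (max ?r (cmod (z' - t))) - ln (cmod (z' - t))"
            using pos le by (intro ln_max_diff_antimono) auto
          finally show ?thesis using True by simp
        next
          case False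
          have "ln (cmod (z' - t)) \<le> ln (max ?r (cmod (z' - t)))" using elim by (intro ln_mono) auto
          then show ?thesis using False by simp
        qed
      qed
      show "integrable \<mu> (\<lambda>t. (ln (max (?r / 2) (cmod (z - t))) - ln (cmod (z - t))) * indicator K t)"
        by (intro integrable_real_mult_indicator Bochner_Integration.integrable_diff) (auto simp: sets_eq)
    qed auto
    moreover have "(\<integral>t. ln (max ?r (cmod (z' - t))) - ln (cmod (z' - t)) \<partial>\<mu>) = Utr ?r z' - U z'"
      by (simp add: Utr_def U_def)
    moreover have "Utr ?r z' - U z' \<le> (1/2) ^ j"
      using z'(1) by (intro not_exceed_imp) (auto simp: K_def)
    ultimately show ?thesis unfolding diff by linarith
  qed
  have "uniform_limit UNIV ?v ?u sequentially"
  proof (rule uniform_limitI)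
    fix e :: real assume "e > 0"
    then have "\<forall>\<^sub>F j in sequentially. (1/2::real) ^ j < e"
      by (intro order_tendstoD(2)[OF LIMSEQ_realpow_zero]) auto
    then show "\<forall>\<^sub>F j in sequentially. \<forall>z\<in>UNIV. dist (?v j z) (?u z) < e"
    proof eventually_elim
      case (elim j)
      show ?case
      proof
        fix z
        show "dist (?v j z) (?u z) < e"
          using close[of j z] elim by (auto simp: dist_real_def)
      qed
    qed
  qed
  then have "continuous_on UNIV ?u"
    by (rule uniform_limit_theorem[rotated]) (auto intro!: always_eventually continuous_ln_max_integral)
  then show thesis using that[of K] cK KS meas by blast
qed

text \<open>The maximum principle for \<open>a\<close> times the restriction of \<open>\<mu>\<close>
  to \<open>K\<close>. The bound lists the prices: \<open>(a - degree P) * B\<close> for the surplus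
  mass, and the terms with \<open>1 - \<kappa>\<close> for the discarded part of
  \<open>\<mu>\<close>, seen from \<open>S\<close> through the diameter bound \<open>D\<close> and
  from \<open>x\<close> through the distance \<open>d\<close>. All vanish as \<open>\<kappa>\<close>
  tends to 1 and \<open>a\<close> to \<open>degree P\<close>.\<close>

lemma domination_off_support:
  fixes \<kappa> a B D d M :: real
  assumes lower: "\<And>z. z \<in> S \<Longrightarrow> - B \<le> U z"
    and bound: "\<And>z. z \<in> S \<Longrightarrow> cmod (poly P z) \<le> exp (M + degree P * U z)"
    and K: "compact K" "K \<subseteq> S" "\<kappa> = measure \<mu> K" "\<kappa> > 0"
    and cont: "continuous_on UNIV (\<lambda>z. \<integral>t. ln (cmod (z - t)) * indicator K t \<partial>\<mu>)"
    and a: "a * \<kappa> > degree P" "a \<ge> degree P"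
    and D: "D \<ge> 1" "\<And>z t. z \<in> S \<Longrightarrow> t \<in> S \<Longrightarrow> cmod (z - t) \<le> D"
    and d: "d > 0" "\<And>t. t \<in> S \<Longrightarrow> d \<le> cmod (x - t)"
  shows "cmod (poly P x) \<le> exp (M + (a - degree P) * B + a * ((1 - \<kappa>) * ln D) + a * (U x + (1 - \<kappa>) * \<bar>ln d\<bar>))"
proof -
  have [measurable]: "K \<in> sets borel" using K(1) by (auto intro: borel_compact)
  let ?u = "\<lambda>z. \<integral>t. ln (cmod (z - t)) * indicator K t \<partial>\<mu>"
  define C where "C = M + (a - degree P) * B + a * ((1 - \<kappa>) * ln D)"
  have a0: "a \<ge> 0" using a(2) by linarith
  have int1: "integrable \<mu> (\<lambda>t. ln (cmod (z - t)) * indicator A t)" if "A \<in> sets borel" for A z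
    using that by (intro integrable_real_mult_indicator) (auto simp: sets_eq)
  have split: "U z = ?u z + (\<integral>t. ln (cmod (z - t)) * indicator (- K) t \<partial>\<mu>)" for z
  proof -
    have "U z = (\<integral>t. ln (cmod (z - t)) * indicator K t + ln (cmod (z - t)) * indicator (- K) t \<partial>\<mu>)"
      unfolding U_def by (intro Bochner_Integration.integral_cong) (auto simp: indicator_def)
    also have "\<dots> = ?u z + (\<integral>t. ln (cmod (z - t)) * indicator (- K) t \<partial>\<mu>)"
      by (intro Bochner_Integration.integral_add int1) auto
    finally show ?thesis .
  qed
  have compl: "(\<integral>t. c * indicator (- K) t \<partial>\<mu>) = c * (1 - \<kappa>)" for c :: real
    using prob_compl[of K] by (simp add: K(3) sets_eq Compl_eq_Diff_UNIV)
  have u_ge: "U z - (1 - \<kappa>) * ln D \<le> ?u z" if "z \<in> S" for z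
  proof -
    have "(\<integral>t. ln (cmod (z - t)) * indicator (- K) t \<partial>\<mu>) \<le> (\<integral>t. ln D * indicator (- K) t \<partial>\<mu>)"
    proof (rule integral_mono_AE)
      show "AE t in \<mu>. ln (cmod (z - t)) * indicator (- K) t \<le> ln D * indicator (- K) t"
        using AE_support AE_neq[of z]
      proof eventually_elim
        case (elim t)
        then have "ln (cmod (z - t)) \<le> ln D" using D(2)[OF that, of t] by (intro ln_mono) auto
        then show ?case by (auto simp: indicator_def)
      qed
      show "integrable \<mu> (\<lambda>t. ln D * indicator (- K) t)"
        by (intro integrable_real_mult_indicator) (auto simp: sets_eq)
    qed (auto simp: int1)
    then show ?thesis using split[of z] compl[of "ln D"] by (simp only: mult.commute[of "1 - \<kappa>"])
  qed
  have u_le: "?u x \<le> U x + (1 - \<kappa>) * \<bar>ln d\<bar>"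
  proof -
    have "(\<integral>t. - \<bar>ln d\<bar> * indicator (- K) t \<partial>\<mu>) \<le> (\<integral>t. ln (cmod (x - t)) * indicator (- K) t \<partial>\<mu>)"
    proof (rule integral_mono_AE)
      show "AE t in \<mu>. - \<bar>ln d\<bar> * indicator (- K) t \<le> ln (cmod (x - t)) * indicator (- K) t"
        using AE_support
      proof eventually_elim
        case (elim t)
        then have "ln d \<le> ln (cmod (x - t))" using d by (intro ln_mono) auto
        then show ?case by (auto simp: indicator_def)
      qed
      show "integrable \<mu> (\<lambda>t. - \<bar>ln d\<bar> * indicator (- K) t)"
        by (intro integrable_real_mult_indicator) (auto simp: sets_eq)
    qed (auto simp: int1)
    then show ?thesis using split[of x] compl[of "- \<bar>ln d\<bar>"]
      by (simp only: mult.commute[of "1 - \<kappa>"] mult_minus_left)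
  qed
  define \<nu> where "\<nu> = density \<mu> (\<lambda>t. ennreal (a * indicator K t))"
  have em: "emeasure \<nu> UNIV = ennreal (a * \<kappa>)"
  proof -
    have "emeasure \<nu> UNIV = (\<integral>\<^sup>+t. ennreal a * indicator K t \<partial>\<mu>)"
      unfolding \<nu>_def using a0 by (subst emeasure_density) (auto simp: sets_eq indicator_def intro!: nn_integral_cong)
    also have "\<dots> = ennreal a * emeasure \<mu> K" by (subst nn_integral_cmult_indicator) (auto simp: sets_eq)
    also have "\<dots> = ennreal (a * \<kappa>)" using a0 K by (simp add: emeasure_eq_measure ennreal_mult)
    finally show ?thesis .
  qed
  have "cmod (poly P x) \<le> exp (C + a * ?u x)"
  proof (rule potential_maximum_principle[where \<nu> = \<nu> and K = K and V = "\<lambda>z. a * ?u z"])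
    show "finite_measure \<nu>" using em by (intro finite_measureI) (auto simp: \<nu>_def)
    show "sets \<nu> = sets borel" by (simp add: \<nu>_def sets_eq)
    show "compact K" by fact
    show "AE t in \<nu>. t \<in> K" unfolding \<nu>_def by (subst AE_density) (auto simp: indicator_def)
    show "integrable \<nu> (\<lambda>t. ln (cmod (z - t)))" for z
      unfolding \<nu>_def using int1[of K z] a0
      by (subst integrable_density) (auto simp: mult_ac sets_eq intro: integrable_mult_right)
    show "a * ?u z = (\<integral>t. ln (cmod (z - t)) \<partial>\<nu>)" for z
      unfolding \<nu>_def using a0
      by (subst integral_density) (auto simp: sets_eq mult_ac integral_mult_right_zero[symmetric] simp del: integral_mult_right_zero)
    show "continuous_on UNIV (\<lambda>z. a * ?u z)" using cont by (intro continuous_intros)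
    show "real (degree P) < measure \<nu> (space \<nu>)"
      using em a a0 K(4) by (simp add: \<nu>_def measure_def)
    fix z assume z: "z \<in> K"
    then have zS: "z \<in> S" using K by auto
    have "a * (U z - (1 - \<kappa>) * ln D) \<le> a * ?u z" using u_ge[OF zS] a0 by (rule mult_left_mono)
    moreover have "(a - degree P) * (- B) \<le> (a - degree P) * U z"
      using lower[OF zS] a(2) by (intro mult_left_mono) auto
    ultimately have "M + degree P * U z \<le> C + a * ?u z" by (simp add: C_def algebra_simps)
    then show "cmod (poly P z) \<le> exp (C + a * ?u z)" using bound[OF zS] by (meson exp_le_cancel_iff order_trans)
  qed
  also have "\<dots> \<le> exp (C + a * (U x + (1 - \<kappa>) * \<bar>ln d\<bar>))"
    using u_le a0 by (simp add: mult_left_mono)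
  finally show ?thesis by (simp add: C_def)
qed

text \<open>Off the support, \<open>x\<close> has a positive distance \<open>d\<close> from it, and
  compact restrictions of mass tending to 1 make every loss in \<open>domination_off_support\<close>
  vanish. Zeros of \<open>P\<close> are set aside so that logarithms can be taken.\<close>

theorem poly_domination_principle:
  assumes lower: "\<And>z. z \<in> S \<Longrightarrow> - B \<le> U z"
    and bound: "\<And>z. z \<in> S \<Longrightarrow> cmod (poly P z) \<le> exp (M + degree P * U z)"
  shows "cmod (poly P x) \<le> exp (M + degree P * U x)"
proof (cases "x \<in> S \<or> poly P x = 0")
  case True
  then show ?thesis using bound by auto
next
  case False
  define n where "n = real (degree P)"
  obtain \<rho> where \<rho>: "\<rho> \<ge> 1" "\<And>t. t \<in> S \<Longrightarrow> cmod t \<le> \<rho>" using support_bound by blast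
  have D: "2 * \<rho> \<ge> 1" using \<rho>(1) by simp
  have D': "cmod (z - t) \<le> 2 * \<rho>" if "z \<in> S" "t \<in> S" for z t
    using \<rho>(2)[OF that(1)] \<rho>(2)[OF that(2)] norm_triangle_ineq4[of z t] by simp
  obtain d where d: "d > 0" "\<And>t. t \<in> S \<Longrightarrow> d \<le> cmod (x - t)"
    using separate_point_closed[OF compact_imp_closed[OF compact_support], of x] False by (auto simp: dist_norm)
  have "\<forall>j::nat. \<exists>K. compact K \<and> K \<subseteq> S \<and> measure \<mu> K \<ge> 1 - 1 / real (j + 2) \<and>
     continuous_on UNIV (\<lambda>z. \<integral>t. ln (cmod (z - t)) * indicator K t \<partial>\<mu>)"
  proof
    fix j :: nat
    have "0 < 1 / real (j + 2)" by simp
    then obtain K where "compact K" "K \<subseteq> S" "measure \<mu> K \<ge> 1 - 1 / real (j + 2)"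
      "continuous_on UNIV (\<lambda>z. \<integral>t. ln (cmod (z - t)) * indicator K t \<partial>\<mu>)"
      by (rule continuous_potential_restriction)
    then show "\<exists>K. compact K \<and> K \<subseteq> S \<and> measure \<mu> K \<ge> 1 - 1 / real (j + 2) \<and>
       continuous_on UNIV (\<lambda>z. \<integral>t. ln (cmod (z - t)) * indicator K t \<partial>\<mu>)" by blast
  qed
  from choice[OF this] obtain K where K: "\<And>j. compact (K j)" "\<And>j. K j \<subseteq> S" "\<And>j. measure \<mu> (K j) \<ge> 1 - 1 / real (j + 2)"
     "\<And>j. continuous_on UNIV (\<lambda>z. \<integral>t. ln (cmod (z - t)) * indicator (K j) t \<partial>\<mu>)" by blast
  define \<kappa> where "\<kappa> j = measure \<mu> (K j)" for j
  \<comment> \<open>The rescaled mass \<open>a j * \<kappa> j\<close> equals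
    \<open>n + 1 / Suc j\<close>: strictly above the degree, as the maximum principle requires, and
    tending to it.\<close>
  define a where "a j = (n + 1 / real (Suc j)) / \<kappa> j" for j
  have \<kappa>_bounds: "1 - 1 / real (j + 2) \<le> \<kappa> j" "\<kappa> j \<le> 1" for j
    using K(3) by (auto simp: \<kappa>_def)
  have \<kappa>_pos: "\<kappa> j > 0" for j
  proof -
    have "1 / real (j + 2) < 1" by (auto simp: field_simps)
    then show ?thesis using \<kappa>_bounds(1)[of j] by linarith
  qed
  have \<kappa>_lim: "\<kappa> \<longlonglongrightarrow> 1"
  proof (rule tendsto_sandwich)
    have "(\<lambda>j. 1 - 1 / real (j + 2)) \<longlonglongrightarrow> 1 - 0"
      by (intro tendsto_diff tendsto_const LIMSEQ_ignore_initial_segment lim_1_over_n)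
    then show "(\<lambda>j. 1 - 1 / real (j + 2)) \<longlonglongrightarrow> 1" by simp
    show "(\<lambda>j. 1) \<longlonglongrightarrow> (1::real)" by simp
  qed (use \<kappa>_bounds in auto)
  have "(\<lambda>j. 1 / real (Suc j)) \<longlonglongrightarrow> 0" by (intro LIMSEQ_Suc lim_1_over_n)
  then have "a \<longlonglongrightarrow> (n + 0) / 1"
    unfolding a_def by (intro tendsto_intros \<kappa>_lim) auto
  then have a_lim: "a \<longlonglongrightarrow> n" by simp
  have a_ge: "a j \<ge> n" for j
  proof -
    have "n * \<kappa> j \<le> n * 1" using \<kappa>_bounds(2)[of j] by (intro mult_left_mono) (auto simp: n_def)
    also have "\<dots> \<le> n + 1 / real (Suc j)" by simp
    finally show ?thesis using \<kappa>_pos[of j] by (simp add: a_def pos_le_divide_eq)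
  qed
  have step: "ln (cmod (poly P x)) \<le>
     M + (a j - n) * B + a j * ((1 - \<kappa> j) * ln (2 * \<rho>)) + a j * (U x + (1 - \<kappa> j) * \<bar>ln d\<bar>)" for j
  proof -
    have ak: "a j * \<kappa> j > degree P" using \<kappa>_pos[of j] by (simp add: a_def n_def)
    have "cmod (poly P x) \<le> exp (M + (a j - degree P) * B + a j * ((1 - \<kappa> j) * ln (2 * \<rho>)) + a j * (U x + (1 - \<kappa> j) * \<bar>ln d\<bar>))"
      by (rule domination_off_support[OF lower bound K(1)[of j] K(2)[of j] \<kappa>_def \<kappa>_pos K(4)[of j] ak _ D D' d])
         (use a_ge in \<open>auto simp: n_def\<close>)
    then have "ln (cmod (poly P x)) \<le> ln (exp (M + (a j - degree P) * B + a j * ((1 - \<kappa> j) * ln (2 * \<rho>)) + a j * (U x + (1 - \<kappa> j) * \<bar>ln d\<bar>)))"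
      by (rule ln_mono) (use False in auto)
    then show ?thesis by (simp add: n_def)
  qed
  have "(\<lambda>j. M + (a j - n) * B + a j * ((1 - \<kappa> j) * ln (2 * \<rho>)) + a j * (U x + (1 - \<kappa> j) * \<bar>ln d\<bar>))
     \<longlonglongrightarrow> M + (n - n) * B + n * ((1 - 1) * ln (2 * \<rho>)) + n * (U x + (1 - 1) * \<bar>ln d\<bar>)"
    by (intro tendsto_intros a_lim \<kappa>_lim)
  then have "ln (cmod (poly P x)) \<le> M + n * U x"
    using step by (intro LIMSEQ_le_const) auto
  then show ?thesis using False by (metis exp_le_cancel_iff exp_ln n_def zero_less_norm_iff)
qed

end

section \<open>A curve through a bounded planar set\<close>

lemma compact_UNIV_bool_seq: "compact (UNIV :: (nat \<Rightarrow> bool) set)"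
proof -
  have "compact_space (euclidean :: bool topology)"
    by (simp add: compact_space_def compactin_def) (metis UNIV_I finite_imp_compact compactE finite subset_UNIV)
  then have "compact_space (product_topology (\<lambda>_::nat. euclidean :: bool topology) UNIV)"
    by (simp add: compact_space_product_topology)
  then show ?thesis by (simp add: euclidean_product_topology compact_space_def)
qed

lemma binary_series_summable: "summable (\<lambda>i. of_bool (b i) * c ^ Suc i)" if "\<bar>c\<bar> < 1" for c :: real
proof (rule summable_comparison_test'[where N = 0])
  show "summable (\<lambda>i. \<bar>c\<bar> ^ Suc i)" using that by (subst summable_Suc_iff) (auto intro: summable_geometric)
qed (auto simp: abs_mult power_abs)

lemma continuous_on_binary_series:
  fixes c :: real
  assumes "\<bar>c\<bar> < 1" and "\<And>i. continuous_on UNIV (\<lambda>b. d b i)"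
  shows "continuous_on UNIV (\<lambda>b::nat \<Rightarrow> bool. \<Sum>i. of_bool (d b i :: bool) * c ^ Suc i)"
proof (rule uniform_limit_theorem)
  show "uniform_limit UNIV (\<lambda>n b. \<Sum>i<n. of_bool (d b i) * c ^ Suc i) (\<lambda>b. \<Sum>i. of_bool (d b i) * c ^ Suc i) sequentially"
  proof (rule Weierstrass_m_test)
    show "summable (\<lambda>i. \<bar>c\<bar> ^ Suc i)" using assms(1) by (subst summable_Suc_iff) (auto intro: summable_geometric)
  qed (auto simp: abs_mult power_abs)
  have "continuous_on UNIV (\<lambda>b. of_bool (d b i) :: real)" for i
    by (rule continuous_on_compose2[OF _ assms(2)[of i], of UNIV]) (auto intro: continuous_on_discrete)
  then show "\<forall>\<^sub>F n in sequentially. continuous_on UNIV (\<lambda>b. \<Sum>i<n. of_bool (d b i) * c ^ Suc i)"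
    by (intro always_eventually allI continuous_intros)
qed auto

text \<open>Base 3 with digits 0 and 1, that is, half of the usual Cantor set. The digits after the
  first contribute at most 1/6 in total, so the first digit can be read off and, unlike for binary
  expansions, the map is injective.\<close>

definition cantor_point :: "(nat \<Rightarrow> bool) \<Rightarrow> real" where
  "cantor_point b = (\<Sum>i. of_bool (b i) * (1/3) ^ Suc i)"

lemma cantor_point_rec:
  "cantor_point b = (of_bool (b 0) + cantor_point (\<lambda>i. b (Suc i))) / 3"
proof -
  have "cantor_point b = (\<Sum>i. of_bool (b (Suc i)) * (1/3) ^ Suc (Suc i)) + of_bool (b 0) * (1/3) ^ Suc 0"
    unfolding cantor_point_def using suminf_split_head[OF binary_series_summable[of "1/3" b]] by simp
  also have "(\<Sum>i. of_bool (b (Suc i)) * (1/3::real) ^ Suc (Suc i)) = (\<Sum>i. (1/3) * (of_bool (b (Suc i)) * (1/3) ^ Suc i))"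
    by (simp add: mult_ac)
  also have "\<dots> = (1/3) * cantor_point (\<lambda>i. b (Suc i))"
    unfolding cantor_point_def by (subst suminf_mult[OF binary_series_summable]) auto
  finally show ?thesis by simp
qed

lemma cantor_point_bounds: "0 \<le> cantor_point b" "cantor_point b \<le> 1/2"
proof -
  show "0 \<le> cantor_point b"
    unfolding cantor_point_def by (intro suminf_nonneg binary_series_summable) auto
  have s: "(\<lambda>i. (1/3) * (1/3::real) ^ i) sums ((1/3) * (1 / (1 - 1/3)))"
    by (intro sums_mult geometric_sums) auto
  have "cantor_point b \<le> (\<Sum>i. (1/3) * (1/3) ^ i)"
    unfolding cantor_point_def using sums_summable[OF s] by (intro suminf_le binary_series_summable) auto
  then show "cantor_point b \<le> 1/2" using s by (simp add: sums_iff)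
qed

lemma inj_cantor_point: "inj cantor_point"
proof (rule injI, rule ext)
  fix b b' n assume "cantor_point b = cantor_point b'"
  then show "b n = b' n"
  proof (induction n arbitrary: b b')
    case 0
    then show ?case
      using cantor_point_rec[of b] cantor_point_rec[of b']
        cantor_point_bounds[of "\<lambda>i. b (Suc i)"] cantor_point_bounds[of "\<lambda>i. b' (Suc i)"]
      by (cases "b 0"; cases "b' 0") auto
  next
    case (Suc n)
    have "b 0 = b' 0"
      using Suc.prems cantor_point_rec[of b] cantor_point_rec[of b']
        cantor_point_bounds[of "\<lambda>i. b (Suc i)"] cantor_point_bounds[of "\<lambda>i. b' (Suc i)"]
      by (cases "b 0"; cases "b' 0") auto
    then have "cantor_point (\<lambda>i. b (Suc i)) = cantor_point (\<lambda>i. b' (Suc i))"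
      using Suc.prems cantor_point_rec[of b] cantor_point_rec[of b'] by simp
    from Suc.IH[OF this] show ?case .
  qed
qed

lemma binary_expansion:
  fixes x :: real
  assumes "0 \<le> x" "x \<le> 1"
  obtains d :: "nat \<Rightarrow> bool" where "(\<Sum>i. of_bool (d i) * (1/2) ^ Suc i) = x"
proof -
  \<comment> \<open>\<open>r i\<close> is the remainder after \<open>i\<close> greedy digits,
    rescaled by \<open>2 ^ i\<close>.\<close>
  define r where "r = rec_nat x (\<lambda>_ y. 2 * y - of_bool (y \<ge> 1/2))"
  have r0: "r 0 = x" and rS: "r (Suc i) = 2 * r i - of_bool (r i \<ge> 1/2)" for i by (simp_all add: r_def)
  have rb: "0 \<le> r i \<and> r i \<le> 1" for i by (induction i) (use assms in \<open>auto simp: r0 rS\<close>)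
  have part: "(\<Sum>i<n. of_bool (r i \<ge> 1/2) * (1/2) ^ Suc i) = x - r n * (1/2) ^ n" for n
    by (induction n) (auto simp: r0 rS field_simps)
  have "(\<lambda>n. r n * (1/2) ^ n) \<longlonglongrightarrow> 0"
  proof (rule Lim_null_comparison)
    show "\<forall>\<^sub>F n in sequentially. norm (r n * (1/2) ^ n) \<le> (1/2) ^ n"
      using rb by (auto simp: abs_mult intro!: always_eventually mult_left_le_one_le)
    show "(\<lambda>n. (1/2::real) ^ n) \<longlonglongrightarrow> 0" by (intro LIMSEQ_realpow_zero) auto
  qed
  then have "(\<lambda>n. x - r n * (1/2) ^ n) \<longlonglongrightarrow> x - 0" by (intro tendsto_diff tendsto_const)
  then have "(\<lambda>i. of_bool (r i \<ge> 1/2) * (1/2) ^ Suc i) sums x"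
    unfolding sums_def part by simp
  then show thesis using that[of "\<lambda>i. r i \<ge> 1/2"] by (simp add: sums_iff)
qed

text \<open>The Cantor set is mapped onto a square, even and odd digits becoming the two
  coordinates, and Tietze extends the map to the line. Weak limits of measures in the plane can then
  be taken on the line.\<close>

lemma continuous_curve_covers_bounded:
  fixes A :: "complex set"
  assumes "bounded A"
  obtains \<gamma> :: "real \<Rightarrow> complex" where "continuous_on UNIV \<gamma>" "A \<subseteq> \<gamma> ` {0..1}"
proof -
  obtain \<rho> where \<rho>: "\<rho> > 0" "\<And>z. z \<in> A \<Longrightarrow> cmod z \<le> \<rho>"
    using assms unfolding bounded_pos by auto
  define v where "v b = complex_of_real (\<Sum>i. of_bool (b (2 * i)) * (1/2) ^ Suc i) +
      \<i> * complex_of_real (\<Sum>i. of_bool (b (2 * i + 1)) * (1/2) ^ Suc i)" for b :: "nat \<Rightarrow> bool"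
  have v: "continuous_on UNIV v"
    unfolding v_def
    by (intro continuous_intros continuous_on_binary_series) (auto intro: continuous_on_product_coordinates)
  have e: "continuous_on UNIV cantor_point"
    unfolding cantor_point_def[abs_def] by (rule continuous_on_binary_series) (auto intro: continuous_on_product_coordinates)
  have inv: "continuous_on (range cantor_point) (the_inv cantor_point)"
    by (rule continuous_on_inv[OF e compact_UNIV_bool_seq]) (auto simp: the_inv_f_f[OF inj_cantor_point])
  have "continuous_on (range cantor_point) (v \<circ> the_inv cantor_point)"
    using inv v by (intro continuous_on_compose) (auto intro: continuous_on_subset)
  moreover have "compact (range cantor_point)" using e compact_UNIV_bool_seq by (rule compact_continuous_image)
  ultimately obtain g where g: "continuous_on UNIV g" "\<And>x. x \<in> range cantor_point \<Longrightarrow> g x = (v \<circ> the_inv cantor_point) x"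
    using Tietze_unbounded[of "range cantor_point" "v \<circ> the_inv cantor_point" UNIV] compact_imp_closed by auto
  \<comment> \<open>Carries the unit square to the square of half-side \<open>\<rho>\<close> centred
    at 0.\<close>
  let ?\<gamma> = "\<lambda>x. (2 * g x - (1 + \<i>)) * of_real \<rho>"
  show thesis
  proof
    show "continuous_on UNIV ?\<gamma>" using g(1) by (intro continuous_intros)
    show "A \<subseteq> ?\<gamma> ` {0..1}"
    proof
      fix z assume "z \<in> A"
      then have "\<bar>Re z\<bar> \<le> \<rho>" "\<bar>Im z\<bar> \<le> \<rho>" using \<rho>(2)[of z] abs_Re_le_cmod[of z] abs_Im_le_cmod[of z] by linarith+
      then have *: "0 \<le> (Re z / \<rho> + 1) / 2" "(Re z / \<rho> + 1) / 2 \<le> 1" "0 \<le> (Im z / \<rho> + 1) / 2" "(Im z / \<rho> + 1) / 2 \<le> 1"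
        using \<rho>(1) by (auto simp: field_simps abs_le_iff)
      obtain d1 where d1: "(\<Sum>i. of_bool (d1 i) * (1/2) ^ Suc i) = (Re z / \<rho> + 1) / 2" using binary_expansion[OF *(1,2)] by metis
      obtain d2 where d2: "(\<Sum>i. of_bool (d2 i) * (1/2) ^ Suc i) = (Im z / \<rho> + 1) / 2" using binary_expansion[OF *(3,4)] by metis
      define b where "b i = (if even i then d1 (i div 2) else d2 (i div 2))" for i
      have "v b = Complex ((Re z / \<rho> + 1) / 2) ((Im z / \<rho> + 1) / 2)"
        unfolding v_def b_def using d1 d2 by (simp add: complex_eq_iff)
      then have "?\<gamma> (cantor_point b) = z"
        using g(2)[of "cantor_point b"] \<rho>(1) by (simp add: the_inv_f_f[OF inj_cantor_point] complex_eq_iff field_simps)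
      moreover have "cantor_point b \<in> {0..1}" using cantor_point_bounds[of b] by simp
      ultimately show "z \<in> ?\<gamma> ` {0..1}" by (metis (no_types, lifting) image_eqI)
    qed
  qed
qed

section \<open>Compact sets of capacity zero\<close>

lemma equi_lipschitz_uniform_limit:
  fixes f :: "nat \<Rightarrow> 'a::metric_space \<Rightarrow> real"
  assumes "compact A" and lim: "\<And>z. z \<in> A \<Longrightarrow> (\<lambda>n. f n z) \<longlonglongrightarrow> g z"
    and c: "c > 0" "\<And>n z z'. \<bar>f n z - f n z'\<bar> \<le> c * dist z z'" "\<And>z z'. \<bar>g z - g z'\<bar> \<le> c * dist z z'"
  shows "uniform_limit A f g sequentially"
proof (rule uniform_limitI)
  fix e :: real assume e: "e > 0"
  have "A \<subseteq> (\<Union>x\<in>A. ball x (e / (3 * c)))" using e c(1) by force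
  then obtain T where T: "T \<subseteq> A" "finite T" "A \<subseteq> (\<Union>x\<in>T. ball x (e / (3 * c)))"
    by (rule compactE_image[OF assms(1), rotated]) auto
  have "\<forall>\<^sub>F n in sequentially. \<forall>x\<in>T. \<bar>f n x - g x\<bar> < e / 3"
  proof (rule eventually_ball_finite[OF T(2)], rule ballI)
    fix x assume "x \<in> T"
    then show "\<forall>\<^sub>F n in sequentially. \<bar>f n x - g x\<bar> < e / 3"
      using tendstoD[OF lim, of x "e / 3"] T(1) e by (auto simp: dist_real_def)
  qed
  then show "\<forall>\<^sub>F n in sequentially. \<forall>z\<in>A. dist (f n z) (g z) < e"
  proof eventually_elim
    case (elim n)
    show ?case
    proof
      fix z assume "z \<in> A"
      then obtain x where x: "x \<in> T" "dist z x < e / (3 * c)" using T(3) by (auto simp: dist_commute)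
      then have "c * dist z x < e / 3" using c(1) by (simp add: field_simps)
      then show "dist (f n z) (g z) < e"
        using bspec[OF elim x(1)] c(2)[of n z x] c(3)[of z x] unfolding dist_real_def by linarith
    qed
  qed
qed

text \<open>The positive part of \<open>log (1 / x)\<close> cut off at height \<open>N\<close>:
  bounded and Lipschitz, hence a legitimate test kernel for weak limits, and increasing to
  \<open>neglog\<close> as \<open>N\<close> grows.\<close>

definition trunc_neglog :: "nat \<Rightarrow> real \<Rightarrow> real" where
  "trunc_neglog N x = - ln (max (exp (- real N)) (min 1 x))"

lemma trunc_neglog_bounds: "0 \<le> trunc_neglog N x" "trunc_neglog N x \<le> N"
proof -
  have "ln (max (exp (- real N)) (min 1 x)) \<le> ln 1" by (intro ln_mono) (auto simp: less_max_iff_disj)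
  then show "0 \<le> trunc_neglog N x" by (simp add: trunc_neglog_def)
  have "ln (exp (- real N)) \<le> ln (max (exp (- real N)) (min 1 x))" by (intro ln_mono) auto
  then show "trunc_neglog N x \<le> N" by (simp add: trunc_neglog_def)
qed

lemma trunc_neglog_lipschitz: "\<bar>trunc_neglog N x - trunc_neglog N y\<bar> \<le> exp (real N) * \<bar>x - y\<bar>"
proof -
  have "\<bar>trunc_neglog N x - trunc_neglog N y\<bar> \<le> \<bar>min 1 x - min 1 y\<bar> / exp (- real N)"
    using ln_max_lipschitz[of "exp (- real N)" "min 1 x" "min 1 y"] by (simp add: trunc_neglog_def abs_minus_commute)
  also have "\<dots> \<le> \<bar>x - y\<bar> / exp (- real N)" by (intro divide_right_mono) auto
  finally show ?thesis by (simp add: exp_minus field_simps)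
qed

lemma continuous_on_trunc_neglog [continuous_intros]:
  "continuous_on A f \<Longrightarrow> continuous_on A (\<lambda>x. trunc_neglog N (f x))"
  unfolding trunc_neglog_def
proof (intro continuous_intros ballI)
  fix x show "max (exp (- real N)) (min 1 (f x)) \<noteq> 0" by (metis exp_not_eq_zero less_max_iff_disj exp_gt_zero less_irrefl)
qed auto

lemma trunc_neglog_measurable [measurable]: "trunc_neglog N \<in> borel_measurable borel"
  by (intro borel_measurable_continuous_onI continuous_intros)

lemma trunc_neglog_le:
  assumes "0 < x" "x \<le> D" "1 \<le> D"
  shows "trunc_neglog N x \<le> ln D - ln x"
proof -
  have "ln (x / D) \<le> ln (max (exp (- real N)) (min 1 x))"
  proof (rule ln_mono)
    have "x / D \<le> 1" "x / D \<le> x" using assms by (auto simp: field_simps mult_left_le_one_le)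
    then show "x / D \<le> max (exp (- real N)) (min 1 x)" by (simp add: le_max_iff_disj)
  qed (use assms in auto)
  then show ?thesis using assms by (simp add: trunc_neglog_def ln_div split: if_splits)
qed

lemma trunc_neglog_mono: "N \<le> N' \<Longrightarrow> trunc_neglog N x \<le> trunc_neglog N' x"
  unfolding trunc_neglog_def by (simp, intro ln_mono) (auto simp: less_max_iff_disj intro: max.coboundedI1)

lemma neglog_eq_SUP_trunc: "x \<ge> 0 \<Longrightarrow> neglog x = (SUP N. ennreal (trunc_neglog N x))"
proof (cases "x = 0")
  case True
  have "trunc_neglog N 0 = real N" for N by (simp add: trunc_neglog_def)
  moreover have "neglog 0 = \<top>" by (simp add: neglog_def)
  ultimately show ?thesis
    unfolding True using ennreal_SUP_of_nat_eq_top by (simp only: ennreal_of_nat_eq_real_of_nat)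
next
  case False
  assume "x \<ge> 0"
  then have x: "x > 0" using False by simp
  show ?thesis
  proof (rule antisym)
    obtain N where N: "- ln x \<le> real N" using real_arch_simple by blast
    then have "- real N \<le> ln x" by simp
    then have "exp (- real N) \<le> x" using x by (metis exp_le_cancel_iff exp_ln)
    then have "max 0 (- ln x) \<le> trunc_neglog N x"
      using x by (auto simp: trunc_neglog_def max_def min_def)
    then show "neglog x \<le> (SUP N. ennreal (trunc_neglog N x))"
      using x by (intro SUP_upper2[of N]) (auto simp: neglog_def intro!: ennreal_leI)
    show "(SUP N. ennreal (trunc_neglog N x)) \<le> neglog x"
    proof (rule SUP_least)
      fix N
      have "trunc_neglog N x \<le> ln (max 1 x) - ln x" using x by (intro trunc_neglog_le) auto
      also have "\<dots> \<le> max 0 (- ln x)" using x by (auto simp: max_def)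
      finally show "ennreal (trunc_neglog N x) \<le> neglog x"
        using x by (auto simp: neglog_def simp del: ennreal_max_0 ennreal_max_0' intro!: ennreal_leI)
    qed
  qed
qed

text \<open>Greedy choice as for Leja points, except that the product of distances to the earlier
  points is asked to reach \<open>\<delta> ^ n\<close> rather than the maximum. The hypothesis
  \<open>large\<close> is the negation of the existence of small monic polynomials with zeros in
  \<open>A\<close>.\<close>

lemma leja_sequence:
  fixes A :: "complex set" and \<delta> :: real
  assumes "A \<noteq> {}"
    and large: "\<And>d a. d \<ge> 1 \<Longrightarrow> (\<And>i. i < d \<Longrightarrow> a i \<in> A) \<Longrightarrow> \<exists>z\<in>A. \<delta> ^ d \<le> (\<Prod>i<d. cmod (z - a i))"
  obtains a :: "nat \<Rightarrow> complex" where "\<And>n. a n \<in> A" "\<And>n. \<delta> ^ n \<le> (\<Prod>i<n. cmod (a n - a i))"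
proof -
  have "\<exists>a. \<forall>n. a n \<in> A \<and> \<delta> ^ n \<le> (\<Prod>i<n. cmod (a n - a i))"
  proof (rule dependent_wellorder_choice[of "\<lambda>a n r. r \<in> A \<and> \<delta> ^ n \<le> (\<Prod>i<n. cmod (r - a i))"])
    fix n :: nat and a :: "nat \<Rightarrow> complex"
    assume *: "\<And>i. i < n \<Longrightarrow> a i \<in> A \<and> \<delta> ^ i \<le> (\<Prod>j<i. cmod (a i - a j))"
    show "\<exists>r. r \<in> A \<and> \<delta> ^ n \<le> (\<Prod>i<n. cmod (r - a i))"
    proof (cases "n = 0")
      case True
      then show ?thesis using assms(1) by auto
    next
      case False
      then show ?thesis using large[of n a] * by auto
    qed
  next
    fix r :: complex and f g :: "nat \<Rightarrow> complex" and n :: nat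
    assume "\<And>i. i < n \<Longrightarrow> f i = g i"
    then have "(\<Prod>i<n. cmod (r - f i)) = (\<Prod>i<n. cmod (r - g i))" by (intro prod.cong) auto
    then show "(r \<in> A \<and> \<delta> ^ n \<le> (\<Prod>i<n. cmod (r - f i))) = (r \<in> A \<and> \<delta> ^ n \<le> (\<Prod>i<n. cmod (r - g i)))" by simp
  qed
  then show thesis using that by blast
qed

text \<open>Each new point adds twice its row, controlled by the lower bound for its product of
  distances, and one diagonal term. Truncation bounds the diagonal by \<open>N\<close> per point, so
  after division by \<open>real n ^ 2\<close> only a constant independent of \<open>N\<close>
  survives in the limit.\<close>

lemma leja_discrete_energy:
  fixes a :: "nat \<Rightarrow> complex"
  assumes \<delta>: "\<delta> > 0" and a: "\<And>n. \<delta> ^ n \<le> (\<Prod>i<n. cmod (a n - a i))"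
    and D: "D \<ge> 1" "\<And>i j. cmod (a i - a j) \<le> D"
  shows "(\<Sum>i<n. \<Sum>j<n. trunc_neglog N (cmod (a i - a j))) \<le> real n ^ 2 * (ln D + \<bar>ln \<delta>\<bar>) + real n * N"
proof (induction n)
  case 0
  show ?case by simp
next
  case (Suc n)
  let ?k = "\<lambda>i j. trunc_neglog N (cmod (a i - a j))"
  have pos: "0 < cmod (a n - a i)" if "i < n" for i
  proof (rule ccontr)
    assume "\<not> ?thesis"
    then have "(\<Prod>i<n. cmod (a n - a i)) = 0" using that by (intro prod_zero) auto
    with a[of n] have "\<delta> ^ n \<le> 0" by (simp only:)
    then show False using zero_less_power[OF \<delta>, of n] by linarith
  qed
  have "(\<Sum>i<n. ?k n i) \<le> (\<Sum>i<n. ln D - ln (cmod (a n - a i)))"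
    using D pos by (intro sum_mono trunc_neglog_le) auto
  also have "\<dots> = n * ln D - ln (\<Prod>i<n. cmod (a n - a i))"
    using pos by (subst ln_prod) (auto simp: sum_subtractf)
  also have "\<dots> \<le> n * ln D - ln (\<delta> ^ n)"
    using a[of n] \<delta> by (simp, intro ln_mono) auto
  also have "\<dots> \<le> n * ln D + n * \<bar>ln \<delta>\<bar>"
    using \<delta> mult_left_mono[of "- ln \<delta>" "\<bar>ln \<delta>\<bar>" "real n"] by (simp add: ln_realpow)
  finally have 1: "(\<Sum>i<n. ?k n i) \<le> n * (ln D + \<bar>ln \<delta>\<bar>)" by (simp add: distrib_left)
  have "(\<Sum>i<n. ?k i n) = (\<Sum>i<n. ?k n i)" by (simp add: norm_minus_commute)
  then have "(\<Sum>i<Suc n. \<Sum>j<Suc n. ?k i j) = (\<Sum>i<n. \<Sum>j<n. ?k i j) + 2 * (\<Sum>i<n. ?k n i) + ?k n n"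
    by (simp add: sum.distrib)
  also have "\<dots> \<le> (real n ^ 2 * (ln D + \<bar>ln \<delta>\<bar>) + real n * N) + 2 * (n * (ln D + \<bar>ln \<delta>\<bar>)) + N"
    using Suc.IH 1 trunc_neglog_bounds(2)[of N] by (intro add_mono) auto
  also have "\<dots> \<le> real (Suc n) ^ 2 * (ln D + \<bar>ln \<delta>\<bar>) + real (Suc n) * N"
    using D(1) by (simp add: power2_eq_square algebra_simps)
  finally show ?case .
qed

text \<open>The points are lifted along a covering curve to \<open>{0..1}\<close>, tightness yields
  a weak limit of the empirical measures of the lifts, and its image under the curve is
  \<open>\<mu>\<close>.\<close>

lemma bounded_sequence_weak_limit:
  fixes a :: "nat \<Rightarrow> complex"
  assumes A: "compact A" and a: "\<And>n. a n \<in> A"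
  obtains \<mu> r where "prob_space \<mu>" "sets \<mu> = sets borel" "emeasure \<mu> A = 1" "strict_mono (r :: nat \<Rightarrow> nat)"
    "\<forall>f B. continuous_on UNIV f \<longrightarrow> (\<forall>z. \<bar>f z\<bar> \<le> B) \<longrightarrow>
       (\<lambda>k. (\<Sum>i<Suc (r k). f (a i)) / Suc (r k)) \<longlonglongrightarrow> (\<integral>z. f z \<partial>\<mu> :: real)"
proof -
  obtain \<gamma> where \<gamma>: "continuous_on UNIV \<gamma>" "A \<subseteq> \<gamma> ` {0..1::real}"
    using continuous_curve_covers_bounded[OF compact_imp_bounded[OF A]] by blast
  have [measurable]: "\<gamma> \<in> borel_measurable borel" using \<gamma>(1) by (intro borel_measurable_continuous_onI)
  have "\<forall>n. \<exists>x. x \<in> {0..1} \<and> \<gamma> x = a n"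
  proof
    fix n
    have "a n \<in> \<gamma> ` {0..1}" using a[of n] \<gamma>(2) by (rule subsetD[rotated])
    then show "\<exists>x. x \<in> {0..1} \<and> \<gamma> x = a n" by (auto simp: image_iff)
  qed
  from choice[OF this] obtain x where x: "\<And>n. x n \<in> {0..1}" "\<And>n. \<gamma> (x n) = a n" by blast
  define M where "M n = distr (uniform_count_measure {..<Suc n}) borel x" for n
  have meas: "x \<in> uniform_count_measure {..<Suc n} \<rightarrow>\<^sub>M borel" for n
    by (auto simp: uniform_count_measure_def)
  have rd: "real_distribution (M n)" for n
  proof -
    interpret prob_space "uniform_count_measure {..<Suc n}"
      by (rule prob_space_uniform_count_measure) (auto simp: lessThan_empty_iff)
    show ?thesis
      unfolding real_distribution_def real_distribution_axioms_def
      using prob_space_distr[OF meas] by (simp add: M_def)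
  qed
  have int_M: "(\<integral>y. f y \<partial>M n) = (\<Sum>i<Suc n. f (x i)) / Suc n" if "f \<in> borel_measurable borel" for f :: "real \<Rightarrow> real" and n
    unfolding M_def using that by (subst integral_distr[OF meas]) (auto simp: integral_uniform_count_measure)
  have "tight M"
    unfolding tight_def
  proof (intro conjI allI impI rd)
    fix \<epsilon> :: real assume \<epsilon>: "\<epsilon> > 0"
    have "measure (M n) {-1<..2} = 1" for n
    proof -
      interpret real_distribution "M n" by (rule rd)
      have "(\<integral>y. indicator {-1<..2} y \<partial>M n) = (\<Sum>i<Suc n. indicat_real {-1<..2} (x i)) / Suc n"
        by (rule int_M) auto
      also have "(\<Sum>i<Suc n. indicat_real {-1<..2} (x i)) = (\<Sum>i<Suc n. 1)"
        using x(1) by (intro sum.cong) (auto simp: indicator_def intro: less_le_trans[of _ 0] order_trans[of _ 1])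
      finally show ?thesis by simp
    qed
    then show "\<exists>a b. a < b \<and> (\<forall>n. 1 - \<epsilon> < measure (M n) {a<..b})"
      using \<epsilon> by (intro exI[of _ "-1"] exI[of _ 2]) auto
  qed
  from tight_imp_convergent_subsubsequence[OF this strict_mono_id]
  obtain r L where r: "strict_mono (r :: nat \<Rightarrow> nat)" and L: "real_distribution L" and conv: "weak_conv_m (M \<circ> id \<circ> r) L"
    by blast
  interpret L: real_distribution L by fact
  define \<mu> where "\<mu> = distr L borel \<gamma>"
  have \<mu>: "prob_space \<mu>" unfolding \<mu>_def by (rule L.prob_space_distr) simp
  have sets: "sets \<mu> = sets borel" by (simp add: \<mu>_def)
  have lim: "(\<lambda>k. (\<Sum>i<Suc (r k). f (a i)) / Suc (r k)) \<longlonglongrightarrow> (\<integral>z. f z \<partial>\<mu>)"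
    if f: "continuous_on UNIV f" and B: "\<And>z. \<bar>f z\<bar> \<le> B" for f :: "complex \<Rightarrow> real" and B
  proof -
    have fm [measurable]: "f \<in> borel_measurable borel" using f by (intro borel_measurable_continuous_onI)
    have c: "continuous_on UNIV (\<lambda>y. f (\<gamma> y))" by (rule continuous_on_compose2[OF f \<gamma>(1)]) auto
    have "(\<lambda>k. \<integral>y. f (\<gamma> y) \<partial>(M \<circ> id \<circ> r) k) \<longlonglongrightarrow> (\<integral>y. f (\<gamma> y) \<partial>L)"
      by (rule weak_conv_imp_integral_bdd_continuous_conv[OF _ L conv, of _ B])
         (use rd B c in \<open>auto simp: continuous_on_eq_continuous_at\<close>)
    then show ?thesis
      by (simp add: int_M x(2) \<mu>_def integral_distr)
  qed
  have "emeasure \<mu> A = 1"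
  proof -
    interpret \<mu>: prob_space \<mu> by (rule \<mu>)
    have Ane: "A \<noteq> {}" using a by auto
    \<comment> \<open>A bounded continuous test function that vanishes exactly on \<open>A\<close>;
      its averages over the sequence are 0, so the limit measure is carried by
      \<open>A\<close>.\<close>
    let ?f = "\<lambda>z. min 1 (infdist z A)"
    have cf: "continuous_on UNIV ?f" by (intro continuous_intros)
    have bf: "\<bar>?f z\<bar> \<le> 1" for z using infdist_nonneg[of z A] by auto
    have "(\<lambda>k. (\<Sum>i<Suc (r k). ?f (a i)) / Suc (r k)) \<longlonglongrightarrow> (\<integral>z. ?f z \<partial>\<mu>)" by (rule lim[OF cf bf])
    moreover have "?f (a i) = 0" for i using a[of i] by simp
    ultimately have 0: "(\<integral>z. ?f z \<partial>\<mu>) = 0" by (simp add: LIMSEQ_const_iff)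
    have fm: "?f \<in> borel_measurable \<mu>" using borel_measurable_continuous_onI[OF cf] by (simp add: measurable_cong_sets[OF sets])
    have "integrable \<mu> ?f" by (rule \<mu>.integrable_const_bound[of _ 1]) (use bf fm in auto)
    then have "AE z in \<mu>. ?f z = 0"
      using 0 infdist_nonneg by (subst integral_nonneg_eq_0_iff_AE[symmetric]) auto
    then have "AE z in \<mu>. z \<in> A"
    proof eventually_elim
      case (elim z)
      then have "infdist z A = 0" by (auto simp: min_def split: if_splits)
      then show ?case using in_closed_iff_infdist_zero[OF compact_imp_closed[OF A] Ane] by simp
    qed
    moreover have "A \<in> sets \<mu>" using A by (simp add: sets borel_compact)
    ultimately show ?thesis by (simp add: \<mu>.emeasure_eq_1_AE)
  qed
  then show thesis using that[OF \<mu> sets _ r] lim by blast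
qed

text \<open>Otherwise a greedy sequence has truncated energies bounded, up to a vanishing diagonal
  term, by a constant \<open>L\<close> free of the cut-off \<open>N\<close>. The bound passes to the
  weak limit for each \<open>N\<close>, and monotone convergence in \<open>N\<close> gives a measure
  of finite energy on \<open>A\<close>.\<close>

theorem capacity_zero_small_product:
  assumes A: "compact A" and ne: "A \<noteq> {}" and cap: "\<not> pos_log_cap A" and \<delta>: "\<delta> > 0"
  shows "\<exists>d a. d \<ge> 1 \<and> (\<forall>i<d. a i \<in> A) \<and> (\<forall>z\<in>A. (\<Prod>i<d. cmod (z - a i)) < \<delta> ^ (d::nat))"
proof (rule ccontr)
  assume neg: "\<not> ?thesis"
  have large: "\<exists>z\<in>A. \<delta> ^ d \<le> (\<Prod>i<d. cmod (z - a i))" if "d \<ge> 1" "\<And>i. i < d \<Longrightarrow> a i \<in> A" for d and a :: "nat \<Rightarrow> complex"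
    using neg that by (meson not_le)
  obtain a where a: "\<And>n. a n \<in> A" "\<And>n. \<delta> ^ n \<le> (\<Prod>i<n. cmod (a n - a i))"
    using leja_sequence[OF ne large] by blast
  obtain \<mu> r where \<mu>: "prob_space \<mu>" and sets: "sets \<mu> = sets borel" and one: "emeasure \<mu> A = 1" and r: "strict_mono (r :: nat \<Rightarrow> nat)"
    and lim': "\<forall>f B. continuous_on UNIV f \<longrightarrow> (\<forall>z. \<bar>f z\<bar> \<le> B) \<longrightarrow>
       (\<lambda>k. (\<Sum>i<Suc (r k). f (a i)) / Suc (r k)) \<longlonglongrightarrow> (\<integral>z. f z \<partial>\<mu> :: real)"
    by (rule bounded_sequence_weak_limit[where a = a, OF A a(1)])
  note lim = lim'[rule_format]
  interpret prob_space \<mu> by fact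
  note [measurable_cong] = sets
  have [simp]: "space \<mu> = UNIV" using sets_eq_imp_space_eq[OF sets] by simp
  obtain b where b: "\<And>z. z \<in> A \<Longrightarrow> cmod z \<le> b" using compact_imp_bounded[OF A] unfolding bounded_iff by auto
  define D where "D = max 1 (2 * b)"
  have D: "D \<ge> 1" "cmod (a i - a j) \<le> D" for i j
    using norm_triangle_ineq4[of "a i" "a j"] b[OF a(1)[of i]] b[OF a(1)[of j]] by (auto simp: D_def)
  define L where "L = ln D + \<bar>ln \<delta>\<bar>"
  have bound: "(\<integral>\<^sup>+z. (\<integral>\<^sup>+t. ennreal (trunc_neglog N (cmod (z - t))) \<partial>\<mu>) \<partial>\<mu>) \<le> ennreal L" for N
  proof -
    let ?k = "\<lambda>z t. trunc_neglog N (cmod (z - t))"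
    define G where "G z = (\<integral>t. ?k z t \<partial>\<mu>)" for z
    define g where "g k z = (\<Sum>i<Suc (r k). ?k z (a i)) / Suc (r k)" for k z
    have kint: "integrable \<mu> (?k z)" for z
      by (rule integrable_const_bound[of _ N]) (auto simp: trunc_neglog_bounds)
    have klip: "\<bar>?k z t - ?k z' t\<bar> \<le> exp N * dist z z'" for z z' t
    proof -
      have "\<bar>?k z t - ?k z' t\<bar> \<le> exp N * \<bar>cmod (z - t) - cmod (z' - t)\<bar>" by (rule trunc_neglog_lipschitz)
      also have "\<dots> \<le> exp N * dist z z'"
        using norm_triangle_ineq3[of "z - t" "z' - t"] by (intro mult_left_mono) (auto simp: dist_norm)
      finally show ?thesis .
    qed
    have Glip: "\<bar>G z - G z'\<bar> \<le> exp N * dist z z'" for z z'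
    proof -
      have "\<bar>G z - G z'\<bar> = \<bar>\<integral>t. ?k z t - ?k z' t \<partial>\<mu>\<bar>" by (simp add: G_def kint)
      also have "\<dots> \<le> (\<integral>t. \<bar>?k z t - ?k z' t\<bar> \<partial>\<mu>)" by (rule integral_abs_bound)
      also have "\<dots> \<le> (\<integral>t. exp N * dist z z' \<partial>\<mu>)" by (rule integral_mono) (use kint klip in auto)
      finally show ?thesis by (simp add: prob_space[simplified])
    qed
    have glip: "\<bar>g k z - g k z'\<bar> \<le> exp N * dist z z'" for k z z'
    proof -
      have "\<bar>g k z - g k z'\<bar> = \<bar>\<Sum>i<Suc (r k). ?k z (a i) - ?k z' (a i)\<bar> / Suc (r k)"
        unfolding g_def diff_divide_distrib[symmetric] sum_subtractf by simp
      also have "\<dots> \<le> (\<Sum>i<Suc (r k). exp N * dist z z') / Suc (r k)"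
        by (intro divide_right_mono order_trans[OF sum_abs] sum_mono klip) auto
      also have "\<dots> = exp N * dist z z'" by simp
      finally show ?thesis .
    qed
    have Gcont: "continuous_on UNIV G"
      by (rule lipschitz_on_continuous_on, rule lipschitz_onI[where L = "exp N"]) (use Glip in \<open>auto simp: dist_real_def\<close>)
    have G_nonneg: "0 \<le> G z" for z unfolding G_def by (intro integral_nonneg_AE) (auto simp: trunc_neglog_bounds)
    have G_le: "\<bar>G z\<bar> \<le> N" for z
    proof -
      have "G z \<le> (\<integral>t. real N \<partial>\<mu>)" unfolding G_def by (rule integral_mono) (use kint trunc_neglog_bounds in auto)
      then show ?thesis using G_nonneg[of z] by (simp add: prob_space[simplified])
    qed
    \<comment> \<open>Weak convergence handles one variable at a time. The kernel is Lipschitz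
      uniformly in the other variable, so the inner averages converge uniformly on \<open>A\<close>
      and may be averaged again over the moving points.\<close>
    have "uniform_limit A g G sequentially"
    proof (rule equi_lipschitz_uniform_limit[OF A])
      show "(\<lambda>k. g k z) \<longlonglongrightarrow> G z" for z
        unfolding g_def G_def by (rule lim[of _ "real N"]) (auto intro!: continuous_intros simp: abs_le_iff trunc_neglog_bounds order_trans[OF _ trunc_neglog_bounds(1)])
    qed (use glip Glip in auto)
    have "(\<integral>z. G z \<partial>\<mu>) \<le> L + e" if e: "e > 0" for e
    proof -
      \<comment> \<open>\<open>N / Suc (r k)\<close> is the diagonal contribution, \<open>e\<close>
        the error of the uniform convergence.\<close>
      have ev: "\<forall>\<^sub>F k in sequentially. (\<Sum>j<Suc (r k). G (a j)) / Suc (r k) \<le> L + N / Suc (r k) + e"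
        using uniform_limitD[OF \<open>uniform_limit A g G sequentially\<close> e]
      proof eventually_elim
        case (elim k)
        let ?n = "Suc (r k)"
        have "(\<Sum>j<?n. G (a j)) / ?n \<le> (\<Sum>j<?n. g k (a j) + e) / ?n"
        proof (intro divide_right_mono sum_mono)
          fix j show "G (a j) \<le> g k (a j) + e" using elim a(1)[of j] by (fastforce simp: dist_real_def)
        qed auto
        also have "\<dots> = (\<Sum>j<?n. g k (a j)) / ?n + e" by (simp add: sum.distrib add_divide_distrib del: sum.lessThan_Suc)
        also have "(\<Sum>j<?n. g k (a j)) = (\<Sum>j<?n. \<Sum>i<?n. ?k (a j) (a i)) / ?n"
          by (simp add: g_def sum_divide_distrib del: sum.lessThan_Suc)
        also have "\<dots> \<le> (real ?n ^ 2 * L + real ?n * N) / ?n"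
          unfolding L_def by (intro divide_right_mono leja_discrete_energy[OF \<delta> a(2) D]) auto
        also have "\<dots> = real ?n * L + N" by (simp add: field_simps power2_eq_square del: of_nat_Suc)
        finally show ?case by (simp add: add_divide_distrib divide_right_mono del: of_nat_Suc sum.lessThan_Suc)
      qed
      have "(\<lambda>k. 1 / real (Suc (r k))) \<longlonglongrightarrow> 0"
        using LIMSEQ_subseq_LIMSEQ[OF LIMSEQ_Suc[OF lim_1_over_n] r] by (simp add: o_def)
      then have "(\<lambda>k. L + real N * (1 / Suc (r k)) + e) \<longlonglongrightarrow> L + real N * 0 + e"
        by (intro tendsto_add tendsto_mult tendsto_const)
      then have "(\<lambda>k. L + N / Suc (r k) + e) \<longlonglongrightarrow> L + e" by simp
      from tendsto_le[OF _ this lim[OF Gcont G_le] ev] show ?thesis by simp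
    qed
    then have GL: "(\<integral>z. G z \<partial>\<mu>) \<le> L" by (rule field_le_epsilon)
    have "(\<integral>\<^sup>+z. (\<integral>\<^sup>+t. ennreal (?k z t) \<partial>\<mu>) \<partial>\<mu>) = (\<integral>\<^sup>+z. ennreal (G z) \<partial>\<mu>)"
      unfolding G_def by (intro nn_integral_cong nn_integral_eq_integral kint) (auto simp: trunc_neglog_bounds)
    also have "\<dots> = ennreal (\<integral>z. G z \<partial>\<mu>)"
    proof (rule nn_integral_eq_integral)
      have "G \<in> borel_measurable \<mu>"
        using borel_measurable_continuous_onI[OF Gcont] by (simp add: measurable_cong_sets[OF sets])
      then show "integrable \<mu> G" by (rule integrable_const_bound[of _ N, rotated]) (use G_le in auto)
    qed (use G_nonneg in auto)
    finally show ?thesis using GL by (simp add: ennreal_leI)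
  qed
  have "(\<integral>\<^sup>+z. (\<integral>\<^sup>+t. neglog (cmod (z - t)) \<partial>\<mu>) \<partial>\<mu>) =
      (\<integral>\<^sup>+z. (\<integral>\<^sup>+t. (SUP N. ennreal (trunc_neglog N (cmod (z - t)))) \<partial>\<mu>) \<partial>\<mu>)"
    by (simp add: neglog_eq_SUP_trunc)
  also have "\<dots> = (\<integral>\<^sup>+z. (SUP N. \<integral>\<^sup>+t. ennreal (trunc_neglog N (cmod (z - t))) \<partial>\<mu>) \<partial>\<mu>)"
    by (intro nn_integral_cong nn_integral_monotone_convergence_SUP)
       (auto simp: incseq_def le_fun_def intro!: ennreal_leI trunc_neglog_mono)
  also have "\<dots> = (SUP N. \<integral>\<^sup>+z. (\<integral>\<^sup>+t. ennreal (trunc_neglog N (cmod (z - t))) \<partial>\<mu>) \<partial>\<mu>)"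
    by (intro nn_integral_monotone_convergence_SUP)
       (auto simp: incseq_def le_fun_def intro!: nn_integral_mono ennreal_leI trunc_neglog_mono)
  also have "\<dots> \<le> ennreal L" using bound by (rule SUP_least)
  also have "\<dots> < \<infinity>" by simp
  finally have "finite_log_energy \<mu>" unfolding finite_log_energy_def .
  then have "pos_log_cap A"
    unfolding pos_log_cap_def using A \<mu> sets one by (intro exI[of _ A] exI[of _ \<mu>]) auto
  with cap show False by contradiction
qed

section \<open>Weighted equilibrium measures\<close>

lemma AE_msupp:
  assumes "sets \<mu> = sets borel"
  shows "AE t in \<mu>. t \<in> msupp \<mu>"
proof -
  let ?F = "{B. \<exists>z e. e > 0 \<and> B = ball z e \<and> emeasure \<mu> B = 0}"
  obtain F' where F': "F' \<subseteq> ?F" "countable F'" "\<Union>F' = \<Union>?F"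
    by (rule Lindelof[of ?F]) auto
  have "B \<in> null_sets \<mu>" if "B \<in> F'" for B
    using that F'(1) assms by (auto intro!: null_setsI)
  then have "\<Union>F' \<in> null_sets \<mu>"
    using null_sets_UN'[OF F'(2), of "\<lambda>B. B" \<mu>] by simp
  moreover have "{t \<in> space \<mu>. t \<notin> msupp \<mu>} \<subseteq> \<Union>F'"
  proof
    fix t assume "t \<in> {t \<in> space \<mu>. t \<notin> msupp \<mu>}"
    then obtain e where "e > 0" "emeasure \<mu> (ball t e) = 0" by (auto simp: msupp_def)
    then show "t \<in> \<Union>F'" unfolding F'(3) by (auto intro!: exI[of _ "ball t e"])
  qed
  ultimately show ?thesis by (rule AE_I')
qed

lemma ereal_add3_nonneg_imp:
  fixes x y :: ereal and r :: real
  assumes "x + y + ereal r \<ge> 0" "x \<noteq> \<infinity>" "y \<noteq> \<infinity>"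
  shows "x \<noteq> -\<infinity>" "y \<noteq> -\<infinity>"
  using assms by (cases x; cases y; simp)+

locale weighted_equilibrium =
  fixes E :: "complex set" and w :: "complex \<Rightarrow> real" and \<mu> :: "complex measure" and F :: real
  assumes closed_E: "closed E"
    and adm: "admissible_weight E w"
    and equi: "is_weighted_equilibrium E w \<mu> F"
begin

lemma support_subset: "msupp \<mu> \<subseteq> E"
  using equi by (auto simp: is_weighted_equilibrium_def)

lemma w_nonneg: "z \<in> E \<Longrightarrow> 0 \<le> w z"
  using adm by (auto simp: admissible_weight_def)

text \<open>If the potential or \<open>elog (w z)\<close> were \<open>-\<infinity>\<close>, so would
  be the whole sum, against the equilibrium inequality on the support.\<close>

lemma logint_finite_on_support:
  assumes "z \<in> msupp \<mu>"
  shows "(\<integral>\<^sup>+t. neglog (cmod (z - t)) \<partial>\<mu>) < \<infinity>" "w z > 0"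
proof -
  have *: "logint \<mu> (\<lambda>t. cmod (z - t)) + elog (w z) + ereal F \<ge> 0"
    using equi assms by (auto simp: is_weighted_equilibrium_def)
  have 1: "logint \<mu> (\<lambda>t. cmod (z - t)) \<noteq> \<infinity>"
    unfolding logint_def by (cases "enn2ereal (\<integral>\<^sup>+t. neglog (cmod (z - t)) \<partial>\<mu>)") (use enn2ereal_nonneg in auto)
  have 2: "elog (w z) \<noteq> \<infinity>" by (auto simp: elog_def)
  have "logint \<mu> (\<lambda>t. cmod (z - t)) \<noteq> -\<infinity>" "elog (w z) \<noteq> -\<infinity>"
    using ereal_add3_nonneg_imp[OF * 1 2] by auto
  then show "(\<integral>\<^sup>+t. neglog (cmod (z - t)) \<partial>\<mu>) < \<infinity>" "w z > 0"
    by (auto simp: logint_def elog_def less_top[symmetric] split: if_splits)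
qed

text \<open>On the support the potential is finite by the equilibrium inequality, off it because a
  whole ball around the point carries no mass.\<close>

sublocale finite_log_potential \<mu> "msupp \<mu>"
proof -
  interpret prob_space \<mu> using equi by (simp add: is_weighted_equilibrium_def)
  show "finite_log_potential \<mu> (msupp \<mu>)"
  proof
    show sets: "sets \<mu> = sets borel" using equi by (simp add: is_weighted_equilibrium_def)
    then show "AE t in \<mu>. t \<in> msupp \<mu>" by (rule AE_msupp)
    show "compact (msupp \<mu>)" using equi by (simp add: is_weighted_equilibrium_def)
    fix z
    show "(\<integral>\<^sup>+t. neglog (cmod (z - t)) \<partial>\<mu>) < \<infinity>"
    proof (cases "z \<in> msupp \<mu>")
      case True
      then show ?thesis by (rule logint_finite_on_support)
    next
      case False
      then obtain e where e: "e > 0" "emeasure \<mu> (ball z e) = 0" by (auto simp: msupp_def)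
      then have "ball z e \<in> null_sets \<mu>" by (auto simp: sets intro!: null_setsI)
      then have "AE t in \<mu>. t \<notin> ball z e" by (rule AE_not_in)
      then have "AE t in \<mu>. neglog (cmod (z - t)) \<le> ennreal \<bar>ln e\<bar>"
      proof eventually_elim
        case (elim t)
        then have "e \<le> cmod (z - t)" by (simp add: dist_norm)
        then have "ln e \<le> ln (cmod (z - t))" "0 < cmod (z - t)" using e(1) by (auto intro!: ln_mono)
        then show ?case by (auto simp: neglog_def intro!: ennreal_leI)
      qed
      then have "(\<integral>\<^sup>+t. neglog (cmod (z - t)) \<partial>\<mu>) \<le> (\<integral>\<^sup>+t. ennreal \<bar>ln e\<bar> \<partial>\<mu>)" by (rule nn_integral_mono_AE)
      also have "\<dots> < \<infinity>" by (simp add: emeasure_space_1 ennreal_mult_less_top)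
      finally show ?thesis .
    qed
  qed
qed

lemma equilibrium_on_support:
  assumes "z \<in> msupp \<mu>"
  shows "w z > 0" "0 \<le> U z + ln (w z) + F"
proof -
  show w: "w z > 0" by (rule logint_finite_on_support[OF assms])
  have "logint \<mu> (\<lambda>t. cmod (z - t)) + elog (w z) + ereal F \<ge> 0"
    using equi assms by (auto simp: is_weighted_equilibrium_def)
  then show "0 \<le> U z + ln (w z) + F" using w by (simp add: logint_eq_U elog_def)
qed

section \<open>Consequences of the admissibility of the weight\<close>

lemma w_usc:
  assumes "z \<in> E" "w z < a"
  obtains \<delta> where "\<delta> > 0" "\<And>t. t \<in> E \<Longrightarrow> dist t z < \<delta> \<Longrightarrow> w t < a"
  using adm assms unfolding admissible_weight_def by blast

lemma w_decay:
  assumes "\<epsilon> > 0"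
  obtains R where "R > 0" "\<And>z. z \<in> E \<Longrightarrow> cmod z > R \<Longrightarrow> cmod z * w z < \<epsilon>"
proof (cases "bounded E")
  case True
  then obtain R where "R > 0" "\<And>z. z \<in> E \<Longrightarrow> cmod z \<le> R" unfolding bounded_pos by auto
  then show thesis using that[of R] by (meson not_le)
next
  case False
  then obtain R where R: "\<And>z. z \<in> E \<Longrightarrow> cmod z > R \<Longrightarrow> cmod z * w z < \<epsilon>"
    using adm assms unfolding admissible_weight_def by blast
  show thesis by (rule that[of "max 1 R"]) (use R in auto)
qed

text \<open>Decay settles large \<open>cmod z\<close>; on the remaining compact part upper
  semicontinuity gives local bounds, of which finitely many suffice.\<close>

lemma w_bounded:
  obtains W where "W > 0" "\<And>z. z \<in> E \<Longrightarrow> w z \<le> W"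
proof -
  obtain R where R: "R > 0" "\<And>z. z \<in> E \<Longrightarrow> cmod z > R \<Longrightarrow> cmod z * w z < 1" by (rule w_decay[of 1]) auto
  have cpt: "compact (E \<inter> cball 0 R)" using closed_E by (intro closed_Int_compact) auto
  have "\<forall>z\<in>E. \<exists>\<delta>>0. \<forall>t\<in>E. dist t z < \<delta> \<longrightarrow> w t < w z + 1"
    by (metis w_usc less_add_one)
  then obtain \<delta> where \<delta>: "\<And>z. z \<in> E \<Longrightarrow> \<delta> z > 0" "\<And>z t. z \<in> E \<Longrightarrow> t \<in> E \<Longrightarrow> dist t z < \<delta> z \<Longrightarrow> w t < w z + 1"
    by metis
  have "E \<inter> cball 0 R \<subseteq> (\<Union>z\<in>E \<inter> cball 0 R. ball z (\<delta> z))" using \<delta>(1) by force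
  then obtain T where T: "T \<subseteq> E \<inter> cball 0 R" "finite T" "E \<inter> cball 0 R \<subseteq> (\<Union>z\<in>T. ball z (\<delta> z))"
    by (rule compactE_image[OF cpt, rotated]) auto
  define W where "W = Max (insert (1 + 1 / R) ((\<lambda>z. w z + 1) ` T))"
  have W: "1 + 1 / R \<le> W" "\<And>z. z \<in> T \<Longrightarrow> w z + 1 \<le> W" using T(2) by (auto simp: W_def intro!: Max_ge)
  show thesis
  proof (rule that[of W])
    have "0 < 1 + 1 / R" using R(1) by (simp add: add_pos_pos)
    then show "W > 0" using W(1) by linarith
    fix z assume z: "z \<in> E"
    show "w z \<le> W"
    proof (cases "cmod z > R")
      case True
      then have "w z < 1 / cmod z" using R z less_trans[OF R(1) True] by (simp add: field_simps)
      also have "\<dots> \<le> 1 / R" using True less_trans[OF R(1) True] R(1) by (intro divide_left_mono mult_pos_pos) auto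
      finally show ?thesis using W(1) by linarith
    next
      case False
      then obtain t where t: "t \<in> T" "z \<in> ball t (\<delta> t)" using T(3) z by fastforce
      then have "w z < w t + 1" using \<delta>(2)[of t z] T(1) z by (auto simp: dist_commute)
      then show ?thesis using W(2)[OF t(1)] by linarith
    qed
  qed
qed

text \<open>What polynomials of degree \<open>n\<close> against the weight \<open>w ^ n\<close>
  require: a linear factor with its zero in the disc of radius \<open>\<rho>\<close> stays bounded
  on \<open>E\<close> once it has received one factor \<open>w\<close>.\<close>

lemma w_linear_bounded:
  assumes "\<rho> \<ge> 0"
  obtains \<Gamma> where "\<Gamma> > 0" "\<And>z. z \<in> E \<Longrightarrow> w z * (cmod z + \<rho>) \<le> \<Gamma>"
proof -
  obtain W where W: "W > 0" "\<And>z. z \<in> E \<Longrightarrow> w z \<le> W" by (rule w_bounded) blast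
  obtain R where R: "R > 0" "\<And>z. z \<in> E \<Longrightarrow> cmod z > R \<Longrightarrow> cmod z * w z < 1" by (rule w_decay[of 1]) auto
  show thesis
  proof (rule that[of "W * (R + \<rho>) + 1"])
    show "0 < W * (R + \<rho>) + 1" using W(1) R(1) assms by (simp add: add_nonneg_pos)
    fix z assume z: "z \<in> E"
    have 1: "w z * \<rho> \<le> W * \<rho>" using W(2)[OF z] assms by (rule mult_right_mono)
    have "w z * cmod z \<le> W * R + 1"
    proof (cases "cmod z > R")
      case True
      moreover have "0 < W * R" using W(1) R(1) by simp
      ultimately show ?thesis using R(2)[OF z] by (simp add: mult.commute)
    next
      case False
      then have "w z * cmod z \<le> W * R" using W z w_nonneg[OF z] by (intro mult_mono) auto
      then show ?thesis by simp
    qed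
    with 1 show "w z * (cmod z + \<rho>) \<le> W * (R + \<rho>) + 1" by (simp add: algebra_simps)
  qed
qed

lemma w_dist_bdd_above: "bdd_above ((\<lambda>t. w t * cmod (z - t)) ` E)"
proof -
  obtain \<Gamma> where \<Gamma>: "\<And>t. t \<in> E \<Longrightarrow> w t * (cmod t + cmod z) \<le> \<Gamma>" using w_linear_bounded[of "cmod z"] by auto
  show ?thesis
  proof (rule bdd_aboveI2)
    fix t assume t: "t \<in> E"
    have "w t * cmod (z - t) \<le> w t * (cmod t + cmod z)"
      using w_nonneg[OF t] norm_triangle_ineq4[of z t] by (intro mult_left_mono) auto
    then show "w t * cmod (z - t) \<le> \<Gamma>" using \<Gamma>[OF t] by simp
  qed
qed

lemma closed_superlevel:
  assumes "continuous_on UNIV g"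
  shows "closed {z \<in> E. g z \<le> w z}"
proof (subst closed_sequential_limits, intro allI impI, elim conjE)
  fix x l assume x: "\<forall>n. x n \<in> {z \<in> E. g z \<le> w z}" and l: "x \<longlonglongrightarrow> l"
  have lE: "l \<in> E" using closed_E x l by (auto simp: closed_sequential_limits)
  have "g l \<le> w l"
  proof (rule ccontr)
    assume "\<not> ?thesis"
    then obtain b where b: "w l < b" "b < g l" using dense not_le by metis
    obtain \<delta> where \<delta>: "\<delta> > 0" "\<And>t. t \<in> E \<Longrightarrow> dist t l < \<delta> \<Longrightarrow> w t < b" by (rule w_usc[OF lE b(1)]) blast
    have "isCont g l" using assms by (simp add: continuous_on_eq_continuous_at)
    then have "(\<lambda>n. g (x n)) \<longlonglongrightarrow> g l" using l by (rule isCont_tendsto_compose)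
    then have "\<forall>\<^sub>F n in sequentially. b < g (x n)" using b(2) by (rule order_tendstoD)
    moreover have "\<forall>\<^sub>F n in sequentially. dist (x n) l < \<delta>" using l \<delta>(1) by (rule tendstoD)
    ultimately have "\<forall>\<^sub>F n in sequentially. False"
    proof eventually_elim
      case (elim n)
      then show ?case using \<delta>(2)[of "x n"] x[rule_format, of n] by auto
    qed
    then show False by simp
  qed
  then show "l \<in> {z \<in> E. g z \<le> w z}" using lE by simp
qed

text \<open>A support consisting of one point would carry an atom, which the finiteness of the
  potential excludes.\<close>

lemma support_two_points:
  obtains s where "s \<in> msupp \<mu>" "s \<noteq> c"
proof -
  have "AE t in \<mu>. t \<in> msupp \<mu> \<and> t \<noteq> c" using AE_support AE_neq[of c] by eventually_elim auto
  then have "\<exists>t. t \<in> msupp \<mu> \<and> t \<noteq> c"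
    using eventually_mono[of "\<lambda>t. t \<in> msupp \<mu> \<and> t \<noteq> c" "ae_filter \<mu>" "\<lambda>_. False"] AE_False by blast
  then show thesis using that by blast
qed

lemma E_nonempty: "E \<noteq> {}"
  using S_nonempty support_subset by auto

lemma U_lower_on_support: obtains B where "\<And>z. z \<in> msupp \<mu> \<Longrightarrow> - B \<le> U z"
proof -
  obtain W where W: "W > 0" "\<And>z. z \<in> E \<Longrightarrow> w z \<le> W" by (rule w_bounded) blast
  show thesis
  proof (rule that[of "ln W + F"])
    fix z assume z: "z \<in> msupp \<mu>"
    have "ln (w z) \<le> ln W"
      using equilibrium_on_support(1)[OF z] W(2)[of z] z support_subset by (intro ln_mono) auto
    then show "- (ln W + F) \<le> U z" using equilibrium_on_support(2)[OF z] by linarith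
  qed
qed

theorem bernstein_walsh:
  assumes Bd: "Bd > 0" and bound: "\<And>z. z \<in> E \<Longrightarrow> w z ^ degree P * cmod (poly P z) \<le> Bd"
  shows "cmod (poly P x) \<le> Bd * exp (degree P * (U x + F))"
proof -
  obtain B where B: "\<And>z. z \<in> msupp \<mu> \<Longrightarrow> - B \<le> U z" by (rule U_lower_on_support) blast
  let ?n = "degree P"
  have "cmod (poly P x) \<le> exp ((ln Bd + ?n * F) + ?n * U x)"
  proof (rule poly_domination_principle[OF B])
    fix z assume z: "z \<in> msupp \<mu>"
    have w: "w z > 0" and e: "- ln (w z) \<le> U z + F" using equilibrium_on_support[OF z] by auto
    have "cmod (poly P z) \<le> Bd / w z ^ ?n"
      using bound[of z] z support_subset w by (auto simp: field_simps)
    also have "\<dots> = exp (ln Bd + ?n * (- ln (w z)))"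
      using w Bd by (simp add: exp_diff exp_of_nat_mult)
    also have "\<dots> \<le> exp (ln Bd + ?n * (U z + F))"
      using mult_left_mono[OF e, of "real ?n"] by simp
    finally show "cmod (poly P z) \<le> exp (ln Bd + ?n * F + ?n * U z)" by (simp add: algebra_simps)
  qed auto
  also have "\<dots> = Bd * exp (?n * (U x + F))" using Bd by (simp add: exp_add algebra_simps)
  finally show ?thesis .
qed

end

section \<open>The upper bound\<close>

lemma prod_mset_nth:
  fixes f :: "'a \<Rightarrow> 'b::comm_monoid_mult"
  shows "(\<Prod>x\<in>#mset xs. f x) = (\<Prod>k<length xs. f (xs ! k))"
proof -
  have "(\<Prod>x\<in>#mset xs. f x) = prod_list (map f xs)"
    by (simp add: prod_mset_prod_list[symmetric])
  also have "\<dots> = (\<Prod>k<length xs. f (xs ! k))"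
    by (simp add: prod.list_conv_set_nth atLeast0LessThan)
  finally show ?thesis .
qed

lemma Max_image_power:
  fixes f :: "'a \<Rightarrow> real"
  assumes "finite J" "J \<noteq> {}" "\<And>j. j \<in> J \<Longrightarrow> 0 \<le> f j"
  shows "Max ((\<lambda>j. f j ^ p) ` J) = Max (f ` J) ^ p"
proof (rule Max_eqI)
  have "Max (f ` J) \<in> f ` J" using assms by (intro Max_in) auto
  then show "Max (f ` J) ^ p \<in> (\<lambda>j. f j ^ p) ` J" by auto
  fix y assume "y \<in> (\<lambda>j. f j ^ p) ` J"
  then show "y \<le> Max (f ` J) ^ p" using assms by (auto intro!: power_mono)
qed (use assms in auto)

lemma ln_prod_mset:
  fixes f :: "'a \<Rightarrow> real"
  shows "(\<And>x. x \<in># A \<Longrightarrow> 0 < f x) \<Longrightarrow> 0 < (\<Prod>x\<in>#A. f x) \<and> ln (\<Prod>x\<in>#A. f x) = (\<Sum>x\<in>#A. ln (f x))"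
proof (induction A)
  case (add x A)
  then have "0 < f x" "0 < (\<Prod>x\<in>#A. f x)" "ln (\<Prod>x\<in>#A. f x) = (\<Sum>x\<in>#A. ln (f x))" by auto
  then have "ln (f x * (\<Prod>x\<in>#A. f x)) = ln (f x) + (\<Sum>x\<in>#A. ln (f x))" "0 < f x * (\<Prod>x\<in>#A. f x)"
    by (simp_all only: ln_mult_pos mult_pos_pos)
  then show ?case by simp
qed simp

lemma prod_mset_const: "(\<Prod>x\<in>#A. c) = c ^ size A" for c :: "'b::comm_monoid_mult"
  by (induction A) auto

text \<open>Taking \<open>p\<close>-th roots and letting \<open>p\<close> tend to infinity removes
  any constant that does not depend on \<open>p\<close>.\<close>

lemma le_of_power_le_const_mult:
  fixes X Y K :: real
  assumes "Y > 0" and *: "\<And>p::nat. p \<ge> 1 \<Longrightarrow> X ^ p \<le> K * Y ^ p"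
  shows "X \<le> Y"
proof (rule ccontr)
  assume "\<not> X \<le> Y"
  then have "1 < X / Y" using assms(1) by simp
  then obtain p where p: "max 1 K < (X / Y) ^ p" using real_arch_pow by blast
  then have "p \<noteq> 0" by (intro notI) auto
  then have "X ^ p \<le> K * Y ^ p" using * by simp
  then have "(X / Y) ^ p \<le> K" using assms(1) by (simp add: power_divide pos_divide_le_eq)
  then show False using p by simp
qed

context finite_log_potential
begin

text \<open>By symmetry of the kernel, the sum of \<open>U\<close> over the zeros of a polynomial is
  the integral of the logarithm of its modulus against \<open>\<mu>\<close>, up to the leading
  coefficient.\<close>

lemma integral_sum_mset_ln:
  "integrable \<mu> (\<lambda>z. \<Sum>t\<in>#T. ln (cmod (z - t))) \<and> (\<integral>z. (\<Sum>t\<in>#T. ln (cmod (z - t))) \<partial>\<mu>) = (\<Sum>t\<in>#T. U t)"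
proof (induction T)
  case (add t T)
  have "integrable \<mu> (\<lambda>z. ln (cmod (z - t)))" "(\<integral>z. ln (cmod (z - t)) \<partial>\<mu>) = U t"
    using integrable_ln[of t] by (simp_all add: U_def norm_minus_commute)
  with add show ?case by simp
qed simp

end

context weighted_equilibrium
begin

definition wmax :: "nat \<Rightarrow> (nat \<Rightarrow> complex) \<Rightarrow> complex \<Rightarrow> real" where
  "wmax m c z = Max ((\<lambda>k. w (c k) * cmod (z - c k)) ` {..<m})"

lemma wmax_ge: "k < m \<Longrightarrow> w (c k) * cmod (z - c k) \<le> wmax m c z"
  unfolding wmax_def by (intro Max_ge) auto

lemma wmax_nonneg:
  assumes "m \<ge> 1" "\<And>k. k < m \<Longrightarrow> c k \<in> E"
  shows "0 \<le> wmax m c z"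
proof -
  have "0 \<le> w (c 0) * cmod (z - c 0)" using assms(2)[of 0] assms(1) w_nonneg[of "c 0"] by simp
  also have "\<dots> \<le> wmax m c z" using assms(1) by (intro wmax_ge) auto
  finally show ?thesis .
qed

lemma wmax_le:
  assumes "m \<ge> 1" "\<And>k. k < m \<Longrightarrow> w (c k) * cmod (z - c k) \<le> b"
  shows "wmax m c z \<le> b"
  unfolding wmax_def using assms by (subst Max_le_iff) (auto simp: lessThan_empty_iff)

lemma continuous_wmax:
  assumes "m \<ge> 1"
  shows "continuous_on A (wmax m c)"
  using assms
proof (induction m rule: dec_induct)
  case base
  have "wmax 1 c = (\<lambda>z. w (c 0) * cmod (z - c 0))" by (auto simp: wmax_def lessThan_Suc)
  then show ?case by (auto intro!: continuous_intros)
next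
  case (step m)
  have "wmax (Suc m) c = (\<lambda>z. max (w (c m) * cmod (z - c m)) (wmax m c z))"
    using step.hyps(1) by (auto simp: wmax_def lessThan_Suc lessThan_empty_iff)
  then show ?case using step.IH by (auto intro!: continuous_intros)
qed

lemma wmax_measurable:
  assumes "m \<ge> 1"
  shows "wmax m c \<in> borel_measurable \<mu>"
  using borel_measurable_continuous_onI[OF continuous_wmax[OF assms, of UNIV c]]
  by (simp add: measurable_cong_sets[OF sets_eq])

lemma wmax_bounded_on_support:
  assumes "m \<ge> 1"
  obtains b where "b > 0" "\<And>z. z \<in> msupp \<mu> \<Longrightarrow> wmax m c z \<le> b"
proof -
  have "bounded (wmax m c ` msupp \<mu>)"
    using continuous_wmax[OF assms] compact_support by (intro compact_imp_bounded compact_continuous_image)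
  then obtain b where b: "\<And>z. z \<in> msupp \<mu> \<Longrightarrow> \<bar>wmax m c z\<bar> \<le> b" unfolding bounded_iff by auto
  show thesis by (rule that[of "max 1 b"]) (use b in \<open>auto simp: le_max_iff_disj abs_le_iff\<close>)
qed

lemma wmax_integrable:
  assumes m: "m \<ge> 1" and c: "\<And>k. k < m \<Longrightarrow> c k \<in> E" and k: "k < m" "w (c k) > 0"
  shows "AE z in \<mu>. 0 < wmax m c z" "integrable \<mu> (\<lambda>z. ln (wmax m c z))"
proof -
  note [measurable] = wmax_measurable[OF m, of c]
  have low: "AE z in \<mu>. 0 < w (c k) * cmod (z - c k)"
    using AE_neq[of "c k"] by eventually_elim (use k in auto)
  then show "AE z in \<mu>. 0 < wmax m c z"
    by eventually_elim (use wmax_ge[OF k(1)] in \<open>auto intro: less_le_trans\<close>)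
  obtain b where b: "b > 0" "\<And>z. z \<in> msupp \<mu> \<Longrightarrow> wmax m c z \<le> b" by (rule wmax_bounded_on_support[OF m]) blast
  show "integrable \<mu> (\<lambda>z. ln (wmax m c z))"
  proof (rule Bochner_Integration.integrable_bound)
    show "integrable \<mu> (\<lambda>z. \<bar>ln (w (c k))\<bar> + \<bar>ln b\<bar> + \<bar>ln (cmod (c k - z))\<bar>)"
      by (intro Bochner_Integration.integrable_add integrable_abs integrable_ln) auto
    show "AE z in \<mu>. norm (ln (wmax m c z)) \<le> norm (\<bar>ln (w (c k))\<bar> + \<bar>ln b\<bar> + \<bar>ln (cmod (c k - z))\<bar>)"
      using low AE_support
    proof eventually_elim
      case (elim z)
      have "ln (w (c k) * cmod (z - c k)) \<le> ln (wmax m c z)"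
        using elim(1) wmax_ge[OF k(1), of c z] by (intro ln_mono)
      moreover have "ln (w (c k) * cmod (z - c k)) = ln (w (c k)) + ln (cmod (c k - z))"
        using elim(1) k(2) by (subst ln_mult) (auto simp: norm_minus_commute zero_less_mult_iff)
      moreover have "ln (wmax m c z) \<le> ln b"
        using b(2)[OF elim(2)] less_le_trans[OF elim(1) wmax_ge[OF k(1), of c z]] by (intro ln_mono)
      ultimately show ?case by auto
    qed
  qed measurable
qed

lemma logint_wmax:
  assumes m: "m \<ge> 1" and c: "\<And>k. k < m \<Longrightarrow> c k \<in> E"
  shows "(\<exists>k<m. w (c k) > 0) \<Longrightarrow> logint \<mu> (wmax m c) = ereal (\<integral>z. ln (wmax m c z) \<partial>\<mu>)"
    and "\<not> (\<exists>k<m. w (c k) > 0) \<Longrightarrow> logint \<mu> (wmax m c) = -\<infinity>"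
proof -
  assume "\<exists>k<m. w (c k) > 0"
  then show "logint \<mu> (wmax m c) = ereal (\<integral>z. ln (wmax m c z) \<partial>\<mu>)"
    using wmax_integrable[where c = c, OF m c] by (intro logint_eq_integral) auto
next
  assume "\<not> (\<exists>k<m. w (c k) > 0)"
  then have "w (c k) = 0" if "k < m" for k using w_nonneg[OF c[OF that]] that by force
  then have "wmax m c z \<le> 0" for z using m by (intro wmax_le) auto
  then have "wmax m c z = 0" for z using wmax_nonneg[of m c, OF m c] by (simp add: antisym)
  then show "logint \<mu> (wmax m c) = -\<infinity>"
    by (simp add: logint_def neglog_def emeasure_space_1[simplified])
qed

lemma CEwm_eq: "CEwm E w \<mu> F m = (SUP c\<in>{c. \<forall>k<m. c k \<in> E}. logint \<mu> (wmax m c) + ereal F)"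
  unfolding CEwm_def wmax_def[abs_def] ..

text \<open>With \<open>Q = \<Sum>\<^sub>j \<zeta>\<^sub>j (w(c\<^sub>j) (z - c\<^sub>j))\<^sup>p\<close> and unimodular \<open>\<zeta>\<^sub>j\<close>, comparing the products of \<open>|Q|\<close> over the zeros of \<open>P\<close>
  and of \<open>|P|\<close> over the zeros of \<open>Q\<close> moves the Bernstein--Walsh bound from the latter to the former.
  As \<open>|Q| \<le> m wmax\<^sup>p\<close>, the loss disappears for \<open>p \<rightarrow> \<infinity>\<close>. The linear form with index \<open>length xs\<close> keeps the
  leading coefficient of \<open>Q\<close> away from zero.\<close>

lemma prod_wmax_power_bound:
  assumes m: "m \<ge> 1" and c: "\<And>k. k < m \<Longrightarrow> c k \<in> E" and k0: "k0 < m" "w (c k0) > 0"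
    and P: "P \<noteq> 0" and Bd: "Bd > 0" "\<And>z. z \<in> E \<Longrightarrow> w z ^ degree P * cmod (poly P z) \<le> Bd"
    and gpos: "\<And>x. x \<in># proots P \<Longrightarrow> wmax m c x > 0" and p: "p \<ge> 1"
  shows "(cmod (lead_coeff P) * (\<Prod>x\<in>#proots P. wmax m c x)) ^ p \<le>
     real m ^ (degree P + 1) * (Bd * exp (degree P * ((\<integral>z. ln (wmax m c z) \<partial>\<mu>) + F))) ^ p"
proof -
  let ?g = "wmax m c" and ?n = "degree P"
  define I where "I = (\<integral>z. ln (?g z) \<partial>\<mu>)"
  define Wm where "Wm = Max ((\<lambda>j. w (c j)) ` {..<m})"
  obtain xs where xs: "mset xs = proots P" using ex_mset by blast
  have len: "length xs = ?n" using xs by (metis size_mset size_proots_complex)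
  have Wm: "w (c j) \<le> Wm" if "j < m" for j unfolding Wm_def using that by (intro Max_ge) auto
  have Wm_pos: "Wm > 0" using Wm[OF k0(1)] k0(2) by linarith
  define b where "b j k = (if k < ?n then (of_real (w (c j)) * (xs ! k - c j)) ^ p else of_real (w (c j)) ^ p)" for j k
  have ne: "{..<m} \<noteq> {}" using m by (auto simp: lessThan_empty_iff)
  obtain \<zeta> where \<zeta>: "\<And>j. cmod (\<zeta> j) = 1"
     "(\<Prod>k\<le>?n. Max ((\<lambda>j. cmod (b j k)) ` {..<m})) \<le> (\<Prod>k\<le>?n. cmod (\<Sum>j<m. \<zeta> j * b j k))"
    using norm_prod_linear_forms_torus_ge[OF _ m, of "{..?n}" b] by auto
  define Q where "Q = (\<Sum>j<m. smult (\<zeta> j * of_real (w (c j)) ^ p) ([:- c j, 1:] ^ p))"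
  define A where "A = (\<Sum>j<m. \<zeta> j * of_real (w (c j)) ^ p)"
  have polyQ: "poly Q z = (\<Sum>j<m. \<zeta> j * (of_real (w (c j)) * (z - c j)) ^ p)" for z
    unfolding Q_def by (simp add: poly_sum power_mult_distrib mult.assoc)
  have coeffQ: "coeff Q p = A"
  proof -
    have "coeff ([:- a, 1:] ^ p) p = 1" for a :: complex
      using lead_coeff_power[of "[:- a, 1:]" p] degree_linear_power[of "- a" p] by simp
    then show ?thesis unfolding Q_def A_def by (simp add: coeff_sum)
  qed
  have degQ: "degree Q \<le> p"
    unfolding Q_def
  proof (rule degree_sum_le)
    fix j show "degree (smult (\<zeta> j * of_real (w (c j)) ^ p) ([:- c j, 1:] ^ p)) \<le> p"
      using degree_smult_le[of "\<zeta> j * of_real (w (c j)) ^ p" "[:- c j, 1:] ^ p"] by (simp add: degree_linear_power)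
  qed auto
  have Qg: "cmod (poly Q z) \<le> m * ?g z ^ p" for z
  proof -
    have "cmod (poly Q z) \<le> (\<Sum>j<m. cmod (\<zeta> j * (of_real (w (c j)) * (z - c j)) ^ p))"
      unfolding polyQ by (rule norm_sum)
    also have "\<dots> \<le> (\<Sum>j<m. ?g z ^ p)"
    proof (rule sum_mono)
      fix j assume "j \<in> {..<m}"
      then show "cmod (\<zeta> j * (of_real (w (c j)) * (z - c j)) ^ p) \<le> ?g z ^ p"
        using \<zeta>(1) wmax_ge[of j m c z] w_nonneg[OF c[of j]]
        by (auto simp: norm_mult norm_power intro!: power_mono)
    qed
    finally show ?thesis by simp
  qed
  have A_le: "cmod A \<le> m * Wm ^ p"
  proof -
    have "cmod A \<le> (\<Sum>j<m. cmod (\<zeta> j * of_real (w (c j)) ^ p))" unfolding A_def by (rule norm_sum)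
    also have "\<dots> \<le> (\<Sum>j<m. Wm ^ p)"
    proof (rule sum_mono)
      fix j assume "j \<in> {..<m}"
      then show "cmod (\<zeta> j * of_real (w (c j)) ^ p) \<le> Wm ^ p"
        using \<zeta>(1) Wm[of j] w_nonneg[OF c[of j]] by (auto simp: norm_mult norm_power intro!: power_mono)
    qed
    finally show ?thesis by simp
  qed
  have gk: "Max ((\<lambda>j. cmod (b j k)) ` {..<m}) = ?g (xs ! k) ^ p" if "k < ?n" for k
  proof -
    have "Max ((\<lambda>j. cmod (b j k)) ` {..<m}) = Max ((\<lambda>j. (w (c j) * cmod (xs ! k - c j)) ^ p) ` {..<m})"
      using that w_nonneg[OF c] by (intro arg_cong[where f = Max] image_cong) (auto simp: b_def norm_mult norm_power)
    also have "\<dots> = ?g (xs ! k) ^ p"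
      unfolding wmax_def using ne w_nonneg[OF c] by (intro Max_image_power) auto
    finally show ?thesis .
  qed
  have gn: "Max ((\<lambda>j. cmod (b j ?n)) ` {..<m}) = Wm ^ p"
  proof -
    have "Max ((\<lambda>j. cmod (b j ?n)) ` {..<m}) = Max ((\<lambda>j. w (c j) ^ p) ` {..<m})"
      using w_nonneg[OF c] by (intro arg_cong[where f = Max] image_cong) (auto simp: b_def norm_mult norm_power)
    also have "\<dots> = Wm ^ p"
      unfolding Wm_def using ne w_nonneg[OF c] by (intro Max_image_power) auto
    finally show ?thesis .
  qed
  define G where "G = (\<Prod>x\<in>#proots P. ?g x)"
  have G: "G = (\<Prod>k<?n. ?g (xs ! k))" unfolding G_def xs[symmetric] prod_mset_nth len ..
  have G_pos: "G > 0" unfolding G_def using ln_prod_mset[of "proots P" ?g] gpos by auto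
  have "G ^ p * Wm ^ p = (\<Prod>k\<le>?n. Max ((\<lambda>j. cmod (b j k)) ` {..<m}))"
    by (simp add: lessThan_Suc_atMost[symmetric] gn gk G prod_power_distrib)
  also note \<zeta>(2)
  also have "(\<Prod>k\<le>?n. cmod (\<Sum>j<m. \<zeta> j * b j k)) = (\<Prod>k<?n. cmod (poly Q (xs ! k))) * cmod A"
    by (simp add: lessThan_Suc_atMost[symmetric] polyQ A_def b_def)
  finally have key: "G ^ p * Wm ^ p \<le> (\<Prod>k<?n. cmod (poly Q (xs ! k))) * cmod A" .
  \<comment> \<open>A vanishing \<open>A\<close> would make the right side of \<open>key\<close>
    zero; so \<open>Q\<close> has degree exactly \<open>p\<close>, hence \<open>p\<close>
    zeros.\<close>
  have "0 < G ^ p * Wm ^ p" using G_pos Wm_pos by simp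
  then have "A \<noteq> 0" using key by (intro notI) simp
  then have dQ: "degree Q = p" using degQ coeffQ le_degree[of Q p] by auto
  have lcQ: "lead_coeff Q = A" using dQ coeffQ by simp
  have "G ^ p * Wm ^ p \<le> (\<Prod>k<?n. cmod (poly Q (xs ! k))) * (m * Wm ^ p)"
    by (rule order_trans[OF key mult_left_mono[OF A_le]]) (auto intro: prod_nonneg)
  then have Gp: "G ^ p \<le> (\<Prod>k<?n. cmod (poly Q (xs ! k))) * m"
    using Wm_pos by (simp add: mult.assoc[symmetric])
  \<comment> \<open>The double product over pairs of zeros is, up to powers of the leading
    coefficients, the modulus of the resultant of \<open>P\<close> and \<open>Q\<close>; it can be
    grouped by either polynomial.\<close>
  have "cmod (lead_coeff P) ^ p * (\<Prod>k<?n. cmod (poly Q (xs ! k))) =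
      cmod A ^ ?n * (cmod (lead_coeff P) ^ p * (\<Prod>k<?n. \<Prod>t\<in>#proots Q. cmod (xs ! k - t)))"
    by (simp add: norm_poly_proots[of Q] lcQ prod.distrib)
  also have "cmod (lead_coeff P) ^ p * (\<Prod>k<?n. \<Prod>t\<in>#proots Q. cmod (xs ! k - t)) =
      (\<Prod>t\<in>#proots Q. cmod (lead_coeff P) * (\<Prod>k<?n. cmod (xs ! k - t)))"
    using size_proots_complex[of Q] dQ by (simp add: prod_prod_mset_swap prod_mset.distrib prod_mset_const)
  also have "\<dots> = (\<Prod>t\<in>#proots Q. cmod (poly P t))"
  proof -
    have "cmod (lead_coeff P) * (\<Prod>k<?n. cmod (xs ! k - t)) = cmod (poly P t)" for t
      unfolding norm_poly_proots[of P] xs[symmetric] prod_mset_nth len by (simp add: norm_minus_commute)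
    then show ?thesis by simp
  qed
  also have "\<dots> \<le> (\<Prod>t\<in>#proots Q. (Bd * exp (?n * F)) * exp (U t) ^ ?n)"
  proof -
    have "cmod (poly P t) \<le> (Bd * exp (?n * F)) * exp (U t) ^ ?n" for t
      using bernstein_walsh[OF Bd(1), of P t] Bd(2)
      by (simp add: exp_of_nat_mult[symmetric] exp_add[symmetric] algebra_simps)
    then show ?thesis
      using prod_mset_mono_real[of "proots Q" "\<lambda>t. cmod (poly P t)" "\<lambda>t. (Bd * exp (?n * F)) * exp (U t) ^ ?n"] by auto
  qed
  also have "\<dots> = (Bd * exp (?n * F)) ^ p * (\<Prod>t\<in>#proots Q. exp (U t)) ^ ?n"
  proof -
    have "(\<Prod>t\<in>#T. a * exp (U t) ^ ?n) = a ^ size T * (\<Prod>t\<in>#T. exp (U t)) ^ ?n" for T and a :: real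
      by (induction T) (auto simp: power_mult_distrib)
    then show ?thesis using size_proots_complex[of Q] dQ by simp
  qed
  finally have 1: "cmod (lead_coeff P) ^ p * (\<Prod>k<?n. cmod (poly Q (xs ! k))) \<le>
     cmod A ^ ?n * ((Bd * exp (?n * F)) ^ p * (\<Prod>t\<in>#proots Q. exp (U t)) ^ ?n)"
    by (simp add: mult_left_mono)
  \<comment> \<open>The left side is \<open>exp\<close> of the integral of \<open>log |Q|\<close>
    against \<open>\<mu>\<close>, and \<open>|Q|\<close> is at most \<open>m\<close> times the
    \<open>p\<close>-th power of \<open>wmax\<close>.\<close>
  have 2: "cmod A * (\<Prod>t\<in>#proots Q. exp (U t)) \<le> m * exp (p * I)"
  proof -
    note int = integral_sum_mset_ln[of "proots Q"]
    have gint: "AE z in \<mu>. 0 < ?g z" "integrable \<mu> (\<lambda>z. ln (?g z))"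
      by (rule wmax_integrable[where c = c, OF m _ k0], erule c)+
    have "ln (cmod A) + (\<Sum>t\<in>#proots Q. U t) = (\<integral>z. ln (cmod A) + (\<Sum>t\<in>#proots Q. ln (cmod (z - t))) \<partial>\<mu>)"
      using int by (simp add: prob_space[simplified])
    also have "\<dots> \<le> (\<integral>z. ln m + p * ln (?g z) \<partial>\<mu>)"
    proof (rule integral_mono_AE)
      have "AE z in \<mu>. \<forall>t\<in>set_mset (proots Q). z \<noteq> t"
        by (rule AE_finite_allI) (use AE_neq in auto)
      then show "AE z in \<mu>. ln (cmod A) + (\<Sum>t\<in>#proots Q. ln (cmod (z - t))) \<le> ln m + p * ln (?g z)"
        using gint(1)
      proof eventually_elim
        case (elim z)
        have *: "0 < (\<Prod>t\<in>#proots Q. cmod (z - t))" "ln (\<Prod>t\<in>#proots Q. cmod (z - t)) = (\<Sum>t\<in>#proots Q. ln (cmod (z - t)))"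
          using ln_prod_mset[of "proots Q" "\<lambda>t. cmod (z - t)"] elim(1) by auto
        have "ln (cmod A) + (\<Sum>t\<in>#proots Q. ln (cmod (z - t))) = ln (cmod (poly Q z))"
          unfolding norm_poly_proots[of Q] lcQ using * \<open>A \<noteq> 0\<close> by (subst ln_mult_pos) auto
        also have "\<dots> \<le> ln (m * ?g z ^ p)"
        proof (rule ln_mono[OF Qg])
          show "0 < cmod (poly Q z)" unfolding norm_poly_proots[of Q] lcQ using * \<open>A \<noteq> 0\<close> by (intro mult_pos_pos) auto
        qed
        also have "\<dots> = ln m + p * ln (?g z)" using m elim(2) by (simp add: ln_mult ln_realpow)
        finally show ?case .
      qed
    qed (use int gint in auto)
    also have "\<dots> = ln m + p * I" using gint(2) by (simp add: I_def prob_space[simplified])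
    finally have "exp (ln (cmod A) + (\<Sum>t\<in>#proots Q. U t)) \<le> exp (ln m + p * I)" by simp
    moreover have "exp (\<Sum>t\<in>#T. U t) = (\<Prod>t\<in>#T. exp (U t))" for T by (induction T) (auto simp: exp_add)
    ultimately show ?thesis using \<open>A \<noteq> 0\<close> m by (simp add: exp_add)
  qed
  have "(cmod (lead_coeff P) * G) ^ p \<le> (cmod (lead_coeff P) ^ p * (\<Prod>k<?n. cmod (poly Q (xs ! k)))) * m"
    using mult_left_mono[OF Gp, of "cmod (lead_coeff P) ^ p"] by (simp add: power_mult_distrib mult.assoc)
  also have "\<dots> \<le> (cmod A ^ ?n * ((Bd * exp (?n * F)) ^ p * (\<Prod>t\<in>#proots Q. exp (U t)) ^ ?n)) * m"
    using 1 by (rule mult_right_mono) simp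
  also have "\<dots> = ((cmod A * (\<Prod>t\<in>#proots Q. exp (U t))) ^ ?n) * ((Bd * exp (?n * F)) ^ p * m)"
    by (simp add: power_mult_distrib)
  also have "\<dots> \<le> ((m * exp (p * I)) ^ ?n) * ((Bd * exp (?n * F)) ^ p * m)"
  proof (intro mult_right_mono power_mono 2)
    show "0 \<le> cmod A * (\<Prod>t\<in>#proots Q. exp (U t))"
      using ln_prod_mset[of "proots Q" "\<lambda>t. exp (U t)"] by simp
  qed (use Bd in auto)
  \<comment> \<open>\<open>?n\<close> factors \<open>m\<close> come from the integral of
    \<open>log |Q|\<close>, one from the bound on \<open>A\<close>; their number does not depend on
    \<open>p\<close>.\<close>
  also have "\<dots> = real m ^ (?n + 1) * (Bd * exp (?n * (I + F))) ^ p"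
  proof -
    have "exp (p * I) ^ ?n * exp (?n * F) ^ p = exp (?n * (I + F)) ^ p"
      by (simp add: exp_of_nat_mult[symmetric] exp_add[symmetric] algebra_simps)
    then show ?thesis by (simp add: power_mult_distrib)
  qed
  finally show ?thesis unfolding G_def I_def .
qed

text \<open>Let \<open>p\<close> tend to infinity in the preceding estimate. A zero of
  \<open>P\<close> at which \<open>wmax\<close> vanishes makes the left side 0 and is treated apart,
  because the estimate takes logarithms of the factors.\<close>

lemma prod_wmax_bound:
  assumes m: "m \<ge> 1" and c: "\<And>k. k < m \<Longrightarrow> c k \<in> E" and k0: "k0 < m" "w (c k0) > 0"
    and P: "P \<noteq> 0" and Bd: "Bd > 0" "\<And>z. z \<in> E \<Longrightarrow> w z ^ degree P * cmod (poly P z) \<le> Bd"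
  shows "cmod (lead_coeff P) * (\<Prod>x\<in>#proots P. wmax m c x) \<le> Bd * exp (degree P * ((\<integral>z. ln (wmax m c z) \<partial>\<mu>) + F))"
proof (cases "\<exists>x\<in>#proots P. wmax m c x = 0")
  case True
  then have "(\<Prod>x\<in>#proots P. wmax m c x) = 0" by (auto simp: prod_mset_zero_iff)
  then show ?thesis using Bd(1) by (simp only: mult_zero_right) simp
next
  case False
  have gpos: "wmax m c x > 0" if "x \<in># proots P" for x
    using that False wmax_nonneg[of m c x, OF m c] by force
  show ?thesis
  proof (rule le_of_power_le_const_mult)
    fix p :: nat assume "p \<ge> 1"
    show "(cmod (lead_coeff P) * (\<Prod>x\<in>#proots P. wmax m c x)) ^ p \<le>
       real m ^ (degree P + 1) * (Bd * exp (degree P * ((\<integral>z. ln (wmax m c z) \<partial>\<mu>) + F))) ^ p"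
      by (rule prod_wmax_power_bound[where c = c, OF m _ k0 P Bd(1) _ _ \<open>p \<ge> 1\<close>]) (erule c Bd(2) gpos)+
  qed (use Bd(1) in simp)
qed

end

text \<open>Near-maximizers are chosen independently for each \<open>j\<close>; the product is
  continuous, so the bound at points passes to the suprema, attained or not.\<close>

lemma prod_SUP_le:
  fixes f :: "'i \<Rightarrow> 'a \<Rightarrow> real"
  assumes "E \<noteq> {}" and bdd: "\<And>j. j \<in> J \<Longrightarrow> bdd_above (f j ` E)"
    and le: "\<And>c. (\<And>j. j \<in> J \<Longrightarrow> c j \<in> E) \<Longrightarrow> (\<Prod>j\<in>J. f j (c j)) \<le> B"
  shows "(\<Prod>j\<in>J. SUP z\<in>E. f j z) \<le> B"
proof -
  have "\<forall>j. \<forall>i::nat. \<exists>z. j \<in> J \<longrightarrow> z \<in> E \<and> (SUP z\<in>E. f j z) - 1 / Suc i < f j z"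
  proof (intro allI)
    fix j and i :: nat
    show "\<exists>z. j \<in> J \<longrightarrow> z \<in> E \<and> (SUP z\<in>E. f j z) - 1 / Suc i < f j z"
    proof (cases "j \<in> J")
      case True
      have "(SUP z\<in>E. f j z) - 1 / Suc i < (SUP z\<in>E. f j z)" by simp
      then show ?thesis using less_cSUP_iff[OF assms(1) bdd[OF True]] by blast
    qed auto
  qed
  then obtain c where c: "\<And>j i. j \<in> J \<Longrightarrow> c j i \<in> E" "\<And>j i. j \<in> J \<Longrightarrow> (SUP z\<in>E. f j z) - 1 / Suc i < f j (c j i)"
    by metis
  have "(\<lambda>i. f j (c j i)) \<longlonglongrightarrow> (SUP z\<in>E. f j z)" if j: "j \<in> J" for j
  proof (rule tendsto_sandwich)
    have "(\<lambda>i. (SUP z\<in>E. f j z) - 1 / Suc i) \<longlonglongrightarrow> (SUP z\<in>E. f j z) - 0"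
      by (intro tendsto_diff tendsto_const LIMSEQ_Suc lim_1_over_n)
    then show "(\<lambda>i. (SUP z\<in>E. f j z) - 1 / Suc i) \<longlonglongrightarrow> (SUP z\<in>E. f j z)" by simp
    show "\<forall>\<^sub>F i in sequentially. (SUP z\<in>E. f j z) - 1 / Suc i \<le> f j (c j i)"
      using c(2)[OF j] by (intro always_eventually allI less_imp_le)
    show "\<forall>\<^sub>F i in sequentially. f j (c j i) \<le> (SUP z\<in>E. f j z)"
      using c(1)[OF j] bdd[OF j] by (intro always_eventually allI cSUP_upper)
  qed auto
  then have "(\<lambda>i. \<Prod>j\<in>J. f j (c j i)) \<longlonglongrightarrow> (\<Prod>j\<in>J. SUP z\<in>E. f j z)" by (rule tendsto_prod)
  then show ?thesis
    by (rule LIMSEQ_le_const2) (use le c(1) in auto)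
qed

section \<open>Weighted norms, the farthest-point distance and the product inequality\<close>

context weighted_equilibrium
begin

lemma wnorm_bdd: "bdd_above ((\<lambda>z. w z ^ degree P * cmod (poly P z)) ` E)"
proof -
  obtain \<Gamma> where \<Gamma>: "\<And>t. t \<in> E \<Longrightarrow> w t * (cmod t + 1) \<le> \<Gamma>" using w_linear_bounded[of 1] by auto
  let ?c = "\<Sum>i\<le>degree P. cmod (coeff P i)"
  show ?thesis
  proof (rule bdd_aboveI2)
    fix z assume z: "z \<in> E"
    have "w z ^ degree P * cmod (poly P z) \<le> w z ^ degree P * (?c * (cmod z + 1) ^ degree P)"
      using w_nonneg[OF z] poly_norm_le_power[of P z] by (intro mult_left_mono) auto
    also have "\<dots> = ?c * (w z * (cmod z + 1)) ^ degree P" by (simp add: power_mult_distrib)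
    also have "\<dots> \<le> ?c * \<Gamma> ^ degree P"
      using \<Gamma>[OF z] w_nonneg[OF z] by (intro mult_left_mono power_mono sum_nonneg) auto
    finally show "w z ^ degree P * cmod (poly P z) \<le> ?c * \<Gamma> ^ degree P" .
  qed
qed

lemma wnorm_ge: "z \<in> E \<Longrightarrow> w z ^ degree P * cmod (poly P z) \<le> wnorm E w (degree P) P"
  unfolding wnorm_def using wnorm_bdd by (rule cSUP_upper[rotated])

lemma wnorm_nonneg: "0 \<le> wnorm E w (degree P) P"
proof -
  obtain z where z: "z \<in> E" using E_nonempty by auto
  have "0 \<le> w z ^ degree P * cmod (poly P z)" using w_nonneg[OF z] by simp
  then show ?thesis using wnorm_ge[OF z, of P] by linarith
qed

text \<open>A nonzero polynomial vanishes only on a \<open>\<mu>\<close>-null set, as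
  \<open>\<mu>\<close> has no atoms, and \<open>w\<close> is positive on the support.\<close>

lemma wnorm_pos:
  assumes "P \<noteq> 0"
  shows "0 < wnorm E w (degree P) P"
proof -
  have "AE t in \<mu>. \<forall>x\<in>{x. poly P x = 0}. t \<noteq> x"
    using poly_roots_finite[OF assms] AE_neq by (intro AE_finite_allI) auto
  then have "AE t in \<mu>. t \<in> msupp \<mu> \<and> poly P t \<noteq> 0" using AE_support by eventually_elim auto
  then have "\<exists>t. t \<in> msupp \<mu> \<and> poly P t \<noteq> 0"
    using eventually_mono[of "\<lambda>t. t \<in> msupp \<mu> \<and> poly P t \<noteq> 0" "ae_filter \<mu>" "\<lambda>_. False"] AE_False by blast
  then obtain t where t: "t \<in> msupp \<mu>" "poly P t \<noteq> 0" by blast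
  have "0 < w t ^ degree P * cmod (poly P t)" using t equilibrium_on_support(1)[OF t(1)] by simp
  then show ?thesis using wnorm_ge[of t P] t support_subset by fastforce
qed

lemma farthest_dist_ge: "t \<in> E \<Longrightarrow> w t * cmod (z - t) \<le> farthest_dist E w z"
  unfolding farthest_dist_def using w_dist_bdd_above by (rule cSUP_upper[rotated])

lemma farthest_dist_pos: "0 < farthest_dist E w z"
proof -
  obtain s where s: "s \<in> msupp \<mu>" "s \<noteq> z" by (rule support_two_points)
  then have "0 < w s * cmod (z - s)" using equilibrium_on_support(1) by simp
  then show ?thesis using farthest_dist_ge[of s z] s support_subset by fastforce
qed

lemma farthest_dist_lipschitz:
  assumes W: "\<And>t. t \<in> E \<Longrightarrow> w t \<le> W"
  shows "farthest_dist E w z \<le> farthest_dist E w z' + W * cmod (z - z')"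
  unfolding farthest_dist_def[of E w z]
proof (rule cSUP_least[OF E_nonempty])
  fix t assume t: "t \<in> E"
  have "cmod (z - t) \<le> cmod (z' - t) + cmod (z - z')" using norm_triangle_ineq[of "z' - t" "z - z'"] by simp
  then have "w t * cmod (z - t) \<le> w t * cmod (z' - t) + w t * cmod (z - z')"
    using w_nonneg[OF t] by (metis distrib_left mult_left_mono)
  also have "\<dots> \<le> farthest_dist E w z' + W * cmod (z - z')"
    using farthest_dist_ge[OF t] W[OF t] by (intro add_mono mult_right_mono) auto
  finally show "w t * cmod (z - t) \<le> farthest_dist E w z' + W * cmod (z - z')" .
qed

lemma continuous_farthest_dist: "continuous_on A (farthest_dist E w)"
proof -
  obtain W where W: "W > 0" "\<And>t. t \<in> E \<Longrightarrow> w t \<le> W" by (rule w_bounded) blast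
  have L: "\<bar>farthest_dist E w z - farthest_dist E w z'\<bar> \<le> W * dist z z'" for z z'
    using farthest_dist_lipschitz[of W z z'] farthest_dist_lipschitz[of W z' z] W(2)
    by (simp add: dist_norm norm_minus_commute abs_le_iff)
  show ?thesis
    by (rule lipschitz_on_continuous_on, rule lipschitz_onI[where L = W]) (use L W(1) in \<open>auto simp: dist_real_def\<close>)
qed

lemma integrable_ln_continuous_pos:
  fixes g :: "complex \<Rightarrow> real"
  assumes g: "continuous_on UNIV g" and pos: "\<And>z. 0 < g z"
  shows "integrable \<mu> (\<lambda>z. ln (g z))"
proof -
  have c: "continuous_on UNIV (\<lambda>z. ln (g z))" using g pos by (intro continuous_intros) (auto simp: less_imp_neq[THEN not_sym])
  have "bounded ((\<lambda>z. ln (g z)) ` msupp \<mu>)"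
    using compact_support by (intro compact_imp_bounded compact_continuous_image continuous_on_subset[OF c]) auto
  then obtain b where b: "\<And>z. z \<in> msupp \<mu> \<Longrightarrow> \<bar>ln (g z)\<bar> \<le> b" unfolding bounded_iff by auto
  have "AE z in \<mu>. norm (ln (g z)) \<le> b" using AE_support by eventually_elim (use b in auto)
  then show ?thesis
    using borel_measurable_continuous_onI[OF c] by (intro integrable_const_bound) (simp_all add: measurable_cong_sets[OF sets_eq])
qed

lemma integral_wmax_le_CEw:
  assumes m: "m \<ge> 1" and c: "\<And>k. k < m \<Longrightarrow> c k \<in> E" and k: "k < m" "w (c k) > 0"
  shows "(\<integral>z. ln (wmax m c z) \<partial>\<mu>) + F \<le> CEw E w \<mu> F"
proof -
  have i: "AE z in \<mu>. 0 < wmax m c z" "integrable \<mu> (\<lambda>z. ln (wmax m c z))"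
    by (rule wmax_integrable[where c = c, OF m _ k], erule c)+
  have "(\<integral>z. ln (wmax m c z) \<partial>\<mu>) \<le> (\<integral>z. ln (farthest_dist E w z) \<partial>\<mu>)"
  proof (rule integral_mono_AE[OF i(2)])
    show "integrable \<mu> (\<lambda>z. ln (farthest_dist E w z))"
      by (intro integrable_ln_continuous_pos continuous_farthest_dist farthest_dist_pos)
    show "AE z in \<mu>. ln (wmax m c z) \<le> ln (farthest_dist E w z)"
      using i(1) by eventually_elim (intro ln_mono wmax_le m farthest_dist_ge c)
  qed
  then show ?thesis by (simp add: CEw_def)
qed

lemma CEwm_real:
  assumes m: "m \<ge> 1"
  obtains C where "CEwm E w \<mu> F m = ereal C" "C \<le> CEw E w \<mu> F"
    "\<And>c k. (\<And>k. k < m \<Longrightarrow> c k \<in> E) \<Longrightarrow> k < m \<Longrightarrow> w (c k) > 0 \<Longrightarrow> (\<integral>z. ln (wmax m c z) \<partial>\<mu>) + F \<le> C"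
proof -
  have up: "CEwm E w \<mu> F m \<le> ereal (CEw E w \<mu> F)"
    unfolding CEwm_eq
  proof (rule SUP_least)
    fix c assume "c \<in> {c. \<forall>k<m. c k \<in> E}"
    then have c: "\<And>k. k < m \<Longrightarrow> c k \<in> E" by auto
    show "logint \<mu> (wmax m c) + ereal F \<le> ereal (CEw E w \<mu> F)"
    proof (cases "\<exists>k<m. w (c k) > 0")
      case True
      then obtain k where k: "k < m" "w (c k) > 0" by blast
      have "(\<integral>z. ln (wmax m c z) \<partial>\<mu>) + F \<le> CEw E w \<mu> F"
        by (rule integral_wmax_le_CEw[where c = c, OF m _ k], erule c)
      then show ?thesis using logint_wmax(1)[of m c] m c True by simp
    next
      case False
      then show ?thesis using logint_wmax(2)[of m c] m c by simp
    qed
  qed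
  have low: "ereal ((\<integral>z. ln (wmax m c z) \<partial>\<mu>) + F) \<le> CEwm E w \<mu> F m"
    if c: "\<And>k. k < m \<Longrightarrow> c k \<in> E" and k: "k < m" "w (c k) > 0" for c k
  proof -
    have "logint \<mu> (wmax m c) + ereal F \<le> CEwm E w \<mu> F m"
      unfolding CEwm_eq using c by (intro SUP_upper) auto
    moreover have "\<exists>k<m. w (c k) > 0" using k by blast
    ultimately show ?thesis using logint_wmax(1)[of m c] m c by simp
  qed
  \<comment> \<open>Taking one support point for every \<open>c k\<close> excludes the value
    \<open>-\<infinity>\<close> for \<open>CEwm\<close>.\<close>
  obtain s where s: "s \<in> msupp \<mu>" using S_nonempty by blast
  have "ereal ((\<integral>z. ln (wmax m (\<lambda>_. s) z) \<partial>\<mu>) + F) \<le> CEwm E w \<mu> F m"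
    by (rule low[of _ 0]) (use s support_subset equilibrium_on_support(1) m in auto)
  with up obtain C where C: "CEwm E w \<mu> F m = ereal C" by (cases "CEwm E w \<mu> F m") auto
  show thesis
  proof (rule that[OF C])
    show "C \<le> CEw E w \<mu> F" using up C by simp
    fix c k assume "\<And>k. k < m \<Longrightarrow> c k \<in> E" "k < m" "w (c k) > 0"
    then show "(\<integral>z. ln (wmax m c z) \<partial>\<mu>) + F \<le> C" using low[of c k] C by simp
  qed
qed

lemma prod_weighted_values_le:
  assumes m: "m \<ge> 1" and c: "\<And>j. j < m \<Longrightarrow> c j \<in> E" and P: "\<And>j. j < m \<Longrightarrow> P j \<noteq> 0"
    and C: "CEwm E w \<mu> F m = ereal C" and n: "n = (\<Sum>j<m. degree (P j))"
  shows "(\<Prod>j<m. w (c j) ^ degree (P j) * cmod (poly (P j) (c j))) \<le> exp (n * C) * wnorm E w n (\<Prod>j<m. P j)"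
proof -
  define Q where "Q = (\<Prod>j<m. P j)"
  have Q0: "Q \<noteq> 0" unfolding Q_def using P by auto
  have dQ: "degree Q = n" unfolding Q_def n using P by (intro degree_prod_eq_sum_degree) auto
  have lcQ: "cmod (lead_coeff Q) = (\<Prod>j<m. cmod (lead_coeff (P j)))"
    unfolding Q_def by (simp add: lead_coeff_prod prod_norm)
  obtain C' where C': "CEwm E w \<mu> F m = ereal C'"
    and le: "\<And>c k. (\<And>k. k < m \<Longrightarrow> c k \<in> E) \<Longrightarrow> k < m \<Longrightarrow> w (c k) > 0 \<Longrightarrow> (\<integral>z. ln (wmax m c z) \<partial>\<mu>) + F \<le> C'"
    by (rule CEwm_real[OF m]) blast
  have CC: "C' = C" using C C' by simp
  note Bd = wnorm_pos[OF Q0]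
  show ?thesis
  proof (cases "\<exists>k<m. w (c k) > 0")
    case True
    then obtain k where k: "k < m" "w (c k) > 0" by blast
    have "(\<Prod>j<m. w (c j) ^ degree (P j) * cmod (poly (P j) (c j))) =
        (\<Prod>j<m. cmod (lead_coeff (P j)) * (\<Prod>x\<in>#proots (P j). w (c j) * cmod (x - c j)))"
    proof (intro prod.cong refl)
      fix j
      have "(\<Prod>x\<in>#A. w (c j) * cmod (x - c j)) = w (c j) ^ size A * (\<Prod>x\<in>#A. cmod (c j - x))" for A
        by (simp add: prod_mset.distrib prod_mset_const norm_minus_commute)
      then show "w (c j) ^ degree (P j) * cmod (poly (P j) (c j)) =
          cmod (lead_coeff (P j)) * (\<Prod>x\<in>#proots (P j). w (c j) * cmod (x - c j))"
        by (simp add: norm_poly_proots[of "P j"] size_proots_complex)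
    qed
    also have "\<dots> \<le> (\<Prod>j<m. cmod (lead_coeff (P j)) * (\<Prod>x\<in>#proots (P j). wmax m c x))"
    proof (rule prod_mono, rule conjI)
      fix j assume j: "j \<in> {..<m}"
      have *: "0 \<le> (\<Prod>x\<in>#proots (P j). w (c j) * cmod (x - c j)) \<and>
          (\<Prod>x\<in>#proots (P j). w (c j) * cmod (x - c j)) \<le> (\<Prod>x\<in>#proots (P j). wmax m c x)"
        using w_nonneg[OF c[of j]] j wmax_ge[of j m c] by (intro prod_mset_mono_real) auto
      then show "0 \<le> cmod (lead_coeff (P j)) * (\<Prod>x\<in>#proots (P j). w (c j) * cmod (x - c j))" by simp
      show "cmod (lead_coeff (P j)) * (\<Prod>x\<in>#proots (P j). w (c j) * cmod (x - c j)) \<le>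
          cmod (lead_coeff (P j)) * (\<Prod>x\<in>#proots (P j). wmax m c x)"
        using * by (intro mult_left_mono) auto
    qed
    also have "\<dots> = cmod (lead_coeff Q) * (\<Prod>x\<in>#proots Q. wmax m c x)"
    proof -
      have "(\<Prod>x\<in>#(\<Sum>j\<in>J. A j). f x) = (\<Prod>j\<in>J. \<Prod>x\<in>#A j. f x)" if "finite J"
        for J :: "nat set" and A :: "nat \<Rightarrow> complex multiset" and f :: "complex \<Rightarrow> real"
        using that by induction auto
      moreover have "proots Q = (\<Sum>j<m. proots (P j))" unfolding Q_def using P by (intro proots_prod) auto
      ultimately show ?thesis unfolding lcQ by (simp add: prod.distrib)
    qed
    also have "\<dots> \<le> wnorm E w n Q * exp (degree Q * ((\<integral>z. ln (wmax m c z) \<partial>\<mu>) + F))"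
      by (rule prod_wmax_bound[where c = c, OF m _ k Q0]) (use Bd wnorm_ge[of _ Q] c dQ in auto)
    also have "\<dots> \<le> wnorm E w n Q * exp (n * C)"
    proof (rule mult_left_mono)
      have "(\<integral>z. ln (wmax m c z) \<partial>\<mu>) + F \<le> C" unfolding CC[symmetric] by (rule le[of c, OF _ k]) (erule c)
      then show "exp (degree Q * ((\<integral>z. ln (wmax m c z) \<partial>\<mu>) + F)) \<le> exp (n * C)" by (simp add: dQ mult_left_mono)
    qed (use Bd dQ in auto)
    finally show ?thesis by (simp add: Q_def mult.commute)
  next
    \<comment> \<open>All weights at the chosen points vanish. A factor of positive degree makes the
      product 0; if all degrees are 0, the powers \<open>w (c j) ^ 0\<close> equal 1 and the
      polynomials are constant.\<close>
    case False
    then have w0: "w (c j) = 0" if "j < m" for j using w_nonneg[OF c[OF that]] that by force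
    show ?thesis
    proof (cases "\<exists>j<m. degree (P j) > 0")
      case True
      then have "(\<Prod>j<m. w (c j) ^ degree (P j) * cmod (poly (P j) (c j))) = 0"
        using w0 by (intro prod_zero) auto
      moreover have "0 \<le> exp (n * C) * wnorm E w n (\<Prod>j<m. P j)" using Bd dQ by (simp add: Q_def)
      ultimately show ?thesis by (simp only:)
    next
      case False
      then have d0: "degree (P j) = 0" if "j < m" for j using that by simp
      have const: "poly (P j) z = poly (P j) z'" if "j < m" for j z z'
        using degree_eq_zeroE[OF d0[OF that]] by (metis poly_const_conv)
      have "(\<Prod>j<m. w (c j) ^ degree (P j) * cmod (poly (P j) (c j))) = (\<Prod>j<m. cmod (poly (P j) (c 0)))"
      proof (intro prod.cong refl)
        fix j assume "j \<in> {..<m}"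
        then show "w (c j) ^ degree (P j) * cmod (poly (P j) (c j)) = cmod (poly (P j) (c 0))"
          using d0[of j] const[of j "c j" "c 0"] by simp
      qed
      also have "\<dots> = w (c 0) ^ degree Q * cmod (poly Q (c 0))"
        using dQ d0 by (simp add: n Q_def poly_prod prod_norm)
      also have "\<dots> \<le> wnorm E w (degree Q) Q" using c[of 0] m by (intro wnorm_ge) auto
      finally show ?thesis using dQ d0 by (simp add: n Q_def)
    qed
  qed
qed

lemma prod_ineq_upper:
  assumes m: "m \<ge> 1" and C: "CEwm E w \<mu> F m = ereal C" and n: "n = (\<Sum>j<m. degree (P j))"
  shows "(\<Prod>j<m. wnorm E w (degree (P j)) (P j)) \<le> exp (n * C) * wnorm E w n (\<Prod>j<m. P j)"
proof (cases "\<exists>j<m. P j = 0")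
  \<comment> \<open>The zero polynomial has degree 0, so here \<open>n\<close> need not be the
    degree of the product; both sides are 0.\<close>
  case True
  then obtain j where j: "j < m" "P j = 0" by blast
  have z: "wnorm E w k 0 = 0" for k using E_nonempty by (simp add: wnorm_def)
  have "(\<Prod>j<m. wnorm E w (degree (P j)) (P j)) = 0"
    using j z by (intro prod_zero bexI[of _ j]) auto
  moreover have "(\<Prod>j<m. P j) = 0" using j by (intro prod_zero) auto
  ultimately show ?thesis by (simp only: z mult_zero_right order_refl)
next
  case False
  show ?thesis
    unfolding wnorm_def[of E w "degree (P _)"]
  proof (rule prod_SUP_le[OF E_nonempty])
    fix c assume "\<And>j. j \<in> {..<m} \<Longrightarrow> c j \<in> E"
    then show "(\<Prod>j<m. w (c j) ^ degree (P j) * cmod (poly (P j) (c j))) \<le> exp (n * C) * wnorm E w n (\<Prod>j<m. P j)"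
      using False by (intro prod_weighted_values_le[OF m _ _ C n]) auto
  qed (rule wnorm_bdd)
qed

end

section \<open>Discretization of the equilibrium measure\<close>

lemma sum_mset_sum:
  fixes f :: "'a \<Rightarrow> 'b::comm_monoid_add"
  assumes "finite I"
  shows "(\<Sum>x\<in>#(\<Sum>i\<in>I. M i). f x) = (\<Sum>i\<in>I. \<Sum>x\<in>#M i. f x)"
  using assms by induction auto

lemma sum_mset_repeat: "(\<Sum>x\<in>#repeat_mset k M. f x) = real k * (\<Sum>x\<in>#M. f x)"
  by (induction k) (auto simp: algebra_simps)

lemma prod_mset_repeat: "(\<Prod>x\<in>#repeat_mset k M. f x) = (\<Prod>x\<in>#M. f x) ^ k" for f :: "'a \<Rightarrow> 'b::comm_monoid_mult"
  by (induction k) auto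

lemma in_repeat_msetD: "x \<in># repeat_mset k M \<Longrightarrow> x \<in># M"
  by (induction k) auto

lemma prod_filter_mset_eq:
  fixes h :: "nat \<Rightarrow> 'a \<Rightarrow> 'b::comm_monoid_mult"
  assumes "\<And>x. J x < m"
  shows "(\<Prod>j<m. \<Prod>x\<in>#filter_mset (\<lambda>x. J x = j) M. h j x) = (\<Prod>x\<in>#M. h (J x) x)"
proof (induction M)
  case (add y M)
  have "(\<Prod>j<m. \<Prod>x\<in>#filter_mset (\<lambda>x. J x = j) (add_mset y M). h j x) =
      (\<Prod>j<m. (if J y = j then h j y else 1) * (\<Prod>x\<in>#filter_mset (\<lambda>x. J x = j) M. h j x))"
    by (intro prod.cong) auto
  also have "\<dots> = (\<Prod>j<m. if J y = j then h j y else 1) * (\<Prod>x\<in>#M. h (J x) x)"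
    by (simp only: prod.distrib add.IH)
  also have "(\<Prod>j<m. if J y = j then h j y else 1) = h (J y) y"
    using assms[of y] by (subst prod.delta') auto
  finally show ?case by simp
qed simp

lemma sum_size_filter_mset_eq:
  fixes J :: "'a \<Rightarrow> nat"
  assumes "\<And>x. J x < m"
  shows "(\<Sum>j<m. size (filter_mset (\<lambda>x. J x = j) M)) = size M"
proof (induction M)
  case (add y M)
  have "(\<Sum>j<m. size (filter_mset (\<lambda>x. J x = j) (add_mset y M))) =
      (\<Sum>j<m. (if J y = j then 1 else 0) + size (filter_mset (\<lambda>x. J x = j) M))"
    by (intro sum.cong) auto
  also have "\<dots> = (\<Sum>j<m. if J y = j then 1 else 0) + size M"
    by (simp only: sum.distrib add.IH)
  also have "(\<Sum>j<m. if J y = j then 1 else 0 :: nat) = 1"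
    using assms[of y] by (subst sum.delta') auto
  finally show ?case by simp
qed simp

lemma pos_log_cap_mono: "pos_log_cap A \<Longrightarrow> A \<subseteq> B \<Longrightarrow> pos_log_cap B"
  unfolding pos_log_cap_def by (meson subset_trans)

context finite_log_potential
begin

lemma support_partition:
  assumes "\<rho> > 0"
  obtains l :: nat and x C where "\<And>i. i < l \<Longrightarrow> x i \<in> S" "\<And>i. C i \<in> sets borel"
    "\<And>i t. i < l \<Longrightarrow> t \<in> C i \<Longrightarrow> t \<in> S \<and> dist (x i) t < \<rho>"
    "\<And>t. t \<in> S \<Longrightarrow> (\<Sum>i<l. indicator (C i) t) = (1::real)"
proof -
  have "S \<subseteq> (\<Union>z\<in>S. ball z \<rho>)" using assms by force
  then obtain T where T: "T \<subseteq> S" "finite T" "S \<subseteq> (\<Union>z\<in>T. ball z \<rho>)"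
    by (rule compactE_image[OF compact_support, rotated]) auto
  obtain xs where xs: "set xs = T" using finite_list[OF T(2)] by blast
  define C where "C i = S \<inter> ball (xs ! i) \<rho> - (\<Union>j<i. ball (xs ! j) \<rho>)" for i
  show thesis
  proof (rule that[of "length xs" "(!) xs" C])
    show "xs ! i \<in> S" if "i < length xs" for i using that xs T(1) by (auto dest: nth_mem)
    show "C i \<in> sets borel" for i
      unfolding C_def using borel_compact[OF compact_support] by (intro sets.Diff sets.Int) auto
    show "t \<in> S \<and> dist (xs ! i) t < \<rho>" if "t \<in> C i" for i t using that by (auto simp: C_def)
    fix t assume t: "t \<in> S"
    then obtain z where "z \<in> T" "t \<in> ball z \<rho>" using T(3) by blast
    then have ex: "\<exists>i. i < length xs \<and> t \<in> ball (xs ! i) \<rho>" using xs by (metis in_set_conv_nth)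
    define k where "k = (LEAST i. i < length xs \<and> t \<in> ball (xs ! i) \<rho>)"
    have k: "k < length xs" "t \<in> ball (xs ! k) \<rho>" using LeastI_ex[OF ex] by (auto simp: k_def)
    have k_min: "t \<notin> ball (xs ! j) \<rho>" if "j < k" for j
      using not_less_Least[of j "\<lambda>i. i < length xs \<and> t \<in> ball (xs ! i) \<rho>"] that k(1) by (auto simp: k_def)
    have "t \<in> C i \<longleftrightarrow> i = k" if "i < length xs" for i
    proof
      assume "t \<in> C i"
      then have "t \<in> ball (xs ! i) \<rho>" "\<And>j. j < i \<Longrightarrow> t \<notin> ball (xs ! j) \<rho>" by (auto simp: C_def)
      then show "i = k" using k k_min by (meson linorder_neqE_nat)
    next
      assume "i = k"
      then show "t \<in> C i" using t k k_min by (auto simp: C_def)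
    qed
    then have "(\<Sum>i<length xs. indicator (C i) t) = (\<Sum>i<length xs. if i = k then 1 else 0 :: real)"
      by (intro sum.cong) (auto simp: indicator_def)
    then show "(\<Sum>i<length xs. indicator (C i) t) = (1::real)" using k(1) by simp
  qed
qed

text \<open>One multiset must serve all members of \<open>G\<close> at once, whence the uniform
  bound and the common modulus of continuity. It consists of centres of small cells, repeated in
  proportion to the masses of the cells; half of \<open>e\<close> pays for replacing
  \<open>f\<close> by its values at the centres, half for rounding the multiplicities.\<close>

lemma discretization:
  fixes G :: "(complex \<Rightarrow> real) set" and e b \<rho> :: real
  assumes e: "e > 0" and meas: "\<And>f. f \<in> G \<Longrightarrow> f \<in> borel_measurable borel"
    and bnd: "\<And>f x. f \<in> G \<Longrightarrow> x \<in> S \<Longrightarrow> \<bar>f x\<bar> \<le> b" and b: "b \<ge> 0"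
    and equi: "\<rho> > 0" "\<And>f x y. f \<in> G \<Longrightarrow> x \<in> S \<Longrightarrow> y \<in> S \<Longrightarrow> dist x y < \<rho> \<Longrightarrow> \<bar>f x - f y\<bar> \<le> e / 2"
  obtains Z where "Z \<noteq> {#}" "set_mset Z \<subseteq> S"
    "\<And>f. f \<in> G \<Longrightarrow> \<bar>(\<Sum>x\<in>#Z. f x) - size Z * (\<integral>t. f t \<partial>\<mu>)\<bar> \<le> e * size Z"
proof -
  obtain l :: nat and x C where x: "\<And>i. i < l \<Longrightarrow> x i \<in> S" and C [measurable]: "\<And>i. C i \<in> sets borel"
    and Cx: "\<And>i t. i < l \<Longrightarrow> t \<in> C i \<Longrightarrow> t \<in> S \<and> dist (x i) t < \<rho>"
    and part: "\<And>t. t \<in> S \<Longrightarrow> (\<Sum>i<l. indicator (C i) t) = (1::real)"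
    using support_partition[OF equi(1)] by metis
  define p where "p i = measure \<mu> (C i)" for i
  have ind_int: "integrable \<mu> (\<lambda>t. c * indicator (C i) t)" for i and c :: real
    by (intro integrable_real_mult_indicator) (auto simp: sets_eq)
  have ind: "(\<integral>t. c * indicator (C i) t \<partial>\<mu>) = c * p i" for i and c :: real
    by (simp add: p_def)
  have sum_p: "(\<Sum>i<l. p i) = 1"
  proof -
    have "(\<Sum>i<l. p i) = (\<integral>t. (\<Sum>i<l. 1 * indicator (C i) t) \<partial>\<mu>)"
      by (subst Bochner_Integration.integral_sum) (use ind[of 1] ind_int in auto)
    also have "\<dots> = (\<integral>t. 1 \<partial>\<mu>)"
      by (rule integral_cong_AE) (use AE_support part in \<open>auto elim!: eventually_mono\<close>)
    finally show ?thesis by (simp add: prob_space[simplified])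
  qed
  have int_f: "integrable \<mu> f" if f: "f \<in> G" for f
  proof (rule integrable_const_bound)
    show "AE t in \<mu>. norm (f t) \<le> b" using AE_support by eventually_elim (use bnd[OF f] in auto)
    show "f \<in> borel_measurable \<mu>" using meas[OF f] by (simp add: measurable_cong_sets[OF sets_eq])
  qed
  have approx: "\<bar>(\<Sum>i<l. p i * f (x i)) - (\<integral>t. f t \<partial>\<mu>)\<bar> \<le> e / 2" if f: "f \<in> G" for f
  proof -
    note [measurable] = meas[OF f]
    have "(\<Sum>i<l. p i * f (x i)) = (\<Sum>i<l. \<integral>t. f (x i) * indicator (C i) t \<partial>\<mu>)"
      by (simp only: ind mult.commute)
    also have "\<dots> = (\<integral>t. (\<Sum>i<l. f (x i) * indicator (C i) t) \<partial>\<mu>)"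
      by (rule Bochner_Integration.integral_sum[symmetric]) (rule ind_int)
    finally have "(\<Sum>i<l. p i * f (x i)) = (\<integral>t. (\<Sum>i<l. f (x i) * indicator (C i) t) \<partial>\<mu>)" .
    moreover have "integrable \<mu> (\<lambda>t. \<Sum>i<l. f (x i) * indicator (C i) t)"
      using ind_int by (intro Bochner_Integration.integrable_sum)
    ultimately have "(\<Sum>i<l. p i * f (x i)) - (\<integral>t. f t \<partial>\<mu>) = (\<integral>t. (\<Sum>i<l. f (x i) * indicator (C i) t) - f t \<partial>\<mu>)"
      using int_f[OF f] by simp
    also have "\<bar>\<dots>\<bar> \<le> (\<integral>t. \<bar>(\<Sum>i<l. f (x i) * indicator (C i) t) - f t\<bar> \<partial>\<mu>)" by (rule integral_abs_bound)
    also have "\<dots> \<le> (\<integral>t. e / 2 \<partial>\<mu>)"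
    proof (rule integral_mono_AE)
      show "AE t in \<mu>. \<bar>(\<Sum>i<l. f (x i) * indicator (C i) t) - f t\<bar> \<le> e / 2"
        using AE_support
      proof eventually_elim
        case (elim t)
        have "f t = (\<Sum>i<l. f t * indicator (C i) t)" using part[OF elim] by (simp add: sum_distrib_left[symmetric])
        then have "(\<Sum>i<l. f (x i) * indicator (C i) t) - f t = (\<Sum>i<l. (f (x i) - f t) * indicator (C i) t)"
          by (simp add: sum_subtractf left_diff_distrib)
        also have "\<bar>\<dots>\<bar> \<le> (\<Sum>i<l. \<bar>(f (x i) - f t) * indicator (C i) t\<bar>)" by (rule sum_abs)
        also have "\<dots> \<le> (\<Sum>i<l. e / 2 * indicator (C i) t)"
        proof (rule sum_mono)
          fix i assume "i \<in> {..<l}"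
          then show "\<bar>(f (x i) - f t) * indicator (C i) t\<bar> \<le> e / 2 * indicator (C i) t"
            using equi(2)[OF f x[of i] elim] Cx[of i t] by (auto simp: indicator_def)
        qed
        also have "\<dots> = e / 2 * (\<Sum>i<l. indicator (C i) t)" by (rule sum_distrib_left[symmetric])
        also have "\<dots> = e / 2" using part[OF elim] by simp
        finally show ?case .
      qed
      show "integrable \<mu> (\<lambda>t. \<bar>(\<Sum>i<l. f (x i) * indicator (C i) t) - f t\<bar>)"
        using ind_int int_f[OF f] by (intro integrable_abs Bochner_Integration.integrable_diff Bochner_Integration.integrable_sum)
    qed auto
    finally show ?thesis by (simp add: prob_space[simplified])
  qed
  \<comment> \<open>Rounding up \<open>l\<close> multiplicities and the resulting excess of
    \<open>size Z\<close> over \<open>N\<close> each cost at most \<open>l * b\<close>; this choice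
    makes both together at most half of \<open>e * N\<close>.\<close>
  obtain N0 :: nat where N0: "4 * l * b / e \<le> N0" using real_arch_simple by blast
  define N where "N = N0 + 1"
  have N: "2 * (l * b) \<le> N * (e / 2)" "N \<ge> 1"
  proof -
    have "4 * l * b / e \<le> N" using N0 by (simp add: N_def)
    then show "2 * (l * b) \<le> N * (e / 2)" using e by (simp add: pos_divide_le_eq mult_ac)
  qed (simp add: N_def)
  define q where "q i = nat \<lceil>N * p i\<rceil>" for i
  have q: "N * p i \<le> q i" "q i \<le> N * p i + 1" for i
    using measure_nonneg[of \<mu> "C i"] by (auto simp: q_def p_def of_nat_ceiling intro: less_imp_le[OF of_int_ceiling_le_add_one[THEN le_less_trans]])
  define Z where "Z = (\<Sum>i<l. replicate_mset (q i) (x i))"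
  have sumZ: "(\<Sum>y\<in>#Z. f y) = (\<Sum>i<l. q i * f (x i))" for f :: "complex \<Rightarrow> real"
  proof -
    have "(\<Sum>y\<in>#replicate_mset k a. f y) = k * f a" for k a by (induction k) (auto simp: algebra_simps)
    then show ?thesis unfolding Z_def by (subst sum_mset_sum) auto
  qed
  have sizeZ: "real (size Z) = (\<Sum>i<l. real (q i))" using sumZ[of "\<lambda>_. 1"] by simp
  have N_le: "N \<le> real (size Z)" and le_N: "real (size Z) \<le> N + l"
  proof -
    have "(\<Sum>i<l. N * p i) \<le> (\<Sum>i<l. real (q i))" using q by (intro sum_mono) auto
    then show "N \<le> real (size Z)" using sum_p by (simp add: sizeZ sum_distrib_left[symmetric])
    have "(\<Sum>i<l. real (q i)) \<le> (\<Sum>i<l. N * p i + 1)" using q by (intro sum_mono) auto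
    then show "real (size Z) \<le> N + l" using sum_p by (simp add: sizeZ sum.distrib sum_distrib_left[symmetric])
  qed
  show thesis
  proof (rule that[of Z])
    show "Z \<noteq> {#}" using N_le N(2) by auto
    show "set_mset Z \<subseteq> S"
      unfolding Z_def using x by (auto simp: set_mset_sum split: if_splits)
    fix f assume f: "f \<in> G"
    define I where "I = (\<integral>t. f t \<partial>\<mu>)"
    have I: "\<bar>I\<bar> \<le> b"
    proof -
      have "\<bar>I\<bar> \<le> (\<integral>t. \<bar>f t\<bar> \<partial>\<mu>)" unfolding I_def by (rule integral_abs_bound)
      also have "\<dots> \<le> (\<integral>t. b \<partial>\<mu>)"
      proof (rule integral_mono_AE)
        show "AE t in \<mu>. \<bar>f t\<bar> \<le> b" using AE_support by eventually_elim (use bnd[OF f] in auto)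
      qed (use int_f[OF f] in auto)
      finally show ?thesis by (simp add: prob_space[simplified])
    qed
    have 1: "\<bar>(\<Sum>i<l. q i * f (x i)) - N * (\<Sum>i<l. p i * f (x i))\<bar> \<le> l * b"
    proof -
      have "(\<Sum>i<l. q i * f (x i)) - N * (\<Sum>i<l. p i * f (x i)) = (\<Sum>i<l. (q i - N * p i) * f (x i))"
        by (simp add: sum_distrib_left sum_subtractf left_diff_distrib mult.assoc)
      also have "\<bar>\<dots>\<bar> \<le> (\<Sum>i<l. \<bar>(q i - N * p i) * f (x i)\<bar>)" by (rule sum_abs)
      also have "\<dots> \<le> (\<Sum>i<l. 1 * b)"
      proof (rule sum_mono)
        fix i assume "i \<in> {..<l}"
        then show "\<bar>(q i - N * p i) * f (x i)\<bar> \<le> 1 * b"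
          unfolding abs_mult using q[of i] bnd[OF f x[of i]] b by (intro mult_mono) auto
      qed
      finally show ?thesis by simp
    qed
    have 2: "\<bar>N * (\<Sum>i<l. p i * f (x i)) - N * I\<bar> \<le> N * (e / 2)"
      using approx[OF f] unfolding I_def right_diff_distrib[symmetric] abs_mult by (intro mult_mono) auto
    have 3: "\<bar>N * I - size Z * I\<bar> \<le> l * b"
      using N_le le_N I b unfolding left_diff_distrib[symmetric] abs_mult by (intro mult_mono) auto
    have "\<bar>(\<Sum>y\<in>#Z. f y) - size Z * I\<bar> \<le> 2 * (l * b) + N * (e / 2)"
      using 1 2 3 unfolding sumZ by linarith
    also have "\<dots> \<le> N * (e / 2) + N * (e / 2)" using N(1) by linarith
    also have "\<dots> = e * N" by simp
    also have "\<dots> \<le> e * size Z" using N_le e by (intro mult_left_mono) auto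
    finally show "\<bar>(\<Sum>x\<in>#Z. f x) - size Z * (\<integral>t. f t \<partial>\<mu>)\<bar> \<le> e * size Z" unfolding I_def .
  qed
qed

text \<open>The family consists of \<open>ln g\<close> and the kernels truncated at \<open>r\<close>
  for all \<open>z\<close> in a disc; these kernels are Lipschitz with constant
  \<open>1 / r\<close>. Truncation can only enlarge distances, which is harmless because the product
  over \<open>Z\<close> is bounded from above.\<close>

lemma discretization_potential:
  fixes g :: "complex \<Rightarrow> real" and e r R :: real
  assumes e: "e > 0" and r: "r > 0" and g: "continuous_on UNIV g" "\<And>z. 0 < g z"
  obtains Z where "Z \<noteq> {#}" "set_mset Z \<subseteq> S"
    "\<And>z. cmod z \<le> R \<Longrightarrow> (\<Prod>x\<in>#Z. cmod (z - x)) \<le> exp (size Z * (Utr r z + e))"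
    "size Z * ((\<integral>t. ln (g t) \<partial>\<mu>) - e) \<le> (\<Sum>x\<in>#Z. ln (g x))"
proof -
  obtain \<rho>0 where \<rho>0: "\<rho>0 \<ge> 1" "\<And>t. t \<in> S \<Longrightarrow> cmod t \<le> \<rho>0" using support_bound by blast
  have lng: "continuous_on UNIV (\<lambda>z. ln (g z))" using g by (intro continuous_intros) (auto simp: less_imp_neq[THEN not_sym])
  have "bounded ((\<lambda>z. ln (g z)) ` S)"
    using compact_support by (intro compact_imp_bounded compact_continuous_image continuous_on_subset[OF lng]) auto
  then obtain b0 where b0: "\<And>z. z \<in> S \<Longrightarrow> \<bar>ln (g z)\<bar> \<le> b0" unfolding bounded_iff by auto
  define b where "b = \<bar>b0\<bar> + \<bar>ln r\<bar> + \<bar>ln (max r (R + \<rho>0))\<bar>"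
  have "uniformly_continuous_on S (\<lambda>z. ln (g z))"
    using compact_support by (intro compact_uniformly_continuous continuous_on_subset[OF lng]) auto
  then obtain d where d: "d > 0" "\<And>x y. x \<in> S \<Longrightarrow> y \<in> S \<Longrightarrow> dist x y < d \<Longrightarrow> \<bar>ln (g x) - ln (g y)\<bar> < e / 2"
    using e unfolding uniformly_continuous_on_def dist_real_def by (metis dist_commute half_gt_zero)
  let ?G = "insert (\<lambda>z. ln (g z)) ((\<lambda>z t. ln (max r (cmod (z - t)))) ` cball 0 R)"
  obtain Z where Z: "Z \<noteq> {#}" "set_mset Z \<subseteq> S"
    "\<And>f. f \<in> ?G \<Longrightarrow> \<bar>(\<Sum>x\<in>#Z. f x) - size Z * (\<integral>t. f t \<partial>\<mu>)\<bar> \<le> e * size Z"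
  proof (rule discretization[where G = ?G and b = b and \<rho> = "min d (e * r / 2)", OF e])
    show "f \<in> borel_measurable borel" if "f \<in> ?G" for f
      using that borel_measurable_continuous_onI[OF lng] by auto
    show "0 \<le> b" by (simp add: b_def)
    show "0 < min d (e * r / 2)" using d e r by simp
    show "\<bar>f x\<bar> \<le> b" if "f \<in> ?G" "x \<in> S" for f x
    proof -
      have "\<bar>ln (max r (cmod (z - x)))\<bar> \<le> b" if z: "cmod z \<le> R" for z
      proof -
        have "cmod (z - x) \<le> R + \<rho>0" using norm_triangle_ineq4[of z x] \<rho>0(2)[OF \<open>x \<in> S\<close>] z by simp
        then have "ln (max r (cmod (z - x))) \<le> ln (max r (R + \<rho>0))" using r by (intro ln_mono) auto
        moreover have "ln r \<le> ln (max r (cmod (z - x)))" using r by (intro ln_mono) auto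
        ultimately show ?thesis unfolding b_def by linarith
      qed
      moreover have "\<bar>ln (g x)\<bar> \<le> b" using b0[OF \<open>x \<in> S\<close>] by (simp add: b_def)
      ultimately show ?thesis using \<open>f \<in> ?G\<close> by auto
    qed
    show "\<bar>f x - f y\<bar> \<le> e / 2" if "f \<in> ?G" "x \<in> S" "y \<in> S" "dist x y < min d (e * r / 2)" for f x y
    proof -
      have "\<bar>ln (max r (cmod (z - x))) - ln (max r (cmod (z - y)))\<bar> \<le> e / 2" for z
      proof -
        have "\<bar>ln (max r (cmod (z - x))) - ln (max r (cmod (z - y)))\<bar> \<le> \<bar>cmod (z - x) - cmod (z - y)\<bar> / r"
          by (rule ln_max_lipschitz[OF r])
        also have "\<dots> \<le> dist x y / r"
          using r norm_triangle_ineq3[of "z - x" "z - y"] by (intro divide_right_mono) (auto simp: dist_norm norm_minus_commute)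
        also have "\<dots> \<le> (e * r / 2) / r" using that(4) r by (intro divide_right_mono) auto
        finally show ?thesis using r by simp
      qed
      moreover have "\<bar>ln (g x) - ln (g y)\<bar> \<le> e / 2" using d(2)[OF that(2,3)] that(4) by simp
      ultimately show ?thesis using \<open>f \<in> ?G\<close> by auto
    qed
  qed blast
  show thesis
  proof (rule that[OF Z(1,2)])
    fix z assume z: "cmod z \<le> R"
    have "(\<Prod>x\<in>#Z. cmod (z - x)) \<le> (\<Prod>x\<in>#Z. max r (cmod (z - x)))"
      using prod_mset_mono_real[of Z "\<lambda>x. cmod (z - x)" "\<lambda>x. max r (cmod (z - x))"] by auto
    also have "\<dots> = exp (\<Sum>x\<in>#Z. ln (max r (cmod (z - x))))"
      using ln_prod_mset[of Z "\<lambda>x. max r (cmod (z - x))"] r by (metis exp_ln less_max_iff_disj)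
    also have "\<dots> \<le> exp (size Z * (Utr r z + e))"
      using Z(3)[of "\<lambda>t. ln (max r (cmod (z - t)))"] z by (auto simp: Utr_def algebra_simps abs_le_iff)
    finally show "(\<Prod>x\<in>#Z. cmod (z - x)) \<le> exp (size Z * (Utr r z + e))" .
  next
    show "size Z * ((\<integral>t. ln (g t) \<partial>\<mu>) - e) \<le> (\<Sum>x\<in>#Z. ln (g x))"
      using Z(3)[of "\<lambda>z. ln (g z)"] by (auto simp: algebra_simps abs_le_iff)
  qed
qed

end

section \<open>Sharpness\<close>

context weighted_equilibrium
begin

text \<open>Where \<open>U + ln w + F \<ge> e\<close>, with \<open>U\<close> replaced by a
  continuous majorant. This makes the sets compact, and for \<open>e > 0\<close> they shrink to a
  subset of the exceptional set.\<close>

definition superlevel :: "real \<Rightarrow> nat \<Rightarrow> complex set" where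
  "superlevel e i = {z \<in> E. exp (e - F - Utr (1 / Suc i) z) \<le> w z}"

lemma superlevel_antimono:
  assumes "i \<le> j"
  shows "superlevel e j \<subseteq> superlevel e i"
proof
  fix z assume z: "z \<in> superlevel e j"
  have "Utr (1 / Suc j) z \<le> Utr (1 / Suc i) z" using assms by (intro Utr_mono) (auto simp: field_simps)
  then have "exp (e - F - Utr (1 / Suc i) z) \<le> exp (e - F - Utr (1 / Suc j) z)" by simp
  then show "z \<in> superlevel e i" using z unfolding superlevel_def mem_Collect_eq by linarith
qed

lemma closed_superlevel_set: "closed (superlevel e i)"
  unfolding superlevel_def by (intro closed_superlevel continuous_intros continuous_Utr) auto

lemma bounded_superlevel: "bounded (superlevel e i)"
proof -
  obtain \<rho> where \<rho>: "\<rho> \<ge> 1" "\<And>t. t \<in> msupp \<mu> \<Longrightarrow> cmod t \<le> \<rho>" using support_bound by blast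
  \<comment> \<open>For \<open>cmod z\<close> beyond the support \<open>Utr\<close> is at most
    \<open>ln (2 * cmod z)\<close>, so a point of the superlevel set has
    \<open>cmod z * w z \<ge> exp (e - F) / 2\<close>; the decay of \<open>w\<close> forbids this
    far out.\<close>
  obtain R where R: "R > 0" "\<And>z. z \<in> E \<Longrightarrow> cmod z > R \<Longrightarrow> cmod z * w z < exp (e - F) / 2"
    using w_decay[of "exp (e - F) / 2"] by auto
  have "cmod z \<le> max \<rho> R" if z: "z \<in> superlevel e i" for z
  proof (rule ccontr)
    assume "\<not> ?thesis"
    then have big: "cmod z > \<rho>" "cmod z > R" by auto
    have zE: "z \<in> E" using z by (simp add: superlevel_def)
    have "Utr (1 / Suc i) z \<le> (\<integral>t. ln (2 * cmod z) \<partial>\<mu>)"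
      unfolding Utr_def
    proof (rule integral_mono_AE)
      show "AE t in \<mu>. ln (max (1 / Suc i) (cmod (z - t))) \<le> ln (2 * cmod z)"
        using AE_support
      proof eventually_elim
        case (elim t)
        have "cmod (z - t) \<le> 2 * cmod z" using norm_triangle_ineq4[of z t] \<rho>(2)[OF elim] big by simp
        moreover have "1 / real (Suc i) \<le> 2 * cmod z"
          by (rule order_trans[of "1 / real (Suc i)" 1]) (use big(1) \<rho>(1) in auto)
        ultimately have "max (1 / Suc i) (cmod (z - t)) \<le> 2 * cmod z" by (rule max.boundedI[rotated])
        then show ?case by (intro ln_mono) (auto simp: less_max_iff_disj)
      qed
    qed auto
    then have U: "Utr (1 / Suc i) z \<le> ln (2 * cmod z)" by (simp add: prob_space[simplified])
    have pos: "0 < 2 * cmod z" using big(1) \<rho>(1) by linarith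
    have "exp (e - F) / (2 * cmod z) = exp (e - F - ln (2 * cmod z))"
      using pos by (simp only: exp_diff exp_ln)
    also have "\<dots> \<le> exp (e - F - Utr (1 / Suc i) z)" using U by simp
    also have "\<dots> \<le> w z" using z by (simp add: superlevel_def)
    finally have "exp (e - F) / 2 \<le> cmod z * w z" using pos by (simp add: pos_divide_le_eq mult_ac)
    then show False using R(2)[OF zE big(2)] by simp
  qed
  then show ?thesis unfolding bounded_iff by blast
qed

lemma compact_superlevel: "compact (superlevel e i)"
  using closed_superlevel_set bounded_superlevel by (simp add: compact_eq_bounded_closed)

lemma superlevel_Inter_capacity_zero:
  assumes "e > 0"
  shows "\<not> pos_log_cap (\<Inter>i. superlevel e i)"
proof
  assume cap: "pos_log_cap (\<Inter>i. superlevel e i)"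
  have "(\<Inter>i. superlevel e i) \<subseteq> {z \<in> E. \<not> (logint \<mu> (\<lambda>t. cmod (z - t)) + elog (w z) + ereal F \<le> 0)}"
  proof
    fix z assume z: "z \<in> (\<Inter>i. superlevel e i)"
    have "(\<lambda>i. exp (e - F - Utr (1 / Suc i) z)) \<longlonglongrightarrow> exp (e - F - U z)"
      by (intro tendsto_intros Utr_tendsto)
    then have le: "exp (e - F - U z) \<le> w z"
      by (rule LIMSEQ_le_const2) (use z in \<open>auto simp: superlevel_def\<close>)
    then have w: "w z > 0" using exp_gt_zero[of "e - F - U z"] by linarith
    then have "e - F - U z \<le> ln (w z)" using le by (simp add: ln_ge_iff)
    then have "0 < U z + ln (w z) + F" using assms by linarith
    then show "z \<in> {z \<in> E. \<not> (logint \<mu> (\<lambda>t. cmod (z - t)) + elog (w z) + ereal F \<le> 0)}"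
      using z w by (auto simp: superlevel_def logint_eq_U elog_def)
  qed
  with cap have "pos_log_cap {z \<in> E. \<not> (logint \<mu> (\<lambda>t. cmod (z - t)) + elog (w z) + ereal F \<le> 0)}"
    by (rule pos_log_cap_mono)
  then show False using equi by (simp add: is_weighted_equilibrium_def quasi_every_def)
qed

text \<open>Capacity zero gives a small product only on the intersection of all superlevel sets.
  Smallness is an open condition and the sets are compact and nested, so it already holds on one of
  them.\<close>

lemma small_product_near_superlevel:
  fixes \<delta> RA :: real
  assumes e: "e > 0" and \<delta>: "\<delta> > 0" and RA: "\<And>z. z \<in> superlevel e 0 \<Longrightarrow> cmod z \<le> RA" "\<And>t. t \<in> msupp \<mu> \<Longrightarrow> cmod t \<le> RA"
  obtains i A where "A \<noteq> {#}" "\<And>x. x \<in># A \<Longrightarrow> cmod x \<le> RA"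
    "\<And>z. z \<in> superlevel e i \<Longrightarrow> (\<Prod>x\<in>#A. cmod (z - x)) < \<delta> ^ size A"
proof -
  let ?K = "\<Inter>i. superlevel e i"
  have K: "compact ?K" using compact_superlevel by (intro compact_Inter) auto
  have "\<exists>d a. d \<ge> 1 \<and> (\<forall>i<d. cmod (a i) \<le> RA) \<and> (\<forall>z\<in>?K. (\<Prod>i<d. cmod (z - a i)) < \<delta> ^ (d::nat))"
  proof (cases "?K = {}")
    \<comment> \<open>Nothing has to be small here, but the multiset must be nonempty and lie in the
      disc; any support point does.\<close>
    case True
    obtain s where "s \<in> msupp \<mu>" using S_nonempty by blast
    then show ?thesis unfolding True using RA(2) by (intro exI[of _ "1::nat"] exI[of _ "\<lambda>_. s"]) auto
  next
    case False
    obtain d a where "d \<ge> 1" "\<forall>i<d. a i \<in> ?K" "\<forall>z\<in>?K. (\<Prod>i<d. cmod (z - a i)) < \<delta> ^ (d::nat)"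
      using capacity_zero_small_product[OF K False superlevel_Inter_capacity_zero[OF e] \<delta>] by blast
    then show ?thesis using RA(1) by (intro exI[of _ d] exI[of _ a]) auto
  qed
  then obtain d a where d: "d \<ge> 1" and a: "\<And>i. i < d \<Longrightarrow> cmod (a i) \<le> RA"
    and small: "\<And>z. z \<in> ?K \<Longrightarrow> (\<Prod>i<d. cmod (z - a i)) < \<delta> ^ (d::nat)" by blast
  define G where "G = {z. (\<Prod>i<d. cmod (z - a i)) < \<delta> ^ d}"
  have G: "open G" unfolding G_def by (intro open_Collect_less continuous_intros)
  have "\<exists>i. superlevel e i \<subseteq> G"
  proof (rule ccontr)
    assume neg: "\<not> ?thesis"
    have "\<Inter>(range (\<lambda>i. superlevel e i - G)) \<noteq> {}"
    proof (rule compact_nest)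
      show "compact (superlevel e i - G)" for i using compact_superlevel G by (rule compact_diff)
      show "superlevel e i - G \<noteq> {}" for i using neg by blast
      show "superlevel e j - G \<subseteq> superlevel e i - G" if "i \<le> j" for i j using superlevel_antimono[OF that] by blast
    qed
    then obtain z where "z \<in> ?K" "z \<notin> G" by blast
    then show False using small by (simp add: G_def)
  qed
  then obtain i where i: "superlevel e i \<subseteq> G" by blast
  let ?A = "image_mset a (mset_set {..<d})"
  have prod: "(\<Prod>x\<in>#?A. cmod (z - x)) = (\<Prod>i<d. cmod (z - a i))" for z
    by (simp add: prod_unfold_prod_mset image_mset.compositionality o_def)
  have size: "size ?A = d" by simp
  show thesis
  proof (rule that[of ?A i])
    show "?A \<noteq> {#}" using d by (simp add: mset_set_empty_iff lessThan_empty_iff)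
    show "cmod x \<le> RA" if "x \<in># ?A" for x using that a by auto
    show "(\<Prod>x\<in>#?A. cmod (z - x)) < \<delta> ^ size ?A" if "z \<in> superlevel e i" for z
      using that i unfolding prod size by (auto simp: G_def)
  qed
qed

text \<open>Discretizing \<open>\<mu>\<close> alone fails on the exceptional set of capacity zero, where \<open>U + log w + F\<close> may be positive;
  a small proportion of extra zeros, whose product is tiny there, repairs this.\<close>

lemma asymptotically_extremal_zeros:
  fixes g :: "complex \<Rightarrow> real" and e :: real
  assumes e: "e > 0" and g: "continuous_on UNIV g" "\<And>z. 0 < g z"
  obtains M where "M \<noteq> {#}" "size M * ((\<integral>t. ln (g t) \<partial>\<mu>) - e) \<le> (\<Sum>x\<in>#M. ln (g x))"
    "\<And>z. z \<in> E \<Longrightarrow> (\<Prod>x\<in>#M. w z * cmod (z - x)) \<le> exp (size M * (3 * e - F))"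
proof -
  define I where "I = (\<integral>t. ln (g t) \<partial>\<mu>)"
  obtain \<rho> where \<rho>: "\<rho> \<ge> 1" "\<And>t. t \<in> msupp \<mu> \<Longrightarrow> cmod t \<le> \<rho>" using support_bound by blast
  obtain b where b: "\<And>z. z \<in> superlevel e 0 \<Longrightarrow> cmod z \<le> b"
    using bounded_superlevel[of e 0] unfolding bounded_iff by auto
  define RA where "RA = max \<rho> b"
  have RA: "RA \<ge> 1" "\<And>z. z \<in> superlevel e 0 \<Longrightarrow> cmod z \<le> RA" "\<And>t. t \<in> msupp \<mu> \<Longrightarrow> cmod t \<le> RA"
    using \<rho> b by (auto simp: RA_def le_max_iff_disj)
  obtain R0 where R0: "R0 > 0" "\<And>z. z \<in> E \<Longrightarrow> cmod z > R0 \<Longrightarrow> cmod z * w z < exp (- F) / 2"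
    using w_decay[of "exp (- F) / 2"] by auto
  define R where "R = max R0 RA"
  obtain W where W: "W > 0" "\<And>z. z \<in> E \<Longrightarrow> w z \<le> W" by (rule w_bounded) blast
  obtain \<Gamma> where \<Gamma>: "\<Gamma> > 0" "\<And>z. z \<in> E \<Longrightarrow> w z * (cmod z + RA) \<le> \<Gamma>"
    using w_linear_bounded[of RA] RA(1) by auto
  have lng: "continuous_on UNIV (\<lambda>z. ln (g z))" using g by (intro continuous_intros) (auto simp: less_imp_neq[THEN not_sym])
  have "bounded ((\<lambda>z. ln (g z)) ` cball 0 RA)"
    by (intro compact_imp_bounded compact_continuous_image continuous_on_subset[OF lng]) auto
  then obtain Lg where "\<forall>z\<in>cball 0 RA. \<bar>ln (g z)\<bar> \<le> Lg" unfolding bounded_iff by auto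
  then have Lg: "\<And>z. cmod z \<le> RA \<Longrightarrow> \<bar>ln (g z)\<bar> \<le> Lg" by simp
  \<comment> \<open>\<open>k\<close> is the ratio of discretization zeros to extra zeros, so large
    that bounding the extra factors by \<open>\<Gamma>\<close> and their share in the sum of
    \<open>ln g\<close> by \<open>Lg\<close> costs only a multiple of \<open>e\<close> per zero.
    Then \<open>\<delta>\<close> depends on \<open>k\<close>, the extra zeros and \<open>i\<close>
    on \<open>\<delta>\<close>, and the discretization on \<open>i\<close>.\<close>
  obtain k :: nat where k: "(\<bar>ln \<Gamma>\<bar> + \<bar>F\<bar> + \<bar>I\<bar> + \<bar>Lg\<bar>) * 2 / e \<le> k" using real_arch_simple by blast
  then have "\<bar>ln \<Gamma>\<bar> + \<bar>F\<bar> + \<bar>I\<bar> + \<bar>Lg\<bar> \<le> k * (e / 2)" using e by (simp add: pos_divide_le_eq)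
  moreover have "0 \<le> k * (e / 2)" using e by simp
  ultimately have k1: "ln \<Gamma> + F \<le> k * e" and k2: "I + Lg \<le> k * (e / 2)" by auto
  \<comment> \<open>Solves \<open>\<Gamma> ^ k * W * \<delta> = exp (- (k + 1) * F)\<close>: one
    extra zero compensates the crude bound \<open>\<Gamma>\<close> for \<open>k\<close> ordinary
    ones.\<close>
  define \<delta> where "\<delta> = exp (- (k + 1) * F) / (\<Gamma> ^ k * W)"
  have \<delta>: "\<delta> > 0" using \<Gamma>(1) W(1) by (simp add: \<delta>_def)
  obtain i A where A: "A \<noteq> {#}" "\<And>x. x \<in># A \<Longrightarrow> cmod x \<le> RA"
    "\<And>z. z \<in> superlevel e i \<Longrightarrow> (\<Prod>x\<in>#A. cmod (z - x)) < \<delta> ^ size A"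
    by (rule small_product_near_superlevel[OF e \<delta> RA(2,3)]) blast+
  have r: "(0::real) < 1 / Suc i" by simp
  have e2: "e / 2 > 0" using e by simp
  obtain Z where Z: "Z \<noteq> {#}" "set_mset Z \<subseteq> msupp \<mu>"
    "\<And>z. cmod z \<le> R \<Longrightarrow> (\<Prod>x\<in>#Z. cmod (z - x)) \<le> exp (size Z * (Utr (1 / Suc i) z + e / 2))"
    "size Z * ((\<integral>t. ln (g t) \<partial>\<mu>) - e / 2) \<le> (\<Sum>x\<in>#Z. ln (g x))"
    by (rule discretization_potential[where R = R, OF e2 r g]) blast
  define d where "d = size A"
  define n where "n = size Z"
  \<comment> \<open>Repetition brings the two parts to sizes \<open>k * (n * d)\<close> and
    \<open>n * d\<close>, so the extra zeros have share \<open>1 / (k + 1)\<close>.\<close>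
  define M where "M = repeat_mset (k * d) Z + repeat_mset n A"
  have size: "size M = (k + 1) * (n * d)" by (simp add: M_def d_def n_def algebra_simps)
  have nd: "n * d > 0" using A(1) Z(1) by (simp add: n_def d_def nonempty_has_size)
  show thesis
  proof (rule that[of M])
    show "M \<noteq> {#}" using size nd by auto
    have "size M * (I - e) = (n * d) * ((k + 1) * (I - e))" by (simp add: size algebra_simps)
    also have "\<dots> \<le> (n * d) * (k * (I - e / 2) - Lg)"
      using k2 e by (intro mult_left_mono) (auto simp: algebra_simps)
    also have "\<dots> = real (k * d) * (n * (I - e / 2)) + n * (d * (- Lg))" by (simp add: algebra_simps)
    also have "\<dots> \<le> real (k * d) * (\<Sum>x\<in>#Z. ln (g x)) + n * (\<Sum>x\<in>#A. ln (g x))"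
    proof (intro add_mono mult_left_mono)
      show "n * (I - e / 2) \<le> (\<Sum>x\<in>#Z. ln (g x))" using Z(4) by (simp add: n_def I_def)
      have "- Lg \<le> ln (g x)" if "x \<in># A" for x using Lg[OF A(2)[OF that]] by simp
      then have "(\<Sum>x\<in>#A. - Lg) \<le> (\<Sum>x\<in>#A. ln (g x))" by (intro sum_mset_mono)
      then show "d * (- Lg) \<le> (\<Sum>x\<in>#A. ln (g x))" by (simp add: d_def)
    qed auto
    also have "\<dots> = (\<Sum>x\<in>#M. ln (g x))" by (simp add: M_def sum_mset_repeat)
    finally show "size M * ((\<integral>t. ln (g t) \<partial>\<mu>) - e) \<le> (\<Sum>x\<in>#M. ln (g x))" by (simp add: I_def)
  next
    fix z assume z: "z \<in> E"
    note wz = w_nonneg[OF z]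
    define H where "H X = (\<Prod>x\<in>#X. w z * cmod (z - x))" for X
    have HM: "H M = H Z ^ (k * d) * H A ^ n" by (simp add: H_def M_def prod_mset_repeat)
    have H_eq: "H X = w z ^ size X * (\<Prod>x\<in>#X. cmod (z - x))" for X
      by (simp add: H_def prod_mset.distrib prod_mset_const)
    have H_bound: "0 \<le> H X \<and> H X \<le> q ^ size X" if "\<And>x. x \<in># X \<Longrightarrow> w z * cmod (z - x) \<le> q" for X q
      using prod_mset_mono_real[of X "\<lambda>x. w z * cmod (z - x)" "\<lambda>_. q"] that wz by (auto simp: H_def prod_mset_const)
    have x_bound: "w z * cmod (z - x) \<le> \<Gamma>" if "cmod x \<le> RA" for x
    proof -
      have "w z * cmod (z - x) \<le> w z * (cmod z + RA)"
        using norm_triangle_ineq4[of z x] that wz by (intro mult_left_mono) auto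
      then show ?thesis using \<Gamma>(2)[OF z] by simp
    qed
    have HZ: "0 \<le> H Z" "H Z \<le> \<Gamma> ^ n" and HA: "0 \<le> H A" "H A \<le> \<Gamma> ^ d"
      using H_bound[of Z \<Gamma>] H_bound[of A \<Gamma>] x_bound RA(3) Z(2) A(2) by (auto simp: n_def d_def)
    \<comment> \<open>Far from the origin the decay of \<open>w\<close> suffices; on
      \<open>superlevel e i\<close> the extra zeros win against the crude bound; elsewhere
      \<open>w\<close> is at most \<open>exp (e - F - Utr (1 / Suc i) z)\<close>, which cancels the
      discretized potential.\<close>
    have "H M \<le> exp (size M * (3 * e - F))"
    proof (cases "cmod z > R")
      case True
      have "w z * cmod (z - x) \<le> exp (- F)" if "x \<in># M" for x
      proof -
        have "cmod x \<le> RA" using that A(2) RA(3) Z(2) by (auto simp: M_def dest!: in_repeat_msetD)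
        then have "cmod (z - x) \<le> 2 * cmod z" using norm_triangle_ineq4[of z x] True by (simp add: R_def)
        then have "w z * cmod (z - x) \<le> w z * (2 * cmod z)" using wz by (intro mult_left_mono)
        then show ?thesis using R0(2)[OF z] True by (simp add: R_def mult_ac)
      qed
      then have "H M \<le> exp (- F) ^ size M" using H_bound[of M "exp (- F)"] by blast
      also have "\<dots> = exp (size M * (- F))" by (simp only: exp_of_nat_mult)
      also have "\<dots> \<le> exp (size M * (3 * e - F))"
          unfolding exp_le_cancel_iff using e by (intro mult_left_mono) auto
      finally show ?thesis .
    next
      case False
      show ?thesis
      proof (cases "z \<in> superlevel e i")
        case True
        have "H A \<le> W ^ d * \<delta> ^ d"
          unfolding H_eq d_def using A(3)[OF True] W(2)[OF z] wz \<delta>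
          by (intro mult_mono power_mono) (auto intro: less_imp_le prod_mset_mono_real[THEN conjunct1])
        then have "H M \<le> (\<Gamma> ^ n) ^ (k * d) * (W ^ d * \<delta> ^ d) ^ n"
          unfolding HM using HZ HA \<Gamma>(1) by (intro mult_mono power_mono) auto
        also have "\<dots> = (\<Gamma> ^ k * W * \<delta>) ^ (n * d)"
          by (simp add: power_mult_distrib power_mult[symmetric] mult_ac)
        also have "\<Gamma> ^ k * W * \<delta> = exp ((k + 1) * (- F))"
          using \<Gamma>(1) W(1) by (simp add: \<delta>_def algebra_simps)
        also have "exp ((k + 1) * (- F)) ^ (n * d) = exp (size M * (- F))"
          by (simp add: exp_of_nat_mult[symmetric] size algebra_simps)
        also have "\<dots> \<le> exp (size M * (3 * e - F))"
          unfolding exp_le_cancel_iff using e by (intro mult_left_mono) auto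
        finally show ?thesis .
      next
        case False
        have "w z \<le> exp (e - F - Utr (1 / Suc i) z)" using False z by (simp add: superlevel_def)
        then have "H Z \<le> exp (e - F - Utr (1 / Suc i) z) ^ n * exp (n * (Utr (1 / Suc i) z + e / 2))"
          unfolding H_eq n_def using wz Z(3)[of z] \<open>\<not> R < cmod z\<close>
          by (intro mult_mono power_mono) (auto intro: prod_mset_mono_real[THEN conjunct1])
        also have "\<dots> = exp (n * (e - F + e / 2))"
          by (simp add: exp_of_nat_mult[symmetric] exp_add[symmetric] algebra_simps)
        also have "\<dots> \<le> exp (n * (2 * e - F))" using e by (simp add: mult_left_mono)
        finally have "H M \<le> exp (n * (2 * e - F)) ^ (k * d) * (\<Gamma> ^ d) ^ n"
          unfolding HM using HZ HA \<Gamma>(1) by (intro mult_mono power_mono) auto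
        also have "\<dots> = exp ((n * d) * (k * (2 * e - F) + ln \<Gamma>))"
        proof -
          have "(\<Gamma> ^ d) ^ n = exp (real (d * n) * ln \<Gamma>)"
            using \<Gamma>(1) by (simp add: power_mult[symmetric] exp_of_nat_mult del: of_nat_mult)
          moreover have "exp (n * (2 * e - F)) ^ (k * d) = exp (real (k * d) * (n * (2 * e - F)))"
            by (simp add: exp_of_nat_mult del: of_nat_mult)
          ultimately show ?thesis by (simp add: exp_add[symmetric] algebra_simps)
        qed
        also have "\<dots> \<le> exp ((n * d) * ((k + 1) * (3 * e - F)))"
        proof -
          have "k * (2 * e - F) + ln \<Gamma> \<le> (k + 1) * (3 * e - F)" using k1 e by (simp add: algebra_simps)
          then show ?thesis by (simp add: mult_left_mono del: of_nat_mult)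
        qed
        also have "\<dots> = exp (size M * (3 * e - F))" by (simp add: size algebra_simps)
        finally show ?thesis .
      qed
    qed
    then show "(\<Prod>x\<in>#M. w z * cmod (z - x)) \<le> exp (size M * (3 * e - F))" by (simp add: H_def)
  qed
qed

text \<open>The discretization needs \<open>ln (wmax m c z)\<close> continuous, hence
  \<open>wmax\<close> positive everywhere. It can vanish only if all chosen points of positive
  weight coincide; then a second index is free, and sending it to a different point of the support
  can only raise \<open>wmax\<close>. This is where \<open>m \<ge> 2\<close> enters.\<close>

lemma positive_wmax_points:
  assumes m: "m \<ge> 2" and C: "ereal C < CEwm E w \<mu> F m"
  obtains c where "\<And>k. k < m \<Longrightarrow> c k \<in> E" "\<And>z. 0 < wmax m c z" "C < (\<integral>z. ln (wmax m c z) \<partial>\<mu>) + F"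
proof -
  have m1: "m \<ge> 1" using m by simp
  obtain c where c: "\<And>k. k < m \<Longrightarrow> c k \<in> E" and Cc: "ereal C < logint \<mu> (wmax m c) + ereal F"
    using C unfolding CEwm_eq less_SUP_iff by auto
  have ex: "\<exists>k<m. w (c k) > 0"
  proof (rule ccontr)
    assume "\<not> ?thesis"
    then show False using logint_wmax(2)[of m c] m1 c Cc by simp
  qed
  then obtain k0 where k0: "k0 < m" "w (c k0) > 0" by blast
  have Ci: "C < (\<integral>z. ln (wmax m c z) \<partial>\<mu>) + F"
    using Cc logint_wmax(1)[where c = c, OF m1 c ex] by simp
  show thesis
  proof (cases "\<exists>k<m. w (c k) > 0 \<and> c k \<noteq> c k0")
    case True
    then obtain k where k: "k < m" "w (c k) > 0" "c k \<noteq> c k0" by blast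
    have "0 < wmax m c z" for z
    proof (cases "z = c k0")
      case True
      then have "0 < w (c k) * cmod (z - c k)" using k by simp
      then show ?thesis using wmax_ge[OF k(1), of c z] by linarith
    next
      case False
      then have "0 < w (c k0) * cmod (z - c k0)" using k0 by simp
      then show ?thesis using wmax_ge[OF k0(1), of c z] by linarith
    qed
    then show ?thesis using that[of c] c Ci by blast
  next
    case False
    obtain k1 where k1: "k1 < m" "k1 \<noteq> k0" using m by (metis One_nat_def Suc_1 Suc_le_lessD less_trans nat_neq_iff zero_less_one zero_neq_one)
    obtain s where s: "s \<in> msupp \<mu>" "s \<noteq> c k0" by (rule support_two_points)
    define c' where "c' = c(k1 := s)"
    have c'E: "c' k \<in> E" if "k < m" for k using c[OF that] s(1) support_subset by (auto simp: c'_def)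
    have pos: "0 < wmax m c' z" for z
    proof (cases "z = c k0")
      case True
      then have "0 < w (c' k1) * cmod (z - c' k1)" using s equilibrium_on_support(1)[OF s(1)] by (simp add: c'_def)
      then show ?thesis using wmax_ge[OF k1(1), of c' z] by linarith
    next
      case False
      then have "0 < w (c' k0) * cmod (z - c' k0)" using k0 k1(2) by (simp add: c'_def)
      then show ?thesis using wmax_ge[OF k0(1), of c' z] by linarith
    qed
    have le: "wmax m c z \<le> wmax m c' z" for z
    proof (rule wmax_le[OF m1])
      fix k assume k: "k < m"
      show "w (c k) * cmod (z - c k) \<le> wmax m c' z"
      proof (cases "k = k1")
        case True
        show ?thesis
        proof (cases "w (c k) > 0")
          case True
          then have "c k = c k0" using False k by blast
          then have "w (c k) * cmod (z - c k) = w (c' k0) * cmod (z - c' k0)" using k1(2) by (simp add: c'_def)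
          then show ?thesis using wmax_ge[OF k0(1), of c' z] by linarith
        next
          case False
          then have "w (c k) = 0" using w_nonneg[OF c[OF k]] by simp
          then show ?thesis using pos[of z] by simp
        qed
      next
        case False
        then show ?thesis using wmax_ge[OF k, of c' z] by (simp add: c'_def)
      qed
    qed
    have i: "AE z in \<mu>. 0 < wmax m c z" "integrable \<mu> (\<lambda>z. ln (wmax m c z))"
      by (rule wmax_integrable[where c = c, OF m1 _ k0], erule c)+
    have "(\<integral>z. ln (wmax m c z) \<partial>\<mu>) \<le> (\<integral>z. ln (wmax m c' z) \<partial>\<mu>)"
    proof (rule integral_mono_AE[OF i(2)])
      show "integrable \<mu> (\<lambda>z. ln (wmax m c' z))"
        by (intro integrable_ln_continuous_pos continuous_wmax m1 pos)
      show "AE z in \<mu>. ln (wmax m c z) \<le> ln (wmax m c' z)"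
        using i(1) by eventually_elim (intro ln_mono le)
    qed
    then show ?thesis using that[of c'] c'E pos Ci by force
  qed
qed

lemma prod_ineq_fails:
  assumes m: "m \<ge> 2" and C: "ereal C < CEwm E w \<mu> F m"
  shows "\<exists>P. \<not> prod_ineq E w m P (ereal C)"
proof -
  obtain c where c: "\<And>k. k < m \<Longrightarrow> c k \<in> E" and pos: "\<And>z. 0 < wmax m c z"
    and gt: "C < (\<integral>z. ln (wmax m c z) \<partial>\<mu>) + F"
    by (rule positive_wmax_points[OF m C]) blast
  have m1: "m \<ge> 1" using m by simp
  define I where "I = (\<integral>z. ln (wmax m c z) \<partial>\<mu>)"
  \<comment> \<open>Five parts: the product of norms loses \<open>e\<close>, the norm of the product
    \<open>3 * e\<close>, and one \<open>e\<close> keeps the inequality strict.\<close>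
  define e where "e = (I + F - C) / 5"
  have e: "e > 0" using gt by (simp add: e_def I_def)
  obtain M where M: "M \<noteq> {#}" "size M * ((\<integral>t. ln (wmax m c t) \<partial>\<mu>) - e) \<le> (\<Sum>x\<in>#M. ln (wmax m c x))"
    "\<And>z. z \<in> E \<Longrightarrow> (\<Prod>x\<in>#M. w z * cmod (z - x)) \<le> exp (size M * (3 * e - F))"
    by (rule asymptotically_extremal_zeros[OF e continuous_wmax[OF m1, of UNIV c] pos]) blast
  have "\<exists>j<m. w (c j) * cmod (x - c j) = wmax m c x" for x
  proof -
    have "wmax m c x \<in> (\<lambda>k. w (c k) * cmod (x - c k)) ` {..<m}"
      unfolding wmax_def using m1 by (intro Max_in) (auto simp: lessThan_empty_iff)
    then show ?thesis by auto
  qed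
  then obtain J where J: "\<And>x. J x < m" "\<And>x. w (c (J x)) * cmod (x - c (J x)) = wmax m c x" by metis
  \<comment> \<open>An index to which no zero is assigned gets the empty product, the constant
    1.\<close>
  define P where "P j = (\<Prod>x\<in>#filter_mset (\<lambda>x. J x = j) M. [:- x, 1:])" for j
  have lin: "degree (\<Prod>x\<in>#A. [:- x, 1:]) = size A \<and> (\<Prod>x\<in>#A. [:- x, 1:]) \<noteq> 0 \<and>
      cmod (poly (\<Prod>x\<in>#A. [:- x, 1:]) z) = (\<Prod>x\<in>#A. cmod (z - x))" for A :: "complex multiset" and z
  proof (induction A)
    case (add x A)
    have "poly (\<Prod>x\<in>#add_mset x A. [:- x, 1:]) z = (z - x) * poly (\<Prod>x\<in>#A. [:- x, 1:]) z"
      by (simp add: algebra_simps)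
    then show ?case using add by (simp add: degree_mult_eq norm_mult del: mult_pCons_left)
  qed simp
  have degP: "degree (P j) = size (filter_mset (\<lambda>x. J x = j) M)" for j using lin by (simp add: P_def)
  have sum_deg: "(\<Sum>j<m. degree (P j)) = size M" unfolding degP by (rule sum_size_filter_mset_eq[OF J(1)])
  have prodP: "(\<Prod>j<m. P j) = (\<Prod>x\<in>#M. [:- x, 1:])"
    unfolding P_def using prod_filter_mset_eq[where J = J and h = "\<lambda>_ x. [:- x, 1:]", OF J(1)] by simp
  have "exp (size M * (I - e)) \<le> exp (\<Sum>x\<in>#M. ln (wmax m c x))" using M(2) by (simp add: I_def)
  also have "\<dots> = (\<Prod>x\<in>#M. wmax m c x)"
    using ln_prod_mset[of M "wmax m c"] pos by (metis exp_ln)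
  also have "\<dots> = (\<Prod>x\<in>#M. w (c (J x)) * cmod (c (J x) - x))" using J(2) by (simp add: norm_minus_commute)
  also have "\<dots> = (\<Prod>j<m. \<Prod>x\<in>#filter_mset (\<lambda>x. J x = j) M. w (c j) * cmod (c j - x))"
    using prod_filter_mset_eq[where J = J and h = "\<lambda>j x. w (c j) * cmod (c j - x)", OF J(1)] by simp
  also have "\<dots> = (\<Prod>j<m. w (c j) ^ degree (P j) * cmod (poly (P j) (c j)))"
    unfolding degP using lin by (simp add: P_def prod_mset.distrib prod_mset_const)
  also have "\<dots> \<le> (\<Prod>j<m. wnorm E w (degree (P j)) (P j))"
    using c w_nonneg by (intro prod_mono) (auto intro!: wnorm_ge)
  finally have 1: "exp (size M * (I - e)) \<le> (\<Prod>j<m. wnorm E w (degree (P j)) (P j))" .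
  have 2: "wnorm E w (size M) (\<Prod>j<m. P j) \<le> exp (size M * (3 * e - F))"
    unfolding wnorm_def prodP
  proof (rule cSUP_least[OF E_nonempty])
    fix z assume "z \<in> E"
    then show "w z ^ size M * cmod (poly (\<Prod>x\<in>#M. [:- x, 1:]) z) \<le> exp (size M * (3 * e - F))"
      using M(3)[of z] lin by (simp add: prod_mset.distrib prod_mset_const)
  qed
  have "exp (size M * C) * wnorm E w (size M) (\<Prod>j<m. P j) \<le> exp (size M * C) * exp (size M * (3 * e - F))"
    using 2 by (intro mult_left_mono) auto
  also have "\<dots> = exp (size M * (C + 3 * e - F))" by (simp add: exp_add[symmetric] algebra_simps)
  also have "\<dots> < exp (size M * (I - e))"
  proof -
    have "C = I + F - 5 * e" by (simp add: e_def field_simps)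
    then have "C + 3 * e - F < I - e" using e by simp
    then show ?thesis using M(1) by (simp add: nonempty_has_size)
  qed
  also note 1
  finally have "exp (size M * C) * wnorm E w (size M) (\<Prod>j<m. P j) < (\<Prod>j<m. wnorm E w (degree (P j)) (P j))" .
  then have "\<not> prod_ineq E w m P (ereal C)"
    unfolding prod_ineq_def Let_def sum_deg by (simp add: eexp_def)
  then show ?thesis by blast
qed

lemma CEw_approx:
  assumes "C < CEw E w \<mu> F"
  obtains m where "m \<ge> 2" "ereal C < CEwm E w \<mu> F m"
proof -
  let ?d = "farthest_dist E w"
  define \<epsilon> where "\<epsilon> = (CEw E w \<mu> F - C) / 2"
  have \<epsilon>: "\<epsilon> > 0" using assms by (simp add: \<epsilon>_def)
  obtain W where W: "W > 0" "\<And>z. z \<in> E \<Longrightarrow> w z \<le> W" by (rule w_bounded) blast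
  obtain z0 where z0: "z0 \<in> msupp \<mu>" "\<And>z. z \<in> msupp \<mu> \<Longrightarrow> ?d z0 \<le> ?d z"
    using continuous_attains_inf[OF compact_support S_nonempty continuous_farthest_dist] by auto
  \<comment> \<open>On the support an additive loss \<open>h\<close> costs at most a factor
    \<open>exp (- \<epsilon>)\<close>, because the farthest-point distance is there at least its
    minimum \<open>?d z0\<close>.\<close>
  define h where "h = ?d z0 * (1 - exp (- \<epsilon>))"
  have h: "h > 0" using farthest_dist_pos \<epsilon> by (simp add: h_def)
  \<comment> \<open>The denominator counts the losses: one \<open>\<delta>\<close> for the
    near-maximizer \<open>\<tau> x\<close>, and \<open>W * \<delta>\<close> twice for moving between
    \<open>z\<close> and the centre \<open>x\<close>, once in the farthest-point distance and once
    in the weighted distance to \<open>\<tau> x\<close>.\<close>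
  define \<delta> where "\<delta> = h / (1 + 2 * W)"
  have \<delta>: "\<delta> > 0" "\<delta> * (1 + 2 * W) = h" using h W(1) by (auto simp: \<delta>_def)
  have "msupp \<mu> \<subseteq> (\<Union>z\<in>msupp \<mu>. ball z \<delta>)" using \<delta>(1) by force
  then obtain T where T: "T \<subseteq> msupp \<mu>" "finite T" "msupp \<mu> \<subseteq> (\<Union>z\<in>T. ball z \<delta>)"
    by (rule compactE_image[OF compact_support, rotated]) auto
  obtain xs where xs: "set xs = T" using finite_list[OF T(2)] by blast
  have "\<exists>t\<in>E. ?d x - \<delta> < w t * cmod (x - t)" for x
    using less_cSUP_iff[OF E_nonempty w_dist_bdd_above, of "?d x - \<delta>" x] \<delta>(1) by (simp add: farthest_dist_def)
  then obtain \<tau> where \<tau>: "\<And>x. \<tau> x \<in> E" "\<And>x. ?d x - \<delta> < w (\<tau> x) * cmod (x - \<tau> x)" by metis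
  \<comment> \<open>Two further indices, sent to a support point: they secure
    \<open>m \<ge> 2\<close> and a point of positive weight.\<close>
  define m where "m = length xs + 2"
  define c where "c k = (if k < length xs then \<tau> (xs ! k) else z0)" for k
  have m1: "m \<ge> 1" by (simp add: m_def)
  have c: "c k \<in> E" for k using \<tau>(1) z0(1) support_subset by (auto simp: c_def)
  have ge: "?d z * exp (- \<epsilon>) \<le> wmax m c z" if z: "z \<in> msupp \<mu>" for z
  proof -
    obtain x where x: "x \<in> T" "dist x z < \<delta>" using T(3) z by (auto simp: subset_iff)
    then obtain k where k: "k < length xs" "xs ! k = x" using xs by (metis in_set_conv_nth)
    let ?t = "\<tau> x"
    have "cmod (x - ?t) \<le> cmod (z - ?t) + cmod (x - z)" using norm_triangle_ineq[of "z - ?t" "x - z"] by simp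
    then have "w ?t * cmod (x - ?t) \<le> w ?t * (cmod (z - ?t) + cmod (x - z))"
      using w_nonneg[OF \<tau>(1)] by (intro mult_left_mono)
    also have "\<dots> \<le> w ?t * cmod (z - ?t) + W * \<delta>"
      using x(2) W(2)[OF \<tau>(1)] W(1) w_nonneg[OF \<tau>(1)] unfolding distrib_left by (intro add_mono mult_mono) (auto simp: dist_norm)
    also have "w ?t * cmod (z - ?t) \<le> wmax m c z"
      using wmax_ge[of k m c z] k by (simp add: c_def m_def)
    finally have 1: "w ?t * cmod (x - ?t) \<le> wmax m c z + W * \<delta>" by simp
    have "?d z \<le> ?d x + W * cmod (z - x)" by (rule farthest_dist_lipschitz[OF W(2)])
    also have "\<dots> \<le> ?d x + W * \<delta>" using x(2) W(1) by (simp add: dist_norm norm_minus_commute)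
    finally have "?d z \<le> wmax m c z + \<delta> * (1 + 2 * W)" using 1 \<tau>(2)[of x] by (simp add: algebra_simps)
    moreover have "h \<le> ?d z * (1 - exp (- \<epsilon>))"
      unfolding h_def using z0(2)[OF z] \<epsilon> by (intro mult_right_mono) auto
    ultimately show ?thesis using \<delta>(2) by (simp add: algebra_simps)
  qed
  have last: "length xs < m" "w (c (length xs)) > 0"
    using equilibrium_on_support(1)[OF z0(1)] by (auto simp: m_def c_def)
  have i: "integrable \<mu> (\<lambda>z. ln (wmax m c z))" by (rule wmax_integrable[where c = c, OF m1 _ last]) (rule c)
  have id: "integrable \<mu> (\<lambda>z. ln (?d z))"
    by (intro integrable_ln_continuous_pos continuous_farthest_dist farthest_dist_pos)
  have "(\<integral>z. ln (?d z) \<partial>\<mu>) - \<epsilon> = (\<integral>z. ln (?d z) - \<epsilon> \<partial>\<mu>)" using id by (simp add: prob_space[simplified])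
  also have "\<dots> \<le> (\<integral>z. ln (wmax m c z) \<partial>\<mu>)"
  proof (rule integral_mono_AE)
    show "AE z in \<mu>. ln (?d z) - \<epsilon> \<le> ln (wmax m c z)"
      using AE_support
    proof eventually_elim
      case (elim z)
      have "ln (?d z) - \<epsilon> = ln (?d z * exp (- \<epsilon>))" using farthest_dist_pos[of z] by (subst ln_mult_pos) auto
      also have "\<dots> \<le> ln (wmax m c z)" using ge[OF elim] farthest_dist_pos[of z] by (intro ln_mono) auto
      finally show ?case .
    qed
  qed (use i id in auto)
  finally have "C < (\<integral>z. ln (wmax m c z) \<partial>\<mu>) + F" using \<epsilon> by (simp add: \<epsilon>_def CEw_def field_simps)
  moreover obtain C' where C': "CEwm E w \<mu> F m = ereal C'"
    and le: "\<And>c k. (\<And>k. k < m \<Longrightarrow> c k \<in> E) \<Longrightarrow> k < m \<Longrightarrow> w (c k) > 0 \<Longrightarrow> (\<integral>z. ln (wmax m c z) \<partial>\<mu>) + F \<le> C'"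
    by (rule CEwm_real[OF m1]) blast
  moreover have "(\<integral>z. ln (wmax m c z) \<partial>\<mu>) + F \<le> C'" by (rule le[of c, OF _ last]) (rule c)
  ultimately show thesis using that[of m] by (simp add: m_def)
qed

end

theorem theorem3p1:
  fixes E :: "complex set" and w :: "complex \<Rightarrow> real" and \<mu> :: "complex measure" and F :: real
  assumes "closed E"
    and "admissible_weight E w"
    and "is_weighted_equilibrium E w \<mu> F"
  shows "(\<forall>m\<ge>1. \<forall>P :: nat \<Rightarrow> complex poly.
            prod_ineq E w m P (CEwm E w \<mu> F m)
          \<and> (let n = (\<Sum>j<m. degree (P j)) in
               eexp (ereal (real n) * CEwm E w \<mu> F m) * ereal (wnorm E w n (\<Prod>j<m. P j))
                 \<le> ereal (exp (real n * CEw E w \<mu> F) * wnorm E w n (\<Prod>j<m. P j))))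
       \<and> (\<forall>m\<ge>2. \<forall>c::real. ereal c < CEwm E w \<mu> F m \<longrightarrow>
            (\<exists>P :: nat \<Rightarrow> complex poly. \<not> prod_ineq E w m P (ereal c)))
       \<and> (\<forall>c::real. c < CEw E w \<mu> F \<longrightarrow>
            (\<exists>m\<ge>1. \<exists>P :: nat \<Rightarrow> complex poly. \<not> prod_ineq E w m P (ereal c)))"
proof -
  interpret weighted_equilibrium E w \<mu> F using assms by unfold_locales
  show ?thesis
  proof (intro conjI allI impI)
    fix m :: nat and P :: "nat \<Rightarrow> complex poly" assume m: "m \<ge> 1"
    obtain C where C: "CEwm E w \<mu> F m = ereal C" "C \<le> CEw E w \<mu> F" by (rule CEwm_real[OF m]) blast
    show "prod_ineq E w m P (CEwm E w \<mu> F m)"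
      unfolding prod_ineq_def Let_def C(1) using prod_ineq_upper[OF m C(1) refl, of P] by (simp add: eexp_def)
    define n where "n = (\<Sum>j<m. degree (P j))"
    \<comment> \<open>Multiplying the comparison of exponentials by the norm needs its sign. If some
      \<open>P j\<close> is zero, \<open>n\<close> need not be the degree of the product, and
      \<open>wnorm_nonneg\<close> does not apply directly.\<close>
    have "0 \<le> wnorm E w n (\<Prod>j<m. P j)"
    proof (cases "\<exists>j<m. P j = 0")
      case True
      then have "(\<Prod>j<m. P j) = 0" by (auto intro: prod_zero)
      moreover have "wnorm E w n 0 = 0" using E_nonempty by (simp add: wnorm_def)
      ultimately show ?thesis by (simp only: order_refl)
    next
      case False
      then have "n = degree (\<Prod>j<m. P j)" unfolding n_def by (subst degree_prod_eq_sum_degree) auto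
      then show ?thesis using wnorm_nonneg by simp
    qed
    then show "let n = (\<Sum>j<m. degree (P j)) in
               eexp (ereal (real n) * CEwm E w \<mu> F m) * ereal (wnorm E w n (\<Prod>j<m. P j))
                 \<le> ereal (exp (real n * CEw E w \<mu> F) * wnorm E w n (\<Prod>j<m. P j))"
      unfolding Let_def C(1) n_def[symmetric] using C(2)
      by (auto simp: eexp_def intro!: mult_right_mono mult_left_mono)
  next
    fix m :: nat and c :: real assume "m \<ge> 2" "ereal c < CEwm E w \<mu> F m"
    then show "\<exists>P. \<not> prod_ineq E w m P (ereal c)" by (rule prod_ineq_fails)
  next
    fix c :: real assume "c < CEw E w \<mu> F"
    then obtain m where m: "m \<ge> 2" "ereal c < CEwm E w \<mu> F m" by (rule CEw_approx)
    have "m \<ge> 1" using m(1) by simp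
    then show "\<exists>m\<ge>1. \<exists>P. \<not> prod_ineq E w m P (ereal c)" using prod_ineq_fails[OF m] by blast
  qed
qed

end
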